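(* Fix the total energy $h\in\mathbb{R}$ of the $D_2$-equivariant four-vortex problem. The set of initial conditions whose (generalized) solution leads to total collapse, or leads in an infinite amount of (rescaled) time $\zeta$ to the outermost boundary of the region where the motion is allowed (the zero velocity set $\hat E(h,r,\alpha)=0$), has zero Lebesgue measure.
   Context: Four vortices are located at $(\pm q_1,\pm q_2)$ in the plane (an orbit of the Klein group $D_2$), with $\vec q=(q_1,q_2)$ obeying $\pi\,\ddot{\vec q}=\partial U/\partial \vec q$, $U(\vec q)=-\log(8\|\vec q\|\,|q_1q_2|)$, momentum $\vec p=\pi\dot{\vec q}$, and total energy $h=\frac{1}{2\pi}\|\vec p\|^2-U(\vec q)$. For fixed $h$ the phase space is described, in the fundamental domain $q_1,q_2>0$, by coordinates $(r,\alpha,\psi)$, $r>0$, $\alpha\in(0,\pi/2)$, $\psi\in\mathbb{R}/2\pi\mathbb{Z}$, through $q_1=re^{-1/r^2}\cos\alpha$, $q_2=re^{-1/r^2}\sin\alpha$, $p_1=\frac{\sqrt{\pi\hat E}}{r}\cos\psi$, $p_2=\frac{\sqrt{\pi\hat E}}{r}\sin\psi$, where $$\hat E(h,r,\alpha)=2\left[h r^2+3(1-r^2\log r)\right]-2r^2\log(4\sin 2\alpha)$$ and the allowed region is $\hat E\ge 0$. Initial conditions are points $(r,\alpha,\psi)$ of the allowed region, with Lebesgue measure of $\mathbb{R}^3$. With the rescaled time $\zeta$ defined by $d\sigma=r^2e^{-1/r^2}\sqrt{\hat E}\,d\zeta$ ($\sigma$ the original time) the motion is $$\frac{dr}{d\zeta}=\frac{1}{\sqrt\pi}\frac{r^3}{r^2+2}\hat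 E\cos(\psi-\alpha),\quad \frac{d\alpha}{d\zeta}=\frac{1}{\sqrt\pi}\hat E\sin(\psi-\alpha),\quad \frac{d\psi}{d\zeta}=-\frac{r^2}{\sqrt\pi}\left[\frac{2\cos(\psi+\alpha)}{\sin2\alpha}-\sin(\psi-\alpha)\right],$$ and both total collapse ($r\to0$, all four vortices colliding at the origin) and the zero velocity set $\hat E=0$ are approached only asymptotically as $\zeta\to+\infty$. A binary collision is an instant at which exactly one of $q_1,q_2$ vanishes. A generalized solution is a continuous curve $\vec q(\sigma)$ which is a $C^2$ classical solution of energy $h$ except at finitely many instants, at which it has a binary collision and is continued by transmission: the vanishing coordinate passes through zero and changes sign, the other coordinate and its momentum are continuous, and the energy is unchanged. By the $D_2$ symmetry a solution in any quadrant is represented in the fundamental domain by reflecting it to $q_1,q_2>0$. A generalized solution leads to total collapse (respectively to the zero velocity set) if, after finitely many (possibly zero) binary collisions, its last classical arc satisfies $r\to0$ (respectively converges to a point with $\hat E=0$) as $\zeta\to+\infty$. *)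

theory Defs
  imports "HOL-Analysis.Analysis"
begin

section \<open>The vortex problem in Cartesian coordinates\<close>

definition potential :: "real \<times> real \<Rightarrow> real" where
  "potential q = - ln (8 * norm q * \<bar>fst q * snd q\<bar>)"

text \<open>
  \<open>p\<close> is the momentum \<open>pi * q'\<close>, so that \<open>p' = pi * q''\<close> is the gradient of the potential.
  That \<open>q\<close> is twice continuously differentiable is automatic, since the gradient is continuous
  off the coordinate axes.
\<close>

definition classical_solution_on ::
    "real \<Rightarrow> real set \<Rightarrow> (real \<Rightarrow> real \<times> real) \<Rightarrow> (real \<Rightarrow> real \<times> real) \<Rightarrow> bool" where
  "classical_solution_on h I q p \<longleftrightarrow>
     (\<forall>t\<in>I. fst (q t) \<noteq> 0 \<and> snd (q t) \<noteq> 0 \<and>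
        (q has_vector_derivative (1 / pi) *\<^sub>R p t) (at t within I) \<and>
        (\<exists>F. GDERIV potential (q t) :> F \<and> (p has_vector_derivative F) (at t within I)) \<and>
        (norm (p t))\<^sup>2 / (2 * pi) - potential (q t) = h)"

text \<open>
  At time \<open>t\<close> the coordinate \<open>x\<close> vanishes and changes sign, while the other coordinate \<open>y\<close>
  and its momentum \<open>py\<close> are continuous. The momentum conjugate to \<open>x\<close> diverges at \<open>t\<close>,
  so nothing is required of it.
\<close>

definition transmits_at ::
    "(real \<Rightarrow> real) \<Rightarrow> (real \<Rightarrow> real) \<Rightarrow> (real \<Rightarrow> real) \<Rightarrow> real \<Rightarrow> bool" where
  "transmits_at x y py t \<longleftrightarrow>
     x t = 0 \<and> y t \<noteq> 0 \<and>
     (\<exists>s\<in>{-1, 1}. (\<forall>\<^sub>F u in at_left t. sgn (x u) = s) \<and> (\<forall>\<^sub>F u in at_right t. sgn (x u) = - s)) \<and>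
     isCont y t \<and> isCont py t"

definition binary_collision_at ::
    "(real \<Rightarrow> real \<times> real) \<Rightarrow> (real \<Rightarrow> real \<times> real) \<Rightarrow> real \<Rightarrow> bool" where
  "binary_collision_at q p t \<longleftrightarrow>
     transmits_at (fst \<circ> q) (snd \<circ> q) (snd \<circ> p) t \<or>
     transmits_at (snd \<circ> q) (fst \<circ> q) (fst \<circ> p) t"

definition time_domain :: "ereal \<Rightarrow> real set" where
  "time_domain T = {t. 0 \<le> t \<and> ereal t < T}"

text \<open>
  A generalized solution on the time interval from 0 (included) to \<open>T\<close> (excluded, possibly
  infinite), with set \<open>C\<close> of collision instants. The interval is not required to be maximal;
  in particular a total collapse takes place at its excluded end \<open>T\<close>.
\<close>

definition generalized_solution ::
    "real \<Rightarrow> ereal \<Rightarrow> real set \<Rightarrow> (real \<Rightarrow> real \<times> real) \<Rightarrow> (real \<Rightarrow> real \<times> real) \<Rightarrow> bool" where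
  "generalized_solution h T C q p \<longleftrightarrow>
     0 < T \<and> continuous_on (time_domain T) q \<and>
     finite C \<and> C \<subseteq> time_domain T - {0} \<and>
     classical_solution_on h (time_domain T - C) q p \<and>
     (\<forall>t\<in>C. binary_collision_at q p t)"

section \<open>Regularized coordinates\<close>

definition E_hat :: "real \<Rightarrow> real \<Rightarrow> real \<Rightarrow> real" where
  "E_hat h r \<alpha> = 2 * (h * r\<^sup>2 + 3 * (1 - r\<^sup>2 * ln r)) - 2 * r\<^sup>2 * ln (4 * sin (2 * \<alpha>))"

definition position :: "real \<Rightarrow> real \<Rightarrow> real \<times> real" where
  "position r \<alpha> = (r * exp (- 1 / r\<^sup>2) * cos \<alpha>, r * exp (- 1 / r\<^sup>2) * sin \<alpha>)"

definition momentum :: "real \<Rightarrow> real \<Rightarrow> real \<Rightarrow> real \<Rightarrow> real \<times> real" where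
  "momentum h r \<alpha> \<psi> =
     (sqrt (pi * E_hat h r \<alpha>) / r * cos \<psi>, sqrt (pi * E_hat h r \<alpha>) / r * sin \<psi>)"

text \<open>The angle \<open>\<psi>\<close>, an element of the circle, is represented in \<open>{0..<2 * pi}\<close>.\<close>

definition allowed_region :: "real \<Rightarrow> (real \<times> real \<times> real) set" where
  "allowed_region h =
     {(r, \<alpha>, \<psi>). 0 < r \<and> 0 < \<alpha> \<and> \<alpha> < pi / 2 \<and> 0 \<le> \<psi> \<and> \<psi> < 2 * pi \<and> 0 \<le> E_hat h r \<alpha>}"

definition solution_from ::
    "real \<Rightarrow> real \<times> real \<times> real \<Rightarrow> ereal \<Rightarrow> real set \<Rightarrow>
     (real \<Rightarrow> real \<times> real) \<Rightarrow> (real \<Rightarrow> real \<times> real) \<Rightarrow> bool" where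
  "solution_from h x T C q p \<longleftrightarrow>
     generalized_solution h T C q p \<and>
     (case x of (r, \<alpha>, \<psi>) \<Rightarrow> q 0 = position r \<alpha> \<and> p 0 = momentum h r \<alpha> \<psi>)"

definition last_arc :: "ereal \<Rightarrow> real set \<Rightarrow> real set" where
  "last_arc T C = {t \<in> time_domain T. \<forall>c\<in>C. c < t}"

definition reflect :: "real \<times> real \<Rightarrow> real \<times> real" where
  "reflect v = (\<bar>fst v\<bar>, \<bar>snd v\<bar>)"

text \<open>
  The last arc, from some instant \<open>\<sigma> 0\<close> on, seen in rescaled time \<open>\<zeta> \<ge> 0\<close>: \<open>\<sigma> \<zeta>\<close> is the original
  time, and \<open>r \<zeta>\<close>, \<open>\<alpha> \<zeta>\<close> are the coordinates of the position reflected to the fundamental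
  domain. The angle \<open>\<psi>\<close> is not needed, since it enters neither the time change nor \<open>E_hat\<close>.
  On the zero velocity set \<open>\<sigma>\<close> stands still, consistently with the rescaled motion, under which
  \<open>r\<close> and \<open>\<alpha>\<close> are constant there.
\<close>

definition rescaled_last_arc ::
    "real \<Rightarrow> ereal \<Rightarrow> real set \<Rightarrow> (real \<Rightarrow> real \<times> real) \<Rightarrow>
     (real \<Rightarrow> real) \<Rightarrow> (real \<Rightarrow> real) \<Rightarrow> (real \<Rightarrow> real) \<Rightarrow> bool" where
  "rescaled_last_arc h T C q \<sigma> r \<alpha> \<longleftrightarrow>
     (\<forall>\<zeta>\<ge>0. \<sigma> \<zeta> \<in> last_arc T C \<and>
        0 < r \<zeta> \<and> 0 < \<alpha> \<zeta> \<and> \<alpha> \<zeta> < pi / 2 \<and>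
        reflect (q (\<sigma> \<zeta>)) = position (r \<zeta>) (\<alpha> \<zeta>) \<and>
        (\<sigma> has_real_derivative (r \<zeta>)\<^sup>2 * exp (- 1 / (r \<zeta>)\<^sup>2) * sqrt (E_hat h (r \<zeta>) (\<alpha> \<zeta>)))
          (at \<zeta> within {0..}))"

definition leads_to_total_collapse :: "real \<Rightarrow> real \<times> real \<times> real \<Rightarrow> bool" where
  "leads_to_total_collapse h x \<longleftrightarrow>
     (\<exists>T C q p \<sigma> r \<alpha>. solution_from h x T C q p \<and> rescaled_last_arc h T C q \<sigma> r \<alpha> \<and>
        (r \<longlongrightarrow> 0) at_top)"

definition leads_to_zero_velocity :: "real \<Rightarrow> real \<times> real \<times> real \<Rightarrow> bool" where
  "leads_to_zero_velocity h x \<longleftrightarrow>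
     (\<exists>T C q p \<sigma> r \<alpha>. solution_from h x T C q p \<and> rescaled_last_arc h T C q \<sigma> r \<alpha> \<and>
        (\<exists>r\<^sub>0 \<alpha>\<^sub>0. 0 < r\<^sub>0 \<and> 0 < \<alpha>\<^sub>0 \<and> \<alpha>\<^sub>0 < pi / 2 \<and> E_hat h r\<^sub>0 \<alpha>\<^sub>0 = 0 \<and>
           (r \<longlongrightarrow> r\<^sub>0) at_top \<and> (\<alpha> \<longlongrightarrow> \<alpha>\<^sub>0) at_top))"

end

theory Submission
  imports Defs "HOL-Real_Asymp.Real_Asymp"
begin

text \<open>
  The proof is a flux argument. Take the states \<open>(q, p)\<close> of all energies together, so that the phase
  space has four dimensions and the motion preserves its Lebesgue measure. The states that collapse
  in a time between \<open>k / n\<close> and \<open>(k + 1) / n\<close> are carried by the motion to states that collapse in a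
  time at most \<open>1 / n\<close>; if these have measure \<open>o(1 / n)\<close>, adding up over \<open>k\<close> gives a null set
  (\<open>negligible_zero_flux\<close>). For total collapse the estimate holds because \<open>\<bar>q\<bar>\<close> is at most of the order
  of the remaining time multiplied by \<open>1 + \<bar>p\<bar>\<close> (\<open>collapse_position_bound\<close>), where \<open>\<bar>p\<bar>\<^sup>2\<close> is only
  logarithmically large outside thin neighbourhoods of the axes, whereas the measure of the part of an
  energy shell of bounded width above a set of positions is at most proportional to the area of that
  set (\<open>emeasure_energy_shell_le\<close>). For arrival at the zero velocity set the momentum is at most of the
  order of the remaining time.

  Only one inequality is needed from the invariance of the measure, and it requires neither a flow
  nor the dependence of solutions on the initial state. The symplectic Euler method is a composition
  of shears, hence preserves measure, and converges pointwise to any given classical solution; if the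
  solution ends in an open set \<open>B\<close>, the approximations are eventually in \<open>B\<close>, and the lower limit of the
  preimages of \<open>B\<close> has measure at most that of \<open>B\<close> (\<open>flows_to_outer_measure\<close>).

  Binary collisions are treated by induction on their number. With the vanishing coordinate \<open>u\<close> in the
  place of time, the other coordinate and its momentum solve an equation that is Lipschitz continuous
  in them and in the energy across \<open>u = 0\<close>, so by Gronwall's inequality the state before a collision
  is a Lipschitz continuous function of the state after it (\<open>negligible_crossing_pair\<close>), and null
  sets are carried back to null sets.

  The energy is fixed again by the scaling symmetry \<open>(q, p) \<mapsto> (l q, p)\<close>, which shifts the energy by
  \<open>3 ln l\<close>. The exceptional initial conditions of energy \<open>h\<close>, multiplied by the half line of scaling
  factors \<open>l\<close>, are mapped by an immersion into the null set of exceptional states, and therefore form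
  a null set of \<open>\<real>\<^sup>4\<close>, a slice of which is the set in question.
\<close>

section \<open>Measure preserving maps and their limits\<close>

lemma distr_shear_snd:
  fixes g :: "'a::euclidean_space \<Rightarrow> 'b::euclidean_space"
  assumes g [measurable]: "g \<in> borel_measurable borel"
  shows "distr lborel borel (\<lambda>z. (fst z, snd z + g (fst z))) = lborel"
proof (rule measure_eqI)
  show "sets (distr lborel borel (\<lambda>z. (fst z, snd z + g (fst z)))) = sets lborel"
    by simp
next
  fix A :: "('a \<times> 'b) set"
  assume "A \<in> sets (distr lborel borel (\<lambda>z. (fst z, snd z + g (fst z))))"
  then have A [measurable]: "A \<in> sets borel" by simp
  define S where "S = (\<lambda>z. (fst z, snd z + g (fst z)))"
  have S [measurable]: "S \<in> borel_measurable borel"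
    unfolding S_def
    by (intro borel_measurable_Pair borel_measurable_add measurable_compose[OF _ g]
        borel_measurable_continuous_onI continuous_intros)
  have SA: "S -` A \<in> sets borel"
    using measurable_sets[OF S A] by simp
  have slice: "emeasure lborel (Pair x -` (S -` A)) = emeasure lborel (Pair x -` A)" for x
  proof -
    have "Pair x -` A \<in> sets borel"
      using A measurable_sets[of "Pair x" borel borel A] by simp
    then have "emeasure (distr lborel borel ((+) (g x))) (Pair x -` A)
        = emeasure lborel ((+) (g x) -` (Pair x -` A))"
      by (simp add: emeasure_distr)
    moreover have "(+) (g x) -` (Pair x -` A) = Pair x -` (S -` A)"
      by (auto simp: S_def add.commute)
    ultimately show ?thesis by (simp add: lborel_distr_plus)
  qed
  have pair: "emeasure lborel B = (\<integral>\<^sup>+x. emeasure lborel (Pair x -` B) \<partial>lborel)"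
    if "B \<in> sets borel" for B :: "('a \<times> 'b) set"
    using that lborel.emeasure_pair_measure_alt[of B lborel, unfolded lborel_prod] by simp
  have "emeasure (distr lborel borel S) A = emeasure lborel (S -` A)"
    by (subst emeasure_distr) auto
  also have "\<dots> = emeasure lborel A"
    using pair[OF SA] pair[OF A] slice by simp
  finally show "emeasure (distr lborel borel (\<lambda>z. (fst z, snd z + g (fst z)))) A = emeasure lborel A"
    by (simp add: S_def)
qed

lemma distr_shear_fst:
  fixes g :: "'b::euclidean_space \<Rightarrow> 'a::euclidean_space"
  assumes g [measurable]: "g \<in> borel_measurable borel"
  shows "distr lborel borel (\<lambda>z. (fst z + g (snd z), snd z)) = lborel"
proof -
  have swap: "distr (lborel :: ('u::euclidean_space \<times> 'v::euclidean_space) measure) borel prod.swap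
      = lborel"
  proof -
    have *: "(\<lambda>(x, y). (y, x)) = (prod.swap :: 'u \<times> 'v \<Rightarrow> _)" by auto
    have "(lborel :: ('v \<times> 'u) measure) = distr (lborel :: ('u \<times> 'v) measure) lborel prod.swap"
      using lborel_pair.distr_pair_swap[where ?'a='v and ?'b='u]
      unfolding lborel_prod * .
    also have "\<dots> = distr lborel borel prod.swap" by (rule distr_cong) auto
    finally show ?thesis by (rule sym)
  qed
  have m: "(prod.swap :: 'u::euclidean_space \<times> 'v::euclidean_space \<Rightarrow> _) \<in> borel_measurable borel"
    unfolding prod.swap_def
    by (intro borel_measurable_continuous_onI continuous_intros)
  define S where "S = (\<lambda>z::'b \<times> 'a. (fst z, snd z + g (fst z)))"
  have S: "S \<in> borel_measurable borel"
    unfolding S_def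
    by (intro borel_measurable_Pair borel_measurable_add measurable_compose[OF _ g]
        borel_measurable_continuous_onI continuous_intros)
  have "(\<lambda>z. (fst z + g (snd z), snd z)) = prod.swap \<circ> (S \<circ> prod.swap)"
    by (auto simp: S_def)
  moreover have "distr (distr lborel borel (S \<circ> prod.swap)) borel prod.swap
      = distr lborel borel (prod.swap \<circ> (S \<circ> prod.swap))"
    by (rule distr_distr) (use m measurable_comp[OF m S] in auto)
  moreover have "distr (distr lborel borel prod.swap) borel S = distr lborel borel (S \<circ> prod.swap)"
    by (rule distr_distr) (use m S in auto)
  ultimately have "distr lborel borel (\<lambda>z. (fst z + g (snd z), snd z))
     = distr (distr (distr lborel borel prod.swap) borel S) borel prod.swap"
    by simp
  also have "\<dots> = lborel"
    unfolding swap using distr_shear_snd[OF g] by (simp add: S_def swap)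
  finally show ?thesis .
qed

lemma distr_funpow:
  fixes f :: "'a::euclidean_space \<Rightarrow> 'a"
  assumes f [measurable]: "f \<in> borel_measurable borel" and d: "distr lborel borel f = lborel"
  shows "(f ^^ n) \<in> borel_measurable borel \<and> distr lborel borel (f ^^ n) = lborel"
proof (induction n)
  case 0
  have "distr lborel borel (\<lambda>x::'a. x) = lborel"
    by (rule distr_id2) simp
  then show ?case by (simp add: id_def)
next
  case (Suc n)
  then have m [measurable]: "(f ^^ n) \<in> borel_measurable borel" by simp
  have "distr (distr lborel borel (f ^^ n)) borel f = distr lborel borel (f \<circ> (f ^^ n))"
    by (rule distr_distr) auto
  then show ?case using Suc d by (simp add: comp_def)
qed

text \<open>
  No regularity of the limit map is needed here: pointwise convergence of measure preserving maps
  is enough for the limit not to decrease the outer measure.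
\<close>
lemma outer_measure_limit_preimage:
  fixes P :: "nat \<Rightarrow> 'a::euclidean_space \<Rightarrow> 'a"
  assumes m: "\<And>n. P n \<in> borel_measurable borel" and d: "\<And>n. distr lborel borel (P n) = lborel"
    and B: "open B"
  obtains U where "U \<in> sets borel" "emeasure lborel U \<le> emeasure lborel B"
    "\<And>z w. ((\<lambda>n. P n z) \<longlonglongrightarrow> w) \<Longrightarrow> w \<in> B \<Longrightarrow> z \<in> U"
proof
  define V where "V = (\<lambda>k. \<Inter>n\<in>{k..}. P n -` B)"
  have PB: "P n -` B \<in> sets borel" for n
    using measurable_sets[OF m[of n], of B] B by simp
  have V: "V k \<in> sets borel" for k
    unfolding V_def by (intro sets.countable_INT') (use PB in auto)
  show "(\<Union>k. V k) \<in> sets borel" using V by auto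
  have "emeasure lborel (V k) \<le> emeasure lborel B" for k
  proof -
    have "emeasure lborel (V k) \<le> emeasure lborel (P k -` B)"
      by (rule emeasure_mono) (use PB in \<open>auto simp: V_def\<close>)
    also have "\<dots> = emeasure (distr lborel borel (P k)) B"
      using m[of k] B by (simp add: emeasure_distr)
    finally show ?thesis by (simp add: d)
  qed
  moreover have "(SUP k. emeasure lborel (V k)) = emeasure lborel (\<Union>k. V k)"
    by (rule SUP_emeasure_incseq) (use V in \<open>auto simp: incseq_def V_def\<close>)
  ultimately show "emeasure lborel (\<Union>k. V k) \<le> emeasure lborel B"
    using SUP_least[of UNIV "\<lambda>k. emeasure lborel (V k)" "emeasure lborel B"] by simp
  show "z \<in> (\<Union>k. V k)" if "(\<lambda>n. P n z) \<longlonglongrightarrow> w" "w \<in> B" for z w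
  proof -
    have "\<forall>\<^sub>F n in sequentially. P n z \<in> B"
      using that B by (simp add: topological_tendstoD)
    then obtain k where "\<forall>n\<ge>k. P n z \<in> B" by (auto simp: eventually_sequentially)
    then show ?thesis by (auto simp: V_def)
  qed
qed

text \<open>
  The usual error estimate: a local error of second order in the step makes the method converge.
  The estimate along the orbit is only required in a tube around it, in which the approximations
  remain when the step is small.
\<close>
lemma one_step_method_converges:
  fixes x :: "real \<Rightarrow> 'a::real_normed_vector" and S :: "real \<Rightarrow> 'a \<Rightarrow> 'a"
  assumes t: "0 \<le> t" and e: "0 < e" and L: "0 \<le> L" and C: "0 \<le> C"
    and step: "\<And>u d y. 0 \<le> u \<Longrightarrow> 0 \<le> d \<Longrightarrow> u + d \<le> t \<Longrightarrow> norm (y - x u) < e \<Longrightarrow>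
       norm (S d y - x (u + d)) \<le> (1 + L * d) * norm (y - x u) + C * d\<^sup>2"
  shows "(\<lambda>n. (S (t / real n) ^^ n) (x 0)) \<longlonglongrightarrow> x t"
proof -
  define b where "b = (\<lambda>n. C * t\<^sup>2 * exp (L * t) / real n)"
  have b0: "b \<longlonglongrightarrow> 0" unfolding b_def by (rule lim_const_over_n)
  have bound: "norm ((S (t / real n) ^^ n) (x 0) - x t) \<le> b n" if n: "n > 0" "b n < e" for n
  proof -
    define d where "d = t / real n"
    have d: "0 \<le> d" using t by (simp add: d_def)
    have nd: "real n * d = t" using n by (simp add: d_def)
    have small: "C * d\<^sup>2 * real k * (1 + L * d) ^ k \<le> b n" if "k \<le> n" for k
    proof -
      have "(1 + L * d) ^ k \<le> exp (L * d) ^ k"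
        using L d by (intro power_mono exp_ge_add_one_self) auto
      also have "\<dots> = exp (L * (real k * d))"
        by (simp add: exp_of_nat_mult[symmetric] mult_ac)
      also have "\<dots> \<le> exp (L * t)"
        using L nd d \<open>k \<le> n\<close> by (metis exp_le_cancel_iff mult_left_mono mult_right_mono of_nat_le_iff)
      finally have *: "(1 + L * d) ^ k \<le> exp (L * t)" .
      have "C * d\<^sup>2 * real k * (1 + L * d) ^ k \<le> C * d\<^sup>2 * real n * exp (L * t)"
        using * C d L that by (intro mult_mono) auto
      also have "\<dots> = b n"
        using n by (simp add: b_def d_def power2_eq_square field_simps)
      finally show ?thesis .
    qed
    have "k \<le> n \<Longrightarrow> norm ((S d ^^ k) (x 0) - x (real k * d)) \<le> C * d\<^sup>2 * real k * (1 + L * d) ^ k" for k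
    proof (induction k)
      case 0
      then show ?case by simp
    next
      case (Suc k)
      let ?y = "(S d ^^ k) (x 0)"
      have IH: "norm (?y - x (real k * d)) \<le> C * d\<^sup>2 * real k * (1 + L * d) ^ k"
        using Suc by simp
      then have lt: "norm (?y - x (real k * d)) < e" using small[of k] Suc n by linarith
      have le: "real k * d + d \<le> t"
      proof -
        have "real k * d + d = real (Suc k) * d" by (simp add: algebra_simps)
        also have "\<dots> \<le> real n * d" using Suc d by (intro mult_right_mono) auto
        finally show ?thesis by (simp add: nd)
      qed
      have "norm ((S d ^^ Suc k) (x 0) - x (real (Suc k) * d)) = norm (S d ?y - x (real k * d + d))"
        by (simp add: algebra_simps)
      also have "\<dots> \<le> (1 + L * d) * norm (?y - x (real k * d)) + C * d\<^sup>2"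
        using d le lt by (intro step) auto
      also have "\<dots> \<le> (1 + L * d) * (C * d\<^sup>2 * real k * (1 + L * d) ^ k) + C * d\<^sup>2"
        using L d IH by (intro add_right_mono mult_left_mono) auto
      also have "\<dots> \<le> (1 + L * d) * (C * d\<^sup>2 * real k * (1 + L * d) ^ k)
          + C * d\<^sup>2 * (1 + L * d) ^ Suc k"
      proof -
        have "1 \<le> (1 + L * d) ^ Suc k" using L d by (intro one_le_power) auto
        then show ?thesis using C d mult_left_mono[of 1 "(1 + L * d) ^ Suc k" "C * d\<^sup>2"] by simp
      qed
      also have "\<dots> = C * d\<^sup>2 * real (Suc k) * (1 + L * d) ^ Suc k" by (simp add: algebra_simps)
      finally show ?case .
    qed
    from this[of n] small[of n] nd show ?thesis by (simp add: d_def)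
  qed
  have "\<forall>\<^sub>F n in sequentially. norm ((S (t / real n) ^^ n) (x 0) - x t) \<le> b n"
    using order_tendstoD(2)[OF b0 e] eventually_gt_at_top[of 0] by eventually_elim (rule bound)
  then have "(\<lambda>n. (S (t / real n) ^^ n) (x 0) - x t) \<longlonglongrightarrow> 0"
    by (rule Lim_null_comparison) (rule b0)
  then show ?thesis by (simp add: LIM_zero_iff)
qed

section \<open>The equations of motion\<close>

text \<open>The gradient of the potential, given by its formula off the coordinate axes.\<close>
definition force :: "real \<times> real \<Rightarrow> real \<times> real" where
  "force q = - (q /\<^sub>R (norm q)\<^sup>2 + (1 / fst q, 1 / snd q))"

lemma potential_eq_sum_ln:
  assumes "fst q \<noteq> 0" "snd q \<noteq> 0"
  shows "potential q = - (ln 8 + ln (norm q) + ln (fst q) + ln (snd q))"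
proof -
  have "norm q \<noteq> 0" using assms by auto
  moreover have "ln \<bar>fst q * snd q\<bar> = ln (fst q * snd q)"
    by (metis abs_real_def ln_minus)
  ultimately show ?thesis
    using assms by (simp add: potential_def ln_mult)
qed

lemma DERIV_ln_nonzero: "x \<noteq> 0 \<Longrightarrow> DERIV ln x :> inverse x" for x :: real
proof (cases "0 < x")
  case False
  assume "x \<noteq> 0"
  with False have "DERIV ln (- x) :> inverse (- x)" by (intro DERIV_ln) auto
  then have "DERIV (\<lambda>x. ln (- x)) x :> inverse x"
    using DERIV_mirror[of ln "- inverse x" x] by (simp add: inverse_minus_eq)
  then show ?thesis by (simp add: ln_minus)
qed (simp add: DERIV_ln)

lemma open_off_axes: "open {q :: real \<times> real. fst q \<noteq> 0 \<and> snd q \<noteq> 0}"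
  by (intro open_Collect_conj open_Collect_neq continuous_intros)

lemma GDERIV_potential:
  assumes q: "fst q \<noteq> 0" "snd q \<noteq> 0"
  shows "GDERIV potential q :> force q"
proof -
  have n: "norm q \<noteq> 0" using q by auto
  have f: "GDERIV fst q :> (1, 0)" and s: "GDERIV snd q :> (0, 1)"
    by (auto simp: gderiv_def inner_prod_def intro: derivative_eq_intros)
  have N: "GDERIV norm q :> sgn q" using n by (intro GDERIV_norm) auto
  have "GDERIV (\<lambda>q. - (ln 8 + ln (norm q) + ln (fst q) + ln (snd q))) q :>
      - (0 + inverse (norm q) *\<^sub>R sgn q + inverse (fst q) *\<^sub>R (1, 0) + inverse (snd q) *\<^sub>R (0, 1))"
    by (intro GDERIV_minus GDERIV_add GDERIV_const GDERIV_DERIV_compose[OF N DERIV_ln_nonzero]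
        GDERIV_DERIV_compose[OF f DERIV_ln_nonzero] GDERIV_DERIV_compose[OF s DERIV_ln_nonzero] q n)
  then have "GDERIV (\<lambda>q. - (ln 8 + ln (norm q) + ln (fst q) + ln (snd q))) q :> force q"
    by (rule GDERIV_subst) (auto simp: force_def sgn_div_norm power2_eq_square divide_inverse prod_eq_iff)
  then show ?thesis unfolding gderiv_def
    by (rule has_derivative_transform_within_open[OF _ open_off_axes])
      (use q potential_eq_sum_ln in auto)
qed

lemma GDERIV_potential_unique:
  assumes "fst q \<noteq> 0" "snd q \<noteq> 0" "GDERIV potential q :> F"
  shows "F = force q"
proof -
  have "(\<lambda>x. inner x F) = (\<lambda>x. inner x (force q))"
    using assms GDERIV_potential unfolding gderiv_def by (blast intro: has_derivative_unique)
  then show ?thesis by (metis vector_eq_ldot)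
qed

lemma continuous_on_potential: "continuous_on {q. fst q \<noteq> 0 \<and> snd q \<noteq> 0} potential"
proof (rule continuous_at_imp_continuous_on, rule ballI)
  fix q :: "real \<times> real"
  assume "q \<in> {q. fst q \<noteq> 0 \<and> snd q \<noteq> 0}"
  then have "(potential has_derivative (\<lambda>v. v \<bullet> force q)) (at q)"
    using GDERIV_potential[of q] by (simp add: gderiv_def)
  then show "isCont potential q" by (rule has_derivative_continuous)
qed

lemma classical_solutionD:
  assumes "classical_solution_on h I q p" "t \<in> I"
  shows "fst (q t) \<noteq> 0" "snd (q t) \<noteq> 0"
    "(q has_vector_derivative (1 / pi) *\<^sub>R p t) (at t within I)"
    "(p has_vector_derivative force (q t)) (at t within I)"
    "(norm (p t))\<^sup>2 = 2 * pi * (h + potential (q t))"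
proof -
  show 1: "fst (q t) \<noteq> 0" "snd (q t) \<noteq> 0"
    "(q has_vector_derivative (1 / pi) *\<^sub>R p t) (at t within I)"
    using assms unfolding classical_solution_on_def by auto
  show "(p has_vector_derivative force (q t)) (at t within I)"
    using assms GDERIV_potential_unique[OF 1(1,2)] unfolding classical_solution_on_def by auto
  have "(norm (p t))\<^sup>2 / (2 * pi) - potential (q t) = h"
    using assms unfolding classical_solution_on_def by auto
  then show "(norm (p t))\<^sup>2 = 2 * pi * (h + potential (q t))" by (simp add: field_simps)
qed

lemma classical_solutionI:
  assumes "\<And>t. t \<in> I \<Longrightarrow> fst (q t) \<noteq> 0 \<and> snd (q t) \<noteq> 0"
    "\<And>t. t \<in> I \<Longrightarrow> (q has_vector_derivative (1 / pi) *\<^sub>R p t) (at t within I)"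
    "\<And>t. t \<in> I \<Longrightarrow> (p has_vector_derivative force (q t)) (at t within I)"
    "\<And>t. t \<in> I \<Longrightarrow> (norm (p t))\<^sup>2 = 2 * pi * (h + potential (q t))"
  shows "classical_solution_on h I q p"
  unfolding classical_solution_on_def
proof (intro ballI conjI)
  fix t assume t: "t \<in> I"
  show "\<exists>F. GDERIV potential (q t) :> F \<and> (p has_vector_derivative F) (at t within I)"
    using assms t GDERIV_potential by blast
  show "(norm (p t))\<^sup>2 / (2 * pi) - potential (q t) = h"
    using assms(4)[OF t] by (simp add: field_simps)
qed (use assms in auto)

lemma classical_solution_subset:
  assumes "classical_solution_on h I q p" "J \<subseteq> I"
  shows "classical_solution_on h J q p"
proof (rule classical_solutionI)
  fix t assume "t \<in> J"
  then have "t \<in> I" using assms by auto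
  note D = classical_solutionD[OF assms(1) this]
  show "fst (q t) \<noteq> 0 \<and> snd (q t) \<noteq> 0" "(norm (p t))\<^sup>2 = 2 * pi * (h + potential (q t))"
    using D by auto
  show "(q has_vector_derivative (1 / pi) *\<^sub>R p t) (at t within J)"
    "(p has_vector_derivative force (q t)) (at t within J)"
    using D(3,4) assms(2) by (auto intro: has_vector_derivative_within_subset)
qed

lemma classical_solution_continuous:
  assumes "classical_solution_on h I q p"
  shows "continuous_on I q" "continuous_on I p"
  using classical_solutionD[OF assms]
  by (auto intro!: has_vector_derivative_continuous simp: continuous_on_eq_continuous_within)

section \<open>Classical arcs as limits of measure preserving maps\<close>

lemma abs_fst_le_norm: "\<bar>fst v\<bar> \<le> norm v" and abs_snd_le_norm: "\<bar>snd v\<bar> \<le> norm v"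
  for v :: "real \<times> real"
  by (metis norm_fst_le norm_snd_le prod.collapse real_norm_def)+

lemma norm_inversion_diff:
  fixes a b :: "'a::real_inner"
  assumes "a \<noteq> 0" "b \<noteq> 0"
  shows "norm (a /\<^sub>R (norm a)\<^sup>2 - b /\<^sub>R (norm b)\<^sup>2) = norm (a - b) / (norm a * norm b)"
proof (rule power2_eq_imp_eq)
  have na: "norm a \<noteq> 0" "norm b \<noteq> 0" using assms by auto
  have sq: "(norm (u - v))\<^sup>2 = (norm u)\<^sup>2 - 2 * (u \<bullet> v) + (norm v)\<^sup>2" for u v :: 'a
    by (simp add: power2_norm_eq_inner inner_diff_left inner_diff_right inner_commute)
  have "(norm (a /\<^sub>R (norm a)\<^sup>2 - b /\<^sub>R (norm b)\<^sup>2))\<^sup>2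
      = (norm a / (norm a)\<^sup>2)\<^sup>2 - 2 * (a \<bullet> b) / ((norm a)\<^sup>2 * (norm b)\<^sup>2) + (norm b / (norm b)\<^sup>2)\<^sup>2"
    unfolding sq by (simp add: divide_inverse mult_ac)
  also have "\<dots> = ((norm a)\<^sup>2 - 2 * (a \<bullet> b) + (norm b)\<^sup>2) / ((norm a)\<^sup>2 * (norm b)\<^sup>2)"
    using na by (simp add: field_simps power2_eq_square)
  also have "(norm a)\<^sup>2 - 2 * (a \<bullet> b) + (norm b)\<^sup>2 = (norm (a - b))\<^sup>2"
    by (rule sq[symmetric])
  finally show "(norm (a /\<^sub>R (norm a)\<^sup>2 - b /\<^sub>R (norm b)\<^sup>2))\<^sup>2 = (norm (a - b) / (norm a * norm b))\<^sup>2"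
    by (simp add: power_divide power_mult_distrib)
qed auto

lemma abs_diff_inverse_le:
  fixes x y :: real
  assumes "0 < e" "e \<le> \<bar>x\<bar>" "e \<le> \<bar>y\<bar>"
  shows "\<bar>1 / x - 1 / y\<bar> \<le> \<bar>x - y\<bar> / e\<^sup>2"
proof -
  have "x \<noteq> 0" "y \<noteq> 0" using assms by auto
  then have "\<bar>1 / x - 1 / y\<bar> = \<bar>x - y\<bar> / (\<bar>x\<bar> * \<bar>y\<bar>)"
    by (simp add: divide_simps abs_mult[symmetric] flip: abs_divide) (simp add: abs_minus_commute abs_divide)
  also have "\<dots> \<le> \<bar>x - y\<bar> / (e * e)"
    using assms by (intro divide_left_mono mult_mono mult_pos_pos) auto
  finally show ?thesis by (simp add: power2_eq_square)
qed

lemma force_lipschitz: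
  assumes e: "0 < e" and a: "e \<le> \<bar>fst a\<bar>" "e \<le> \<bar>snd a\<bar>" and b: "e \<le> \<bar>fst b\<bar>" "e \<le> \<bar>snd b\<bar>"
  shows "norm (force a - force b) \<le> 3 / e\<^sup>2 * norm (a - b)"
proof -
  have ab: "\<bar>fst a - fst b\<bar> \<le> norm (a - b)" "\<bar>snd a - snd b\<bar> \<le> norm (a - b)"
    using abs_fst_le_norm[of "a - b"] abs_snd_le_norm[of "a - b"] by simp_all
  have n: "e \<le> norm a" "e \<le> norm b"
    using a b norm_fst_le[of "fst a" "snd a"] norm_fst_le[of "fst b" "snd b"] by auto
  then have nz: "a \<noteq> 0" "b \<noteq> 0" using e by auto
  have "norm (a /\<^sub>R (norm a)\<^sup>2 - b /\<^sub>R (norm b)\<^sup>2) \<le> norm (a - b) / e\<^sup>2"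
    unfolding norm_inversion_diff[OF nz] power2_eq_square[of e]
    using n e by (intro divide_left_mono mult_mono mult_pos_pos) auto
  moreover have "norm (1 / fst a - 1 / fst b, 1 / snd a - 1 / snd b) \<le> 2 * (norm (a - b) / e\<^sup>2)"
  proof -
    have "norm (1 / fst a - 1 / fst b, 1 / snd a - 1 / snd b)
        \<le> \<bar>1 / fst a - 1 / fst b\<bar> + \<bar>1 / snd a - 1 / snd b\<bar>"
      by (metis norm_Pair_le real_norm_def)
    also have "\<dots> \<le> \<bar>fst a - fst b\<bar> / e\<^sup>2 + \<bar>snd a - snd b\<bar> / e\<^sup>2"
      by (intro add_mono abs_diff_inverse_le e a b)
    also have "\<dots> \<le> norm (a - b) / e\<^sup>2 + norm (a - b) / e\<^sup>2"
      using ab by (intro add_mono divide_right_mono) auto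
    finally show ?thesis by simp
  qed
  moreover have "force a - force b = - ((a /\<^sub>R (norm a)\<^sup>2 - b /\<^sub>R (norm b)\<^sup>2)
      + (1 / fst a - 1 / fst b, 1 / snd a - 1 / snd b))"
    by (simp add: force_def algebra_simps prod_eq_iff)
  ultimately have "norm (force a - force b) \<le> norm (a - b) / e\<^sup>2 + 2 * (norm (a - b) / e\<^sup>2)"
    by (simp only: norm_minus_cancel) (intro order_trans[OF norm_triangle_ineq] add_mono)
  then show ?thesis by simp
qed

lemma norm_force_le:
  assumes e: "0 < e" and a: "e \<le> \<bar>fst a\<bar>" "e \<le> \<bar>snd a\<bar>"
  shows "norm (force a) \<le> 3 / e"
proof -
  have n: "e \<le> norm a"
    using a norm_fst_le[of "fst a" "snd a"] by auto
  have "norm (a /\<^sub>R (norm a)\<^sup>2) = 1 / norm a"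
    using n e by (simp add: power2_eq_square divide_simps)
  also have "\<dots> \<le> 1 / e" using n e by (intro divide_left_mono mult_pos_pos) auto
  finally have 1: "norm (a /\<^sub>R (norm a)\<^sup>2) \<le> 1 / e" .
  have "norm (1 / fst a, 1 / snd a) \<le> 1 / \<bar>fst a\<bar> + 1 / \<bar>snd a\<bar>"
    by (metis norm_Pair_le real_norm_def abs_divide abs_one)
  also have "\<dots> \<le> 1 / e + 1 / e"
    using a e by (intro add_mono divide_left_mono mult_pos_pos) auto
  finally show ?thesis
    using 1 norm_triangle_ineq[of "a /\<^sub>R (norm a)\<^sup>2" "(1 / fst a, 1 / snd a)"]
    unfolding force_def norm_minus_cancel by linarith
qed

text \<open>
  The symplectic Euler method. It is a composition of two shears, and total because division
  by zero gives zero; so it preserves Lebesgue measure although \<open>force\<close> is singular.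
\<close>
definition euler_step :: "real \<Rightarrow> (real \<times> real) \<times> (real \<times> real) \<Rightarrow> (real \<times> real) \<times> (real \<times> real)" where
  "euler_step d z =
     (fst z + (d / pi) *\<^sub>R (snd z + d *\<^sub>R force (fst z)), snd z + d *\<^sub>R force (fst z))"

lemma borel_measurable_force: "force \<in> borel_measurable borel"
proof -
  have [measurable]: "fst \<in> borel_measurable (borel :: (real \<times> real) measure)"
    "snd \<in> borel_measurable (borel :: (real \<times> real) measure)"
    by (intro borel_measurable_continuous_onI continuous_intros)+
  show ?thesis
    unfolding force_def
    by (intro borel_measurable_uminus borel_measurable_add borel_measurable_Pair borel_measurable_scaleR)
      measurable
qed

lemma euler_step_measure_preserving:
  "euler_step d \<in> borel_measurable borel \<and> distr lborel borel (euler_step d) = lborel"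
proof -
  define K where "K = (\<lambda>z :: (real \<times> real) \<times> (real \<times> real). (fst z, snd z + d *\<^sub>R force (fst z)))"
  define D where "D = (\<lambda>z :: (real \<times> real) \<times> (real \<times> real). (fst z + (d / pi) *\<^sub>R snd z, snd z))"
  have f: "(\<lambda>q. d *\<^sub>R force q) \<in> borel_measurable borel"
    using borel_measurable_force by (intro borel_measurable_scaleR) auto
  have K: "K \<in> borel_measurable borel" unfolding K_def
    by (intro borel_measurable_Pair borel_measurable_add measurable_compose[OF _ f]
        borel_measurable_continuous_onI continuous_intros)
  have D: "D \<in> borel_measurable borel" unfolding D_def
    by (intro borel_measurable_continuous_onI continuous_intros)
  have eq: "euler_step d = D \<circ> K" by (auto simp: euler_step_def D_def K_def)
  have "distr lborel borel K = lborel"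
    unfolding K_def using distr_shear_snd[OF f] by simp
  moreover have "distr lborel borel D = lborel"
    unfolding D_def by (rule distr_shear_fst[of "\<lambda>p. (d / pi) *\<^sub>R p"])
      (intro borel_measurable_continuous_onI continuous_intros)
  moreover have "distr (distr lborel borel K) borel D = distr lborel borel (D \<circ> K)"
    by (rule distr_distr) (use K D in auto)
  ultimately show ?thesis using measurable_comp[OF K D] eq by simp
qed

lemma norm_diff_le_of_vector_derivative:
  fixes f :: "real \<Rightarrow> 'a::real_normed_vector"
  assumes uv: "u \<le> v" and f: "\<And>s. s \<in> {u..v} \<Longrightarrow> (f has_vector_derivative f' s) (at s within {u..v})"
    and B: "\<And>s. s \<in> {u..v} \<Longrightarrow> norm (f' s) \<le> B"
  shows "norm (f v - f u) \<le> B * (v - u)"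
proof (cases "u = v")
  case False
  have "norm (f v - f u) \<le> B * v - B * u"
  proof (rule differentiable_bound_general)
    show "continuous_on {u..v} f"
      using f has_vector_derivative_continuous by (fastforce simp: continuous_on_eq_continuous_within)
    show "(f has_vector_derivative f' s) (at s)" if "u < s" "s < v" for s
      using f[of s] that by (simp add: at_within_Icc_at)
    show "((*) B has_vector_derivative B) (at s)" for s
      by (auto intro!: derivative_eq_intros simp: has_real_derivative_iff_has_vector_derivative[symmetric])
    show "continuous_on {u..v} ((*) B)" by (intro continuous_intros)
  qed (use False uv B in auto)
  then show ?thesis by (simp add: right_diff_distrib)
qed simp

lemma euler_converges:
  assumes sol: "classical_solution_on h {0..t} q p" and t: "0 \<le> t"
  shows "(\<lambda>n. (euler_step (t / real n) ^^ n) (q 0, p 0)) \<longlonglongrightarrow> (q t, p t)"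
proof -
  note D = classical_solutionD[OF sol]
  note cont = classical_solution_continuous[OF sol]
  \<comment> \<open>compactness keeps the orbit at a distance \<open>2 * e\<close> from the axes\<close>
  obtain e where e: "0 < e" and qe: "\<And>u. u \<in> {0..t} \<Longrightarrow> 2 * e \<le> \<bar>fst (q u)\<bar> \<and> 2 * e \<le> \<bar>snd (q u)\<bar>"
  proof -
    let ?m = "\<lambda>u. min \<bar>fst (q u)\<bar> \<bar>snd (q u)\<bar>"
    have "continuous_on {0..t} ?m" by (intro continuous_intros cont)
    then obtain v where v: "v \<in> {0..t}" "\<And>u. u \<in> {0..t} \<Longrightarrow> ?m v \<le> ?m u"
      using continuous_attains_inf[of "{0..t}" ?m] t by auto
    show ?thesis
    proof (rule that[of "?m v / 2"])
      show "0 < ?m v / 2" using D(1,2)[OF v(1)] by auto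
      show "2 * (?m v / 2) \<le> \<bar>fst (q u)\<bar> \<and> 2 * (?m v / 2) \<le> \<bar>snd (q u)\<bar>" if "u \<in> {0..t}" for u
        using v(2)[OF that] by auto
    qed
  qed
  obtain V where V: "\<And>u. u \<in> {0..t} \<Longrightarrow> norm (p u) \<le> V"
  proof -
    have "compact (p ` {0..t})" by (intro compact_continuous_image cont compact_Icc)
    then show ?thesis using that compact_imp_bounded by (metis bounded_iff imageI)
  qed
  have V0: "0 \<le> V" using t by (intro order_trans[OF norm_ge_zero V[of 0]]) auto
  define L0 where "L0 = 3 / e\<^sup>2"
  define M where "M = 3 / e"
  have pos: "0 \<le> L0" "0 \<le> M" using e by (auto simp: L0_def M_def)
  have F: "norm (force (q u)) \<le> M" if "u \<in> {0..t}" for u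
    using qe[OF that] e unfolding M_def by (intro norm_force_le) auto
  have q_lip: "norm (q v - q u) \<le> V * (v - u)" if "0 \<le> u" "u \<le> v" "v \<le> t" for u v
  proof -
    have "norm (q v - q u) \<le> (V / pi) * (v - u)"
      by (rule norm_diff_le_of_vector_derivative[where f' = "\<lambda>s. (1 / pi) *\<^sub>R p s"])
        (use that V in \<open>auto intro!: has_vector_derivative_within_subset[OF D(3)] divide_right_mono\<close>)
    also have "\<dots> \<le> V * (v - u)"
      using that V0 pi_ge_two by (intro mult_right_mono) (auto simp: divide_simps mult_le_cancel_left1)
    finally show ?thesis .
  qed
  have p_lip: "norm (p v - p u) \<le> M * (v - u)" if "0 \<le> u" "u \<le> v" "v \<le> t" for u v
    by (rule norm_diff_le_of_vector_derivative[where f' = "\<lambda>s. force (q s)"])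
      (use that F in \<open>auto intro!: has_vector_derivative_within_subset[OF D(4)]\<close>)
  define C where "C = M + M + L0 * V"
  have C0: "0 \<le> C" using pos V0 by (simp add: C_def)
  show ?thesis
  proof (rule one_step_method_converges[where x = "\<lambda>u. (q u, p u)" and S = euler_step
        and e = e and L = "1 + L0" and C = C])
    show "0 \<le> t" "0 < e" "0 \<le> 1 + L0" "0 \<le> C" using t e pos C0 by auto
    fix u d and y :: "(real \<times> real) \<times> (real \<times> real)"
    assume u: "0 \<le> u" "0 \<le> d" "u + d \<le> t" and y: "norm (y - (q u, p u)) < e"
    define a b where "a = fst y" and "b = snd y"
    have yab: "y = (a, b)" by (simp add: a_def b_def)
    let ?N = "norm (y - (q u, p u))"
    have na: "norm (a - q u) \<le> ?N" and nb: "norm (b - p u) \<le> ?N"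
      by (auto simp: yab norm_fst_le norm_snd_le)
    have "\<bar>fst a - fst (q u)\<bar> \<le> norm (a - q u)" "\<bar>snd a - snd (q u)\<bar> \<le> norm (a - q u)"
      using abs_fst_le_norm[of "a - q u"] abs_snd_le_norm[of "a - q u"] by simp_all
    then have ae: "e \<le> \<bar>fst a\<bar>" "e \<le> \<bar>snd a\<bar>" using qe[of u] u y na by auto
    have fa: "norm (force a) \<le> M" unfolding M_def by (rule norm_force_le[OF e ae])
    have fl: "norm (force a - force (q u)) \<le> L0 * norm (a - q u)"
      unfolding L0_def using qe[of u] u e ae by (intro force_lipschitz) auto
    have ep: "norm (p (u + d) - p u - d *\<^sub>R force (q u)) \<le> L0 * V * d\<^sup>2"
    proof -
      have "norm (p (u + d) - p u - ((u + d) - u) *\<^sub>R force (q u)) \<le> norm ((u + d) - u) * (L0 * V * d)"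
      proof (rule vector_differentiable_bound_linearization[of "{u..u + d}"])
        fix s assume s: "s \<in> {u..u + d}"
        show "(p has_vector_derivative force (q s)) (at s within {u..u + d})"
          using s u by (intro has_vector_derivative_within_subset[OF D(4)]) auto
        have "norm (force (q s) - force (q u)) \<le> L0 * norm (q s - q u)"
          unfolding L0_def using qe[of u] qe[of s] u s e by (intro force_lipschitz) auto
        also have "\<dots> \<le> L0 * (V * d)"
          using q_lip[of u s] s u V0 pos mult_left_mono[of "s - u" d V] by (intro mult_left_mono) auto
        finally show "norm (force (q s) - force (q u)) \<le> L0 * V * d" by simp
      qed (use u in \<open>auto simp: closed_segment_eq_real_ivl\<close>)
      then show ?thesis using u by (simp add: power2_eq_square mult_ac)
    qed
    have eq: "norm (q (u + d) - q u - d *\<^sub>R ((1 / pi) *\<^sub>R p u)) \<le> M * d\<^sup>2"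
    proof -
      have "norm (q (u + d) - q u - ((u + d) - u) *\<^sub>R ((1 / pi) *\<^sub>R p u)) \<le> norm ((u + d) - u) * (M * d)"
      proof (rule vector_differentiable_bound_linearization[of "{u..u + d}"])
        fix s assume s: "s \<in> {u..u + d}"
        show "(q has_vector_derivative (1 / pi) *\<^sub>R p s) (at s within {u..u + d})"
          using s u by (intro has_vector_derivative_within_subset[OF D(3)]) auto
        have "norm ((1 / pi) *\<^sub>R p s - (1 / pi) *\<^sub>R p u) = (1 / pi) * norm (p s - p u)"
          by (metis abs_of_pos divide_pos_pos norm_scaleR pi_gt_zero scaleR_diff_right zero_less_one)
        also have "\<dots> \<le> 1 * norm (p s - p u)"
          using pi_ge_two by (intro mult_right_mono) (auto simp: divide_simps)
        also have "\<dots> \<le> M * d"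
          using p_lip[of u s] s u pos mult_left_mono[of "s - u" d M] by auto
        finally show "norm ((1 / pi) *\<^sub>R p s - (1 / pi) *\<^sub>R p u) \<le> M * d" .
      qed (use u in \<open>auto simp: closed_segment_eq_real_ivl\<close>)
      then show ?thesis using u by (simp add: power2_eq_square mult_ac)
    qed
    define r1 where "r1 = (d\<^sup>2 / pi) *\<^sub>R force a - (q (u + d) - q u - d *\<^sub>R ((1 / pi) *\<^sub>R p u))"
    define r2 where "r2 = - (p (u + d) - p u - d *\<^sub>R force (q u))"
    have split: "euler_step d y - (q (u + d), p (u + d)) = (y - (q u, p u))
        + d *\<^sub>R ((1 / pi) *\<^sub>R (b - p u), force a - force (q u)) + (r1, r2)"
      by (simp add: yab euler_step_def r1_def r2_def algebra_simps power2_eq_square)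
    have "norm ((1 / pi) *\<^sub>R (b - p u), force a - force (q u))
        \<le> norm ((1 / pi) *\<^sub>R (b - p u)) + norm (force a - force (q u))"
      by (rule norm_Pair_le)
    also have "\<dots> \<le> 1 * norm (b - p u) + L0 * norm (a - q u)"
      using pi_ge_two fl by (intro add_mono) (auto simp: divide_simps mult_le_cancel_left1)
    also have "\<dots> \<le> 1 * ?N + L0 * ?N"
      using na nb pos by (intro add_mono mult_left_mono) auto
    finally have n2: "norm (d *\<^sub>R ((1 / pi) *\<^sub>R (b - p u), force a - force (q u))) \<le> d * ((1 + L0) * ?N)"
      unfolding norm_scaleR[of d] using u mult_left_mono[of _ _ d] by (simp add: distrib_right)
    have "norm ((d\<^sup>2 / pi) *\<^sub>R force a) \<le> d\<^sup>2 * M"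
    proof -
      have "norm ((d\<^sup>2 / pi) *\<^sub>R force a) = (d\<^sup>2 / pi) * norm (force a)" by simp
      also have "\<dots> \<le> d\<^sup>2 * M"
        using fa pos pi_ge_two by (intro mult_mono) (auto simp: divide_simps mult_le_cancel_left1)
      finally show ?thesis .
    qed
    then have "norm r1 \<le> d\<^sup>2 * M + M * d\<^sup>2"
      unfolding r1_def using eq by (rule order_trans[OF norm_triangle_ineq4 add_mono])
    moreover have "norm r2 \<le> L0 * V * d\<^sup>2"
      unfolding r2_def using ep by (metis norm_minus_cancel)
    ultimately have n3: "norm (r1, r2) \<le> C * d\<^sup>2"
      using norm_Pair_le[of r1 r2] by (simp add: C_def algebra_simps)
    have "norm (euler_step d y - (q (u + d), p (u + d))) \<le> ?N + d * ((1 + L0) * ?N) + C * d\<^sup>2"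
      unfolding split using n2 n3
      by (intro order_trans[OF norm_triangle_ineq] add_mono) auto
    then show "norm (euler_step d y - (q (u + d), p (u + d))) \<le> (1 + (1 + L0) * d) * ?N + C * d\<^sup>2"
      by (simp add: algebra_simps)
  qed
qed

text \<open>\<open>flows_to t z w\<close>: a classical solution leads from the state \<open>z\<close> to the state \<open>w\<close> in time \<open>t\<close>.\<close>
definition flows_to ::
    "real \<Rightarrow> (real \<times> real) \<times> (real \<times> real) \<Rightarrow> (real \<times> real) \<times> (real \<times> real) \<Rightarrow> bool" where
  "flows_to t z w \<longleftrightarrow> 0 \<le> t \<and>
     (\<exists>h q p. classical_solution_on h {0..t} q p \<and> z = (q 0, p 0) \<and> w = (q t, p t))"

text \<open>
  The part of Liouville's theorem that is needed: the flow backwards in time does not increase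
  the outer measure.
\<close>
lemma flows_to_outer_measure:
  assumes "open B"
  obtains U where "U \<in> sets borel" "emeasure lborel U \<le> emeasure lborel B"
    "\<And>z w. flows_to t z w \<Longrightarrow> w \<in> B \<Longrightarrow> z \<in> U"
proof -
  have P: "(euler_step (t / real n) ^^ n) \<in> borel_measurable borel"
    "distr lborel borel (euler_step (t / real n) ^^ n) = lborel" for n
    using distr_funpow[of "euler_step (t / real n)" n] euler_step_measure_preserving by auto
  obtain U where U: "U \<in> sets borel" "emeasure lborel U \<le> emeasure lborel B"
    "\<And>z w. ((\<lambda>n. (euler_step (t / real n) ^^ n) z) \<longlonglongrightarrow> w) \<Longrightarrow> w \<in> B \<Longrightarrow> z \<in> U"
    using outer_measure_limit_preimage[of "\<lambda>n. euler_step (t / real n) ^^ n" B, OF P assms] by blast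
  show ?thesis
  proof (rule that[OF U(1,2)])
    fix z w assume "flows_to t z w" "w \<in> B"
    then show "z \<in> U" using U(3)[of z w] euler_converges unfolding flows_to_def by blast
  qed
qed

lemma negligible_flows_to:
  assumes N: "negligible N"
  shows "negligible {z. \<exists>w\<in>N. flows_to t z w}"
  unfolding negligible_outer_le
proof (intro allI impI)
  fix e :: real assume e: "0 < e"
  obtain T where T: "open T" "N \<subseteq> T" "emeasure lebesgue (T - N) < ennreal e"
    using sets_lebesgue_outer_open[OF negligible_imp_sets[OF N] e] by metis
  have "emeasure lborel T \<le> ennreal e"
  proof -
    have "emeasure lborel T = emeasure lebesgue T" using T by simp
    also have "\<dots> = emeasure lebesgue (T - N)"
      using N T by (intro emeasure_Diff_null_set[symmetric]) (auto simp: negligible_iff_null_sets)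
    finally show ?thesis using T by simp
  qed
  moreover obtain U where U: "U \<in> sets borel" "emeasure lborel U \<le> emeasure lborel T"
    "\<And>z w. flows_to t z w \<Longrightarrow> w \<in> T \<Longrightarrow> z \<in> U"
    using flows_to_outer_measure[OF T(1)] by metis
  ultimately have Ue: "emeasure lebesgue U \<le> ennreal e" by simp
  show "\<exists>T. {z. \<exists>w\<in>N. flows_to t z w} \<subseteq> T \<and> T \<in> lmeasurable \<and> measure lebesgue T \<le> e"
  proof (intro exI conjI)
    show "{z. \<exists>w\<in>N. flows_to t z w} \<subseteq> U" using U T by auto
    show "U \<in> lmeasurable"
      using U Ue by (intro fmeasurableI) (auto simp: le_less_trans)
    show "measure lebesgue U \<le> e"
      using Ue e by (simp add: measure_def enn2real_leI)
  qed
qed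

text \<open>
  If for every large \<open>n\<close> all points of \<open>A\<close> are carried into a set of measure \<open>o(1 / n)\<close>, each of them
  at one of the \<open>O(n)\<close> multiples of \<open>1 / n\<close> up to a bounded time, then \<open>A\<close> is null.
\<close>
lemma negligible_zero_flux:
  fixes B :: "nat \<Rightarrow> ((real \<times> real) \<times> (real \<times> real)) set" and K :: nat
  assumes B: "\<And>n. n0 \<le> n \<Longrightarrow> open (B n)"
    and \<beta>: "\<And>n. n0 \<le> n \<Longrightarrow> emeasure lborel (B n) \<le> ennreal (\<beta> n)"
    and lim: "(\<lambda>n. real n * \<beta> n) \<longlonglongrightarrow> 0"
    and A: "\<And>n z. n0 \<le> n \<Longrightarrow> z \<in> A \<Longrightarrow> \<exists>k\<le>n * K. \<exists>w\<in>B n. flows_to (real k / real n) z w"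
  shows "negligible A"
  unfolding negligible_outer_le
proof (intro allI impI)
  fix e :: real assume e: "0 < e"
  define c where "c = real K + 1"
  have "\<forall>\<^sub>F n in sequentially. real n * \<beta> n < e / c"
    by (rule order_tendstoD(2)[OF lim]) (use e in \<open>auto simp: c_def\<close>)
  then have "\<forall>\<^sub>F n in sequentially. real n * \<beta> n < e / c \<and> n0 \<le> n \<and> 1 \<le> n"
    by (intro eventually_conj eventually_ge_at_top)
  then obtain n where n: "real n * \<beta> n < e / c" "n0 \<le> n" "1 \<le> n"
    using eventually_happens by fastforce
  have "\<exists>U. U \<in> sets borel \<and> emeasure lborel U \<le> emeasure lborel (B n) \<and>
      (\<forall>z w. flows_to t z w \<longrightarrow> w \<in> B n \<longrightarrow> z \<in> U)" for t
    using flows_to_outer_measure[OF B[OF n(2)]] by metis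
  then obtain U where U: "\<And>t. U t \<in> sets borel" "\<And>t. emeasure lborel (U t) \<le> emeasure lborel (B n)"
    "\<And>t z w. flows_to t z w \<Longrightarrow> w \<in> B n \<Longrightarrow> z \<in> U t"
    by metis
  define W where "W = (\<Union>k\<le>n * K. U (real k / real n))"
  have "emeasure lborel W \<le> (\<Sum>k\<le>n * K. emeasure lborel (U (real k / real n)))"
    unfolding W_def by (rule emeasure_subadditive_finite) (use U in auto)
  also have "\<dots> \<le> (\<Sum>k\<le>n * K. ennreal (max 0 (\<beta> n)))"
  proof (rule sum_mono)
    fix k
    show "emeasure lborel (U (real k / real n)) \<le> ennreal (max 0 (\<beta> n))"
      using U(2)[of "real k / real n"] \<beta>[OF n(2)]
        ennreal_leI[of "\<beta> n" "max 0 (\<beta> n)"]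
      by (meson max.cobounded2 order_trans)
  qed
  also have "\<dots> = ennreal (real (n * K + 1) * max 0 (\<beta> n))"
    by (simp add: ennreal_mult' ennreal_of_nat_eq_real_of_nat add.commute)
  also have "\<dots> \<le> ennreal e"
  proof (rule ennreal_leI)
    have "real (n * K + 1) \<le> c * real n" using n by (simp add: c_def algebra_simps)
    then have "real (n * K + 1) * max 0 (\<beta> n) \<le> c * real n * max 0 (\<beta> n)"
      by (intro mult_right_mono) auto
    also have "\<dots> = c * max 0 (real n * \<beta> n)"
      using n by (auto simp: max_def zero_le_mult_iff mult_le_0_iff)
    also have "\<dots> \<le> c * (e / c)" using n e by (intro mult_left_mono) (auto simp: c_def)
    finally show "real (n * K + 1) * max 0 (\<beta> n) \<le> e" by (simp add: c_def)
  qed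
  finally have We: "emeasure lborel W \<le> ennreal e" .
  have Ws: "W \<in> sets borel" using U by (auto simp: W_def)
  with We have We: "emeasure lebesgue W \<le> ennreal e" by simp
  show "\<exists>T. A \<subseteq> T \<and> T \<in> lmeasurable \<and> measure lebesgue T \<le> e"
  proof (intro exI conjI)
    show "A \<subseteq> W"
    proof
      fix z assume "z \<in> A"
      then obtain k w where "k \<le> n * K" "w \<in> B n" "flows_to (real k / real n) z w"
        using A[OF n(2)] by blast
      then show "z \<in> W" using U(3)[of "real k / real n" z w] unfolding W_def by blast
    qed
    show "W \<in> lmeasurable"
      using Ws We by (intro fmeasurableI) (auto simp: le_less_trans)
    show "measure lebesgue W \<le> e"
      using We e by (simp add: measure_def enn2real_leI)
  qed
qed

section \<open>Orbits without binary collision\<close>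

lemma classical_solution_interior:
  assumes sol: "classical_solution_on h I q p" and t: "t \<in> S" "open S" "S \<subseteq> I"
  shows "((\<lambda>t. fst (q t)) has_real_derivative fst (p t) / pi) (at t)"
    "((\<lambda>t. snd (q t)) has_real_derivative snd (p t) / pi) (at t)"
    "((\<lambda>t. fst (p t)) has_real_derivative - (fst (q t) / (norm (q t))\<^sup>2 + 1 / fst (q t))) (at t)"
    "((\<lambda>t. snd (p t)) has_real_derivative - (snd (q t) / (norm (q t))\<^sup>2 + 1 / snd (q t))) (at t)"
    "(q has_vector_derivative (1 / pi) *\<^sub>R p t) (at t)"
    "(p has_vector_derivative force (q t)) (at t)"
proof -
  have "t \<in> I" using t by auto
  note D = classical_solutionD[OF sol this, unfolded at_within_open_subset[OF t]]
  show "(q has_vector_derivative (1 / pi) *\<^sub>R p t) (at t)"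
    "(p has_vector_derivative force (q t)) (at t)" using D by auto
  note F = bounded_linear.has_vector_derivative[OF bounded_linear_fst]
    and G = bounded_linear.has_vector_derivative[OF bounded_linear_snd]
  show "((\<lambda>t. fst (q t)) has_real_derivative fst (p t) / pi) (at t)"
    "((\<lambda>t. snd (q t)) has_real_derivative snd (p t) / pi) (at t)"
    using F[OF D(3)] G[OF D(3)] by (simp_all add: has_real_derivative_iff_has_vector_derivative)
  show "((\<lambda>t. fst (p t)) has_real_derivative - (fst (q t) / (norm (q t))\<^sup>2 + 1 / fst (q t))) (at t)"
    "((\<lambda>t. snd (p t)) has_real_derivative - (snd (q t) / (norm (q t))\<^sup>2 + 1 / snd (q t))) (at t)"
    using F[OF D(4)] G[OF D(4)]
    by (simp_all add: has_real_derivative_iff_has_vector_derivative force_def divide_inverse algebra_simps)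
qed

lemma flows_toI:
  assumes "classical_solution_on h I q p" "{0..t} \<subseteq> I" "0 \<le> t"
  shows "flows_to t (q 0, p 0) (q t, p t)"
  unfolding flows_to_def using classical_solution_subset[OF assms(1,2)] assms(3) by blast

lemma sgn_constant:
  fixes x :: "real \<Rightarrow> real"
  assumes c: "continuous_on S x" and "connected S" and nz: "\<And>t. t \<in> S \<Longrightarrow> x t \<noteq> 0"
    and st: "s \<in> S" "t \<in> S"
  shows "sgn (x t) = sgn (x s)"
proof (rule ccontr)
  assume neq: "sgn (x t) \<noteq> sgn (x s)"
  have con: "connected (x ` S)" using assms by (intro connected_continuous_image)
  have "0 \<in> x ` S"
  proof (cases "x s < 0")
    case True
    then have "0 < x t" using neq nz[OF st(2)] by (auto simp: sgn_if split: if_splits)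
    then show ?thesis using connectedD_interval[OF con, of "x s" "x t" 0] True st by auto
  next
    case False
    then have "x t < 0" "0 < x s"
      using neq nz[OF st(1)] nz[OF st(2)] by (auto simp: sgn_if split: if_splits)
    then show ?thesis using connectedD_interval[OF con, of "x t" "x s" 0] st by auto
  qed
  then show False using nz by auto
qed

text \<open>
  Each coordinate is attracted by its axis, so its absolute value is a concave function of time,
  and lies above its chords.
\<close>
lemma abs_coordinate_above_chord:
  fixes x g c :: "real \<Rightarrow> real"
  assumes x: "\<And>t. t \<in> {a..<b} \<Longrightarrow> (x has_real_derivative g t / pi) (at t)"
    and g: "\<And>t. t \<in> {a..<b} \<Longrightarrow> (g has_real_derivative - (x t * c t + 1 / x t)) (at t)"
    and c: "\<And>t. t \<in> {a..<b} \<Longrightarrow> 0 \<le> c t"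
    and nz: "\<And>t. t \<in> {a..<b} \<Longrightarrow> x t \<noteq> 0"
    and u: "a \<le> u" "u < b"
  shows "\<bar>x a\<bar> * (b - u) \<le> \<bar>x u\<bar> * (b - a)"
proof (cases "a = u")
  case False
  with u have au: "a < u" by simp
  define s where "s = sgn (x a)"
  have cont: "continuous_on {a..<b} x"
    using x DERIV_isCont by (intro continuous_at_imp_continuous_on) blast
  have s2: "s * s = 1" using nz[of a] u by (auto simp: s_def sgn_if)
  have sx: "s * x t = \<bar>x t\<bar>" if "t \<in> {a..<b}" for t
  proof -
    have "s = sgn (x t)" unfolding s_def
      using that u by (intro sgn_constant[OF cont _ nz]) auto
    then show ?thesis by (simp add: abs_sgn mult.commute)
  qed
  have mono: "s * g v \<le> s * g t" if "a \<le> t" "t \<le> v" "v < b" for t v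
  proof (rule DERIV_nonpos_imp_nonincreasing[where f = "\<lambda>t. s * g t"])
    fix w assume w: "t \<le> w" "w \<le> v"
    have w': "w \<in> {a..<b}" using w that by auto
    have "x w \<noteq> 0" using nz w' by auto
    have "s * - (x w * c w + 1 / x w) = - ((s * x w) * c w + (s * x w) / (x w)\<^sup>2)"
      using \<open>x w \<noteq> 0\<close> by (simp add: field_simps power2_eq_square)
    also have "\<dots> \<le> 0"
      unfolding sx[OF w'] neg_le_0_iff_le using c[OF w']
      by (intro add_nonneg_nonneg mult_nonneg_nonneg divide_nonneg_nonneg) auto
    finally show "\<exists>y. ((\<lambda>t. s * g t) has_real_derivative y) (at w) \<and> y \<le> 0"
      using DERIV_cmult[OF g[OF w'], of s] by blast
  qed (use that in auto)
  have chord: "\<bar>x a\<bar> * (v - u) \<le> \<bar>x u\<bar> * (v - a)" if v: "u < v" "v < b" for v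
  proof -
    have d: "((\<lambda>t. s * x t) has_real_derivative s * (g t / pi)) (at t)" if "a \<le> t" "t < b" for t
      using that by (intro DERIV_cmult x) auto
    obtain z where z: "a < z" "z < u" "s * x u - s * x a = (u - a) * (s * (g z / pi))"
      using MVT2[of a u "\<lambda>t. s * x t" "\<lambda>t. s * (g t / pi)"] au d u by auto
    obtain y where y: "u < y" "y < v" "s * x v - s * x u = (v - u) * (s * (g y / pi))"
      using MVT2[of u v "\<lambda>t. s * x t" "\<lambda>t. s * (g t / pi)"] au d u v by auto
    have le: "s * (g y / pi) \<le> s * (g z / pi)"
      using mono[of z y] z y v by (simp add: divide_right_mono)
    have eq: "s * x a = \<bar>x a\<bar>" "s * x u = \<bar>x u\<bar>" "s * x v = \<bar>x v\<bar>" using sx u v by auto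
    have "(\<bar>x v\<bar> - \<bar>x u\<bar>) * (u - a) = ((v - u) * (u - a)) * (s * (g y / pi))"
      using y(3) unfolding eq by simp
    also have "\<dots> \<le> ((v - u) * (u - a)) * (s * (g z / pi))"
      using au v by (intro mult_left_mono[OF le]) auto
    also have "\<dots> = (\<bar>x u\<bar> - \<bar>x a\<bar>) * (v - u)" using z(3) unfolding eq by simp
    finally have "\<bar>x a\<bar> * (v - u) + \<bar>x v\<bar> * (u - a) \<le> \<bar>x u\<bar> * (v - a)"
      by (simp add: algebra_simps)
    moreover have "0 \<le> \<bar>x v\<bar> * (u - a)" using au by simp
    ultimately show ?thesis by linarith
  qed
  show ?thesis
  proof (rule tendsto_le[of "at_left b"])
    show "((\<lambda>v. \<bar>x u\<bar> * (v - a)) \<longlongrightarrow> \<bar>x u\<bar> * (b - a)) (at_left b)"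
      "((\<lambda>v. \<bar>x a\<bar> * (v - u)) \<longlongrightarrow> \<bar>x a\<bar> * (b - u)) (at_left b)"
      by (intro tendsto_intros)+
    show "\<forall>\<^sub>F v in at_left b. \<bar>x a\<bar> * (v - u) \<le> \<bar>x u\<bar> * (v - a)"
      using eventually_at_left_field[of _ b] chord u by blast
  qed simp
qed simp

text \<open>
  Along an arc that collapses at time \<open>\<tau>\<close> the position at time \<open>t\<close> is bounded by
  a multiple of \<open>(\<tau> - t) * (1 + \<bar>p t\<bar>)\<close>: concavity controls how fast the potential, hence the speed, grows.
\<close>
lemma collapse_position_bound:
  assumes sol: "classical_solution_on h {0..<\<tau>} q p" and lim: "(q \<longlongrightarrow> 0) (at_left \<tau>)"
    and a: "0 < a" "a < \<tau>"
  shows "norm (q a) \<le> 2 / pi * (\<tau> - a) * sqrt ((norm (p a))\<^sup>2 + 6 * pi)"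
proof -
  define K where "K = sqrt ((norm (p a))\<^sup>2 + 6 * pi)"
  have K2: "K\<^sup>2 = (norm (p a))\<^sup>2 + 6 * pi" and K0: "0 \<le> K" by (auto simp: K_def)
  note D = classical_solution_interior[OF sol _ open_greaterThanLessThan[of 0 \<tau>]]
  have sub: "{0<..<\<tau>} \<subseteq> {0..<\<tau>}" by auto
  note S = classical_solutionD[OF sol]
  have speed: "norm (p u) \<le> K * sqrt (\<tau> - a) / sqrt (\<tau> - u)" if u: "a \<le> u" "u < \<tau>" for u
  proof -
    define l where "l = (\<tau> - u) / (\<tau> - a)"
    have l: "0 < l" "l \<le> 1" using u a by (auto simp: l_def)
    have fl: "l * \<bar>fst (q a)\<bar> \<le> \<bar>fst (q u)\<bar>"
    proof -
      have "\<bar>fst (q a)\<bar> * (\<tau> - u) \<le> \<bar>fst (q u)\<bar> * (\<tau> - a)"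
        using u a S(1)
        by (intro abs_coordinate_above_chord[where g = "\<lambda>t. fst (p t)" and c = "\<lambda>t. 1 / (norm (q t))\<^sup>2"])
          (auto intro!: D(1)[OF _ sub] DERIV_cong[OF D(3)[OF _ sub]])
      then show ?thesis using a by (simp add: l_def field_simps)
    qed
    have sl: "l * \<bar>snd (q a)\<bar> \<le> \<bar>snd (q u)\<bar>"
    proof -
      have "\<bar>snd (q a)\<bar> * (\<tau> - u) \<le> \<bar>snd (q u)\<bar> * (\<tau> - a)"
        using u a S(2)
        by (intro abs_coordinate_above_chord[where g = "\<lambda>t. snd (p t)" and c = "\<lambda>t. 1 / (norm (q t))\<^sup>2"])
          (auto intro!: D(2)[OF _ sub] DERIV_cong[OF D(4)[OF _ sub]])
      then show ?thesis using a by (simp add: l_def field_simps)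
    qed
    have nl: "l * norm (q a) \<le> norm (q u)"
    proof -
      have "norm (l *\<^sub>R q a) \<le> norm (q u)"
        unfolding norm_prod_def
        using fl sl l by (intro real_sqrt_le_mono add_mono power_mono) (auto simp: abs_mult)
      then show ?thesis using l by simp
    qed
    have nz: "fst (q u) \<noteq> 0" "snd (q u) \<noteq> 0" "fst (q a) \<noteq> 0" "snd (q a) \<noteq> 0"
      "norm (q u) \<noteq> 0" "norm (q a) \<noteq> 0"
      using S(1,2)[of u] S(1,2)[of a] u a by auto
    have ln_le: "ln l + ln v \<le> ln w" if "l * \<bar>v\<bar> \<le> \<bar>w\<bar>" "v \<noteq> 0" "w \<noteq> 0" for v w
    proof -
      have "ln (l * \<bar>v\<bar>) \<le> ln \<bar>w\<bar>"
        using that l by (intro ln_mono) auto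
      moreover have "ln \<bar>v\<bar> = ln v" "ln \<bar>w\<bar> = ln w" by (auto simp: abs_if ln_minus)
      ultimately show ?thesis using that l by (simp add: ln_mult)
    qed
    have "potential (q u) \<le> potential (q a) - 3 * ln l"
      using ln_le[OF fl] ln_le[OF sl] ln_le[of "norm (q a)" "norm (q u)"] nl nz
      by (simp add: potential_eq_sum_ln)
    moreover have "- ln l \<le> 1 / l - 1"
      using ln_le_minus_one[of "1 / l"] l by (simp add: ln_div)
    ultimately have pot: "potential (q u) \<le> potential (q a) + 3 * (1 / l - 1)" by simp
    have "(norm (p u))\<^sup>2 = 2 * pi * (h + potential (q u))" using S(5)[of u] u a by auto
    also have "\<dots> \<le> 2 * pi * (h + (potential (q a) + 3 * (1 / l - 1)))"
      using pot by (intro mult_left_mono) auto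
    also have "\<dots> = (norm (p a))\<^sup>2 + 6 * pi * (1 / l - 1)"
      using S(5)[of a] a by (simp add: algebra_simps)
    also have "\<dots> \<le> (norm (p a))\<^sup>2 / l + 6 * pi / l"
    proof -
      have "(norm (p a))\<^sup>2 * l \<le> (norm (p a))\<^sup>2" using l by (simp add: mult_left_le)
      then have "(norm (p a))\<^sup>2 \<le> (norm (p a))\<^sup>2 / l" using l by (simp add: field_simps)
      moreover have "6 * pi * (1 / l - 1) = 6 * pi / l - 6 * pi" by (simp add: right_diff_distrib)
      ultimately show ?thesis using pi_gt_zero by linarith
    qed
    also have "\<dots> = (K / sqrt l)\<^sup>2" using l by (simp add: power_divide K2 add_divide_distrib)
    finally have "norm (p u) \<le> K / sqrt l"
      by (rule power2_le_imp_le) (use K0 l in simp)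
    also have "\<dots> = K * sqrt (\<tau> - a) / sqrt (\<tau> - u)"
      using u a by (simp add: l_def real_sqrt_divide)
    finally show ?thesis .
  qed
  have bound: "norm (q a) \<le> norm (q v) + 2 / pi * (\<tau> - a) * K" if v: "a < v" "v < \<tau>" for v
  proof -
    define \<phi> where "\<phi> = (\<lambda>u. - (2 * K / pi * sqrt (\<tau> - a)) * sqrt (\<tau> - u))"
    have "norm (q v - q a) \<le> \<phi> v - \<phi> a"
    proof (rule differentiable_bound_general[where f' = "\<lambda>t. (1 / pi) *\<^sub>R p t"
          and \<phi>' = "\<lambda>u. K * sqrt (\<tau> - a) / sqrt (\<tau> - u) / pi"])
      show "continuous_on {a..v} q"
        using v a by (intro continuous_on_subset[OF classical_solution_continuous(1)[OF sol]]) auto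
      show "continuous_on {a..v} \<phi>" unfolding \<phi>_def by (intro continuous_intros)
      fix u assume u: "a < u" "u < v"
      show "(q has_vector_derivative (1 / pi) *\<^sub>R p u) (at u)"
        using u v a by (intro D(5)[OF _ sub]) auto
      have "\<tau> - u > 0" using u v by auto
      have "(\<phi> has_real_derivative K * sqrt (\<tau> - a) / sqrt (\<tau> - u) / pi) (at u)"
        unfolding \<phi>_def using \<open>\<tau> - u > 0\<close>
        by (auto intro!: derivative_eq_intros simp: field_simps)
      then show "(\<phi> has_vector_derivative K * sqrt (\<tau> - a) / sqrt (\<tau> - u) / pi) (at u)"
        by (simp add: has_real_derivative_iff_has_vector_derivative)
      show "norm ((1 / pi) *\<^sub>R p u) \<le> K * sqrt (\<tau> - a) / sqrt (\<tau> - u) / pi"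
        using divide_right_mono[OF speed[of u], of pi] u v by simp
    qed (use v in auto)
    also have "\<dots> \<le> - \<phi> a" using K0 v a by (simp add: \<phi>_def)
    also have "- \<phi> a = 2 / pi * (\<tau> - a) * K" using a by (simp add: \<phi>_def)
    finally show ?thesis
      using norm_triangle_ineq2[of "q a" "q v"] by (simp add: norm_minus_commute)
  qed
  have "norm (q a) \<le> norm (0 :: real \<times> real) + 2 / pi * (\<tau> - a) * K"
  proof (rule tendsto_le[of "at_left \<tau>"])
    show "((\<lambda>v. norm (q v) + 2 / pi * (\<tau> - a) * K) \<longlongrightarrow> norm (0 :: real \<times> real) + 2 / pi * (\<tau> - a) * K)
        (at_left \<tau>)"
      by (intro tendsto_intros lim)
    show "\<forall>\<^sub>F v in at_left \<tau>. norm (q a) \<le> norm (q v) + 2 / pi * (\<tau> - a) * K"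
      using eventually_at_left_field[of _ \<tau>] bound a by blast
  qed (auto intro: tendsto_intros)
  then show ?thesis by (simp add: K_def)
qed

lemma emeasure_lborel_Times:
  fixes A :: "'a::euclidean_space set" and B :: "'b::euclidean_space set"
  assumes "A \<in> sets borel" "B \<in> sets borel"
  shows "emeasure lborel (A \<times> B) = emeasure lborel A * emeasure lborel B"
  using lborel.emeasure_pair_measure_Times[of A lborel B] assms by (simp add: lborel_prod)

lemma emeasure_disc:
  fixes c :: "real \<times> real"
  shows "0 \<le> r \<Longrightarrow> emeasure lborel (ball c r) = ennreal (pi * r\<^sup>2)"
  by (subst emeasure_ball) (auto simp: unit_ball_vol_2 power2_eq_square)

lemma emeasure_annulus_le:
  assumes d: "0 \<le> d"
  shows "emeasure lborel {b :: real \<times> real. \<bar>(norm b)\<^sup>2 - c\<bar> < d} \<le> ennreal (2 * pi * d)"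
proof (cases "0 < c + d")
  case True
  define r1 r2 where "r1 = sqrt (max 0 (c - d))" and "r2 = sqrt (c + d)"
  have r: "0 \<le> r1" "r1 \<le> r2" "0 \<le> r2" using True d by (auto simp: r1_def r2_def)
  have sq: "r1\<^sup>2 = max 0 (c - d)" "r2\<^sup>2 = c + d" using True by (auto simp: r1_def r2_def)
  have "{b :: real \<times> real. \<bar>(norm b)\<^sup>2 - c\<bar> < d} \<subseteq> ball 0 r2 - ball 0 r1"
  proof (clarify, intro DiffI)
    fix x y :: real
    let ?b = "(x, y)"
    assume b: "\<bar>(norm ?b)\<^sup>2 - c\<bar> < d"
    then have "(norm ?b)\<^sup>2 < r2\<^sup>2" using sq by auto
    then show "?b \<in> ball 0 r2" using r by (simp add: power2_less_imp_less)
    have "c - d < (norm ?b)\<^sup>2" using b by auto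
    then have "r1\<^sup>2 \<le> (norm ?b)\<^sup>2" using sq by auto
    then have "r1 \<le> norm ?b" by (rule power2_le_imp_le) simp
    then show "?b \<notin> ball 0 r1" by simp
  qed
  then have "emeasure lborel {b :: real \<times> real. \<bar>(norm b)\<^sup>2 - c\<bar> < d}
      \<le> emeasure lborel (ball 0 r2 - ball (0 :: real \<times> real) r1)"
    by (intro emeasure_mono) auto
  also have "\<dots> = emeasure lborel (ball (0 :: real \<times> real) r2) - emeasure lborel (ball (0 :: real \<times> real) r1)"
    using r by (intro emeasure_Diff) (auto simp: emeasure_disc)
  also have "\<dots> = ennreal (pi * r2\<^sup>2 - pi * r1\<^sup>2)"
    using r by (simp add: emeasure_disc ennreal_minus)
  also have "\<dots> \<le> ennreal (2 * pi * d)"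
  proof (rule ennreal_leI)
    have "r2\<^sup>2 - r1\<^sup>2 \<le> 2 * d" unfolding sq by auto
    then have "pi * (r2\<^sup>2 - r1\<^sup>2) \<le> pi * (2 * d)" by (intro mult_left_mono) auto
    then show "pi * r2\<^sup>2 - pi * r1\<^sup>2 \<le> 2 * pi * d" by (simp add: algebra_simps)
  qed
  finally show ?thesis .
next
  case False
  have "\<not> \<bar>(norm b)\<^sup>2 - c\<bar> < d" for b :: "real \<times> real"
    using False zero_le_power2[of "norm b"] by linarith
  then show ?thesis by simp
qed

text \<open>
  Over each position the momenta of a shell of energies of width \<open>2 * m\<close> fill an annulus or a disc
  of area at most \<open>4 * pi\<^sup>2 * m\<close>, whatever the value of the potential.
\<close>
lemma emeasure_energy_shell_le:
  fixes B :: "((real \<times> real) \<times> (real \<times> real)) set"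
  assumes B: "B \<in> sets borel" and Q: "Q \<in> sets borel" and m: "0 \<le> m"
    and sub: "\<And>a b. (a, b) \<in> B \<Longrightarrow> a \<in> Q \<and> \<bar>(norm b)\<^sup>2 / (2 * pi) - potential a\<bar> < m"
  shows "emeasure lborel B \<le> ennreal (4 * pi\<^sup>2 * m) * emeasure lborel Q"
proof -
  have "emeasure lborel B = (\<integral>\<^sup>+a. emeasure lborel (Pair a -` B) \<partial>lborel)"
    using B lborel.emeasure_pair_measure_alt[of B lborel, unfolded lborel_prod] by simp
  also have "\<dots> \<le> (\<integral>\<^sup>+a. ennreal (4 * pi\<^sup>2 * m) * indicator Q a \<partial>lborel)"
  proof (rule nn_integral_mono)
    fix a :: "real \<times> real"
    show "emeasure lborel (Pair a -` B) \<le> ennreal (4 * pi\<^sup>2 * m) * indicator Q a"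
    proof (cases "a \<in> Q")
      case True
      have "Pair a -` B \<subseteq> {b. \<bar>(norm b)\<^sup>2 - 2 * pi * potential a\<bar> < 2 * pi * m}"
      proof
        fix b assume "b \<in> Pair a -` B"
        then have "\<bar>(norm b)\<^sup>2 / (2 * pi) - potential a\<bar> < m" using sub by auto
        then have "2 * pi * \<bar>(norm b)\<^sup>2 / (2 * pi) - potential a\<bar> < 2 * pi * m" by simp
        also have "2 * pi * \<bar>(norm b)\<^sup>2 / (2 * pi) - potential a\<bar>
            = \<bar>2 * pi * ((norm b)\<^sup>2 / (2 * pi) - potential a)\<bar>" by (simp add: abs_mult)
        finally show "b \<in> {b. \<bar>(norm b)\<^sup>2 - 2 * pi * potential a\<bar> < 2 * pi * m}"
          by (simp add: right_diff_distrib)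
      qed
      then have "emeasure lborel (Pair a -` B)
          \<le> emeasure lborel {b :: real \<times> real. \<bar>(norm b)\<^sup>2 - 2 * pi * potential a\<bar> < 2 * pi * m}"
        by (rule emeasure_mono) (auto intro!: borel_open open_Collect_less continuous_intros)
      also have "\<dots> \<le> ennreal (2 * pi * (2 * pi * m))"
        using m by (intro emeasure_annulus_le) auto
      finally show ?thesis using True by (simp add: power2_eq_square mult_ac)
    next
      case False
      then have "Pair a -` B = {}" using sub by auto
      then show ?thesis by simp
    qed
  qed
  also have "\<dots> = ennreal (4 * pi\<^sup>2 * m) * emeasure lborel Q"
    using Q by (simp add: nn_integral_cmult_indicator)
  finally show ?thesis .
qed

text \<open>The states whose orbit collapses before any binary collision.\<close>
definition collapse_states :: "((real \<times> real) \<times> (real \<times> real)) set" where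
  "collapse_states = {z. \<exists>h \<tau> q p. 0 < \<tau> \<and> classical_solution_on h {0..<\<tau>} q p \<and>
     z = (q 0, p 0) \<and> (q \<longlongrightarrow> 0) (at_left \<tau>)}"

lemma grid_instant_before:
  fixes n m :: nat
  assumes n: "0 < n" and \<tau>: "1 / real n < \<tau>" "\<tau> \<le> real m"
  obtains k where "k \<le> n * m" "0 < real k / real n" "real k / real n < \<tau>" "\<tau> - real k / real n \<le> 1 / real n"
proof -
  define k where "k = nat (\<lceil>\<tau> * real n\<rceil> - 1)"
  have 1: "1 < \<tau> * real n" using n \<tau> by (simp add: field_simps)
  then have c: "2 \<le> \<lceil>\<tau> * real n\<rceil>" by linarith
  have k: "real k = of_int \<lceil>\<tau> * real n\<rceil> - 1" using c by (simp add: k_def)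
  have lt: "real k < \<tau> * real n" "\<tau> * real n \<le> real k + 1" unfolding k by linarith+
  have "\<tau> * real n \<le> real (n * m)" using \<tau> n by (simp add: mult.commute mult_right_mono)
  then have "k \<le> n * m" using lt by linarith
  moreover have "0 < real k" using c k by auto
  moreover have "\<tau> \<le> (real k + 1) / real n" using lt n by (simp add: field_simps)
  ultimately show ?thesis
    using lt n by (intro that[of k]) (auto simp: pos_divide_less_eq add_divide_distrib)
qed

lemma negligible_collapse_states: "negligible collapse_states"
proof -
  define A where "A = (\<lambda>m :: nat. {z :: (real \<times> real) \<times> (real \<times> real). \<exists>h \<tau> q p. classical_solution_on h {0..<\<tau>} q p \<and> z = (q 0, p 0) \<and>
     (q \<longlongrightarrow> 0) (at_left \<tau>) \<and> \<bar>h\<bar> < real m \<and> \<tau> \<le> real m \<and> 1 / real m < \<tau> \<and>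
     (\<forall>t. \<tau> - 1 / real m < t \<and> t < \<tau> \<longrightarrow> norm (q t) < 1)})"
  have "negligible (A m)" for m
  proof (cases "m = 0")
    case True
    then show ?thesis by (auto simp: A_def)
  next
    case m: False
    \<comment> \<open>In a time \<open>1 / n\<close> before the collapse the position is within \<open>1 / n\<^sup>2\<close> of an axis, or the momentum
      is so small that the position is within \<open>\<rho> n\<close> of the origin; both sets have area \<open>o(1 / n)\<close>.\<close>
    define \<rho> where "\<rho> = (\<lambda>n :: nat. 2 / real n * sqrt (2 * pi * (real m + 6 * ln (real n)) + 6 * pi))"
    define Q where "Q = (\<lambda>n :: nat. {- \<rho> n<..<\<rho> n} \<times> {- \<rho> n<..<\<rho> n}
       \<union> ({- (1 / (real n)\<^sup>2)<..<1 / (real n)\<^sup>2} \<times> {- 1<..<1}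
       \<union> {- 1<..<1} \<times> {- (1 / (real n)\<^sup>2)<..<1 / (real n)\<^sup>2}))"
    define B where "B = (\<lambda>n. {z :: (real \<times> real) \<times> (real \<times> real). fst z \<in> Q n \<and> fst (fst z) \<noteq> 0 \<and> snd (fst z) \<noteq> 0 \<and>
       \<bar>(norm (snd z))\<^sup>2 / (2 * pi) - potential (fst z)\<bar> < real m})"
    define \<beta> where "\<beta> = (\<lambda>n. 4 * pi\<^sup>2 * real m * ((2 * \<rho> n) * (2 * \<rho> n) + 8 / (real n)\<^sup>2))"
    have rho0: "0 \<le> \<rho> n" if "Suc m \<le> n" for n
      using that m by (auto simp: \<rho>_def intro!: mult_nonneg_nonneg add_nonneg_nonneg)
    have Qo: "open (Q n)" for n unfolding Q_def by (intro open_Un open_Times open_greaterThanLessThan)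
    show ?thesis
    proof (rule negligible_zero_flux[where ?n0.0 = "Suc m" and B = B and \<beta> = \<beta> and K = m])
      show "open (B n)" for n
      proof -
        let ?V = "{z :: (real \<times> real) \<times> (real \<times> real). fst z \<in> Q n \<and> fst (fst z) \<noteq> 0 \<and> snd (fst z) \<noteq> 0}"
        have "open ?V"
          using Qo by (intro open_Collect_conj open_Collect_neq continuous_intros)
            (simp add: open_vimage_fst vimage_def[symmetric])
        moreover have "continuous_on ?V (\<lambda>z. \<bar>(norm (snd z))\<^sup>2 / (2 * pi) - potential (fst z)\<bar>)"
          by (intro continuous_intros continuous_on_compose2[OF continuous_on_potential]) auto
        ultimately have "open (?V \<inter> (\<lambda>z. \<bar>(norm (snd z))\<^sup>2 / (2 * pi) - potential (fst z)\<bar>) -` {..<real m})"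
          by (intro continuous_open_preimage) auto
        also have "\<dots> = B n" by (auto simp: B_def)
        finally show ?thesis .
      qed
      then have Bb: "B n \<in> sets borel" for n by auto
      show "emeasure lborel (B n) \<le> ennreal (\<beta> n)" if n: "Suc m \<le> n" for n
      proof -
        have "emeasure lborel (Q n) \<le> ennreal (2 * \<rho> n) * ennreal (2 * \<rho> n)
            + (ennreal (2 / (real n)\<^sup>2) * ennreal 2 + ennreal 2 * ennreal (2 / (real n)\<^sup>2))"
          unfolding Q_def
          by (intro order_trans[OF emeasure_subadditive] add_mono)
            (use rho0[OF n] in \<open>auto simp: emeasure_lborel_Times intro!: borel_open open_Un open_Times\<close>)
        also have "\<dots> = ennreal ((2 * \<rho> n) * (2 * \<rho> n) + 8 / (real n)\<^sup>2)"
          using rho0[OF n]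
          by (simp flip: ennreal_mult ennreal_plus ennreal_numeral)
        finally have "ennreal (4 * pi\<^sup>2 * real m) * emeasure lborel (Q n)
            \<le> ennreal (4 * pi\<^sup>2 * real m) * ennreal ((2 * \<rho> n) * (2 * \<rho> n) + 8 / (real n)\<^sup>2)"
          by (intro mult_left_mono) auto
        also have "\<dots> = ennreal (\<beta> n)"
          unfolding \<beta>_def using rho0[OF n] by (intro ennreal_mult[symmetric]) auto
        finally show ?thesis
          using emeasure_energy_shell_le[OF Bb, of "Q n" "real m" n] Qo
          by (force simp: B_def intro: order_trans)
      qed
      have \<beta>_eq: "\<beta> n = 4 * pi\<^sup>2 * real m * (16 / (real n)\<^sup>2 * (2 * pi * (real m + 6 * ln (real n)) + 6 * pi) + 8 / (real n)\<^sup>2)"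
        if "1 \<le> n" for n
      proof -
        have "(sqrt (2 * pi * (real m + 6 * ln (real n)) + 6 * pi))\<^sup>2 = 2 * pi * (real m + 6 * ln (real n)) + 6 * pi"
          using that by (intro real_sqrt_pow2) auto
        then have "(2 * \<rho> n) * (2 * \<rho> n) = 16 / (real n)\<^sup>2 * (2 * pi * (real m + 6 * ln (real n)) + 6 * pi)"
          unfolding \<rho>_def by (simp add: power2_eq_square)
        then show ?thesis unfolding \<beta>_def by simp
      qed
      have lim: "(\<lambda>n. real n * (4 * pi\<^sup>2 * real m * (16 / (real n)\<^sup>2 * (2 * pi * (real m + 6 * ln (real n)) + 6 * pi) + 8 / (real n)\<^sup>2)))
          \<longlonglongrightarrow> 0"
        by real_asymp
      show "(\<lambda>n. real n * \<beta> n) \<longlonglongrightarrow> 0"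
        by (rule Lim_transform_eventually[OF lim])
          (use eventually_ge_at_top[of "1 :: nat"] in \<open>eventually_elim, simp add: \<beta>_eq\<close>)
      fix n z assume n: "Suc m \<le> n" and "z \<in> A m"
      then obtain h \<tau> q p where sol: "classical_solution_on h {0..<\<tau>} q p" and z: "z = (q 0, p 0)"
        and lim: "(q \<longlongrightarrow> 0) (at_left \<tau>)" and h: "\<bar>h\<bar> < real m" and \<tau>: "\<tau> \<le> real m" "1 / real m < \<tau>"
        and near: "\<And>t. \<tau> - 1 / real m < t \<Longrightarrow> t < \<tau> \<Longrightarrow> norm (q t) < 1"
        unfolding A_def by auto
      have nm: "1 / real n < 1 / real m" using n m by (simp add: field_simps)
      obtain k where k: "k \<le> n * m" "0 < real k / real n" "real k / real n < \<tau>"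
        "\<tau> - real k / real n \<le> 1 / real n"
        using grid_instant_before[of n \<tau> m] n \<tau> nm by auto
      define t where "t = real k / real n"
      note S = classical_solutionD[OF sol, of t]
      have t: "t \<in> {0..<\<tau>}" using k by (simp add: t_def)
      have q1: "norm (q t) < 1" using near[of t] k nm by (simp add: t_def)
      then have q1': "\<bar>fst (q t)\<bar> < 1" "\<bar>snd (q t)\<bar> < 1"
        using abs_fst_le_norm[of "q t"] abs_snd_le_norm[of "q t"] by auto
      have "q t \<in> Q n"
      proof (cases "\<bar>fst (q t)\<bar> < 1 / (real n)\<^sup>2 \<or> \<bar>snd (q t)\<bar> < 1 / (real n)\<^sup>2")
        case True
        then show ?thesis using q1' unfolding Q_def by (cases "q t") auto
      next
        case False
        have ln: "- ln v \<le> 2 * ln (real n)" if "1 / (real n)\<^sup>2 \<le> \<bar>v\<bar>" for v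
        proof -
          have "ln (1 / (real n)\<^sup>2) \<le> ln \<bar>v\<bar>" using that n by (intro ln_mono) auto
          moreover have "ln \<bar>v\<bar> = ln v" by (auto simp: abs_if ln_minus)
          ultimately show ?thesis using n by (simp add: ln_div ln_realpow)
        qed
        have "1 / (real n)\<^sup>2 \<le> \<bar>norm (q t)\<bar>" using False abs_fst_le_norm[of "q t"] by auto
        then have "- ln (norm (q t)) \<le> 2 * ln (real n)" by (rule ln)
        moreover have "- ln (fst (q t)) \<le> 2 * ln (real n)" "- ln (snd (q t)) \<le> 2 * ln (real n)"
          using False by (auto intro: ln)
        moreover have "0 \<le> ln (8 :: real)" by (rule ln_ge_zero) simp
        ultimately have "potential (q t) \<le> 6 * ln (real n)"
          unfolding potential_eq_sum_ln[OF S(1,2)[OF t]] by linarith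
        then have "2 * pi * (h + potential (q t)) \<le> 2 * pi * (real m + 6 * ln (real n))"
          using h by (intro mult_left_mono) auto
        then have p: "(norm (p t))\<^sup>2 \<le> 2 * pi * (real m + 6 * ln (real n))" using S(5)[OF t] by simp
        have "norm (q t) \<le> 2 / pi * (\<tau> - t) * sqrt ((norm (p t))\<^sup>2 + 6 * pi)"
          by (rule collapse_position_bound[OF sol lim]) (use k in \<open>auto simp: t_def\<close>)
        also have "\<dots> \<le> 2 / pi * (1 / real n) * sqrt (2 * pi * (real m + 6 * ln (real n)) + 6 * pi)"
          using k p by (intro mult_mono real_sqrt_le_mono) (auto simp: t_def)
        also have "\<dots> < \<rho> n"
        proof -
          have "0 < 2 * pi * (real m + 6 * ln (real n)) + 6 * pi"
            using n by (intro add_nonneg_pos) auto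
          then have "0 < sqrt (2 * pi * (real m + 6 * ln (real n)) + 6 * pi)" by simp
          moreover have "2 / pi * (1 / real n) < 2 / real n"
            using n pi_ge_two by (simp add: divide_simps)
          ultimately show ?thesis unfolding \<rho>_def by (intro mult_strict_right_mono)
        qed
        finally have "\<bar>fst (q t)\<bar> < \<rho> n" "\<bar>snd (q t)\<bar> < \<rho> n"
          using abs_fst_le_norm[of "q t"] abs_snd_le_norm[of "q t"] by auto
        then show ?thesis unfolding Q_def by (cases "q t") auto
      qed
      then have "(q t, p t) \<in> B n" using S(1,2,5)[OF t] h by (simp add: B_def)
      moreover have "flows_to t z (q t, p t)"
        unfolding z using t by (intro flows_toI[OF sol]) auto
      ultimately show "\<exists>k\<le>n * m. \<exists>w\<in>B n. flows_to (real k / real n) z w"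
        using k(1) by (auto simp: t_def)
    qed
  qed
  then have "negligible (\<Union>m. A m)" by (rule negligible_Union_nat)
  moreover have "collapse_states \<subseteq> (\<Union>m. A m)"
  proof
    fix z assume "z \<in> collapse_states"
    then obtain h \<tau> q p where sol: "0 < \<tau>" "classical_solution_on h {0..<\<tau>} q p" "z = (q 0, p 0)"
      and lim: "(q \<longlongrightarrow> 0) (at_left \<tau>)"
      unfolding collapse_states_def by auto
    have "\<forall>\<^sub>F t in at_left \<tau>. norm (q t) < 1"
      using tendsto_norm_zero[OF lim] by (rule order_tendstoD) simp
    then obtain t1 where t1: "t1 < \<tau>" "\<And>t. t1 < t \<Longrightarrow> t < \<tau> \<Longrightarrow> norm (q t) < 1"
      by (auto simp: eventually_at_left_field)
    obtain m :: nat where m: "max (max (\<bar>h\<bar> + 1) \<tau>) (max (1 / \<tau> + 1) (1 / (\<tau> - t1) + 1)) \<le> real m"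
      using real_arch_simple by blast
    have inv: "1 / real m < \<tau>" "1 / real m < \<tau> - t1"
    proof -
      have "1 / \<tau> < real m" "1 / (\<tau> - t1) < real m" using m by auto
      moreover have "0 < real m" using m sol by auto
      ultimately show "1 / real m < \<tau>" "1 / real m < \<tau> - t1" using sol t1 by (auto simp: field_simps)
    qed
    have bnd: "norm (q t) < 1" if "\<tau> - 1 / real m < t" "t < \<tau>" for t
      using t1(2)[of t] that inv by auto
    have "\<tau> \<le> real m" "\<bar>h\<bar> < real m" using m by auto
    with sol lim inv bnd have "z \<in> A m" unfolding A_def by blast
    then show "z \<in> (\<Union>m. A m)" by auto
  qed
  ultimately show ?thesis by (rule negligible_subset)
qed

text \<open>
  The states whose orbit comes to rest off the axes before any binary collision.
\<close>
definition rest_states :: "((real \<times> real) \<times> (real \<times> real)) set" where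
  "rest_states = {z. \<exists>h \<tau> q p e R. 0 < \<tau> \<and> classical_solution_on h {0..<\<tau>} q p \<and> z = (q 0, p 0) \<and>
     (p \<longlongrightarrow> 0) (at_left \<tau>) \<and> 0 < e \<and>
     (\<forall>\<^sub>F t in at_left \<tau>. e \<le> \<bar>fst (q t)\<bar> \<and> e \<le> \<bar>snd (q t)\<bar> \<and> norm (q t) \<le> R)}"

lemma negligible_rest_states: "negligible rest_states"
proof -
  define A where "A = (\<lambda>m :: nat. {z :: (real \<times> real) \<times> (real \<times> real). \<exists>h \<tau> q p. classical_solution_on h {0..<\<tau>} q p \<and> z = (q 0, p 0) \<and>
     (p \<longlongrightarrow> 0) (at_left \<tau>) \<and> \<tau> \<le> real m \<and> 1 / real m < \<tau> \<and>
     (\<forall>t. \<tau> - 1 / real m < t \<and> t < \<tau> \<longrightarrow> 1 / real m \<le> \<bar>fst (q t)\<bar> \<and> 1 / real m \<le> \<bar>snd (q t)\<bar> \<and> norm (q t) \<le> real m)})"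
  have "negligible (A m)" for m
  proof (cases "m = 0")
    case True
    then have "A m = {}" by (auto simp: A_def)
    then show ?thesis by simp
  next
    case m: False
    \<comment> \<open>the force is at most \<open>3 * m\<close> near the end, hence the momentum at most \<open>3 * m / n\<close>\<close>
    define B where "B = (\<lambda>n :: nat. ball (0 :: real \<times> real) (real m + 1) \<times> ball (0 :: real \<times> real) (4 * real m / real n))"
    define \<beta> where "\<beta> = (\<lambda>n :: nat. (pi * (real m + 1)\<^sup>2) * (pi * (4 * real m / real n)\<^sup>2))"
    show ?thesis
    proof (rule negligible_zero_flux[where ?n0.0 = "Suc m" and B = B and \<beta> = \<beta> and K = m])
      show "open (B n)" for n unfolding B_def by (intro open_Times open_ball)
      show "emeasure lborel (B n) \<le> ennreal (\<beta> n)" for n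
        unfolding B_def \<beta>_def by (simp add: emeasure_lborel_Times emeasure_disc ennreal_mult)
      have "real n * \<beta> n = 16 * (real m)\<^sup>2 * pi\<^sup>2 * (real m + 1)\<^sup>2 / real n" for n
        by (simp add: \<beta>_def power2_eq_square)
      then show "(\<lambda>n. real n * \<beta> n) \<longlonglongrightarrow> 0" by (simp add: lim_const_over_n)
      fix n z assume n: "Suc m \<le> n" and "z \<in> A m"
      then obtain h \<tau> q p where sol: "classical_solution_on h {0..<\<tau>} q p" and z: "z = (q 0, p 0)"
        and lim: "(p \<longlongrightarrow> 0) (at_left \<tau>)" and \<tau>: "\<tau> \<le> real m" "1 / real m < \<tau>"
        and near: "\<And>t. \<tau> - 1 / real m < t \<Longrightarrow> t < \<tau> \<Longrightarrow>
          1 / real m \<le> \<bar>fst (q t)\<bar> \<and> 1 / real m \<le> \<bar>snd (q t)\<bar> \<and> norm (q t) \<le> real m"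
        unfolding A_def by auto
      have nm: "1 / real n < 1 / real m" using n m by (simp add: field_simps)
      obtain k where k: "k \<le> n * m" "0 < real k / real n" "real k / real n < \<tau>"
        "\<tau> - real k / real n \<le> 1 / real n"
        using grid_instant_before[of n \<tau> m] n \<tau> nm by auto
      define t where "t = real k / real n"
      have t: "\<tau> - 1 / real m < t" "t < \<tau>" "0 < t" using k nm by (auto simp: t_def)
      have bnd: "norm (p t) \<le> norm (p v) + 3 * real m * (\<tau> - t)" if v: "t < v" "v < \<tau>" for v
      proof -
        have "norm (p v - p t) \<le> 3 * real m * (v - t)"
        proof (rule norm_diff_le_of_vector_derivative[where f' = "\<lambda>s. force (q s)"])
          fix s assume s: "s \<in> {t..v}"
          show "(p has_vector_derivative force (q s)) (at s within {t..v})"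
            using s v t by (intro has_vector_derivative_within_subset[OF classical_solutionD(4)[OF sol]]) auto
          show "norm (force (q s)) \<le> 3 * real m"
            using norm_force_le[of "1 / real m" "q s"] near[of s] s v t m by simp
        qed (use v in auto)
        also have "\<dots> \<le> 3 * real m * (\<tau> - t)" using v by (intro mult_left_mono) auto
        finally show ?thesis
          using norm_triangle_ineq2[of "p t" "p v"] by (simp add: norm_minus_commute)
      qed
      have "norm (p t) \<le> norm (0 :: real \<times> real) + 3 * real m * (\<tau> - t)"
      proof (rule tendsto_le[of "at_left \<tau>"])
        show "((\<lambda>v. norm (p v) + 3 * real m * (\<tau> - t)) \<longlongrightarrow> norm (0 :: real \<times> real) + 3 * real m * (\<tau> - t))
            (at_left \<tau>)"
          by (intro tendsto_intros lim)
        show "\<forall>\<^sub>F v in at_left \<tau>. norm (p t) \<le> norm (p v) + 3 * real m * (\<tau> - t)"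
          using eventually_at_left_field[of _ \<tau>] bnd t by blast
      qed (auto intro: tendsto_intros)
      also have "\<dots> \<le> 3 * real m * (1 / real n)"
        using mult_left_mono[OF k(4), of "3 * real m"] by (simp add: t_def)
      also have "\<dots> < 4 * real m / real n" using m n by (simp add: divide_simps)
      finally have "(q t, p t) \<in> B n" using near[OF t(1,2)] by (simp add: B_def)
      moreover have "flows_to t z (q t, p t)"
        unfolding z using t by (intro flows_toI[OF sol]) auto
      ultimately show "\<exists>k\<le>n * m. \<exists>w\<in>B n. flows_to (real k / real n) z w"
        using k(1) by (auto simp: t_def)
    qed
  qed
  then have "negligible (\<Union>m. A m)" by (rule negligible_Union_nat)
  moreover have "rest_states \<subseteq> (\<Union>m. A m)"
  proof
    fix z assume "z \<in> rest_states"
    then obtain h \<tau> q p e R where sol: "0 < \<tau>" "classical_solution_on h {0..<\<tau>} q p" "z = (q 0, p 0)"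
      and lim: "(p \<longlongrightarrow> 0) (at_left \<tau>)" and e: "0 < e"
      and ev: "\<forall>\<^sub>F t in at_left \<tau>. e \<le> \<bar>fst (q t)\<bar> \<and> e \<le> \<bar>snd (q t)\<bar> \<and> norm (q t) \<le> R"
      unfolding rest_states_def by blast
    obtain t1 where t1: "t1 < \<tau>"
      "\<And>t. t1 < t \<Longrightarrow> t < \<tau> \<Longrightarrow> e \<le> \<bar>fst (q t)\<bar> \<and> e \<le> \<bar>snd (q t)\<bar> \<and> norm (q t) \<le> R"
      using ev by (auto simp: eventually_at_left_field)
    obtain m :: nat where m: "max (max (1 / e + 1) (max R \<tau>)) (max (1 / \<tau> + 1) (1 / (\<tau> - t1) + 1)) \<le> real m"
      using real_arch_simple by blast
    have inv: "1 / real m < \<tau>" "1 / real m < \<tau> - t1" "1 / real m < e"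
    proof -
      have "1 / \<tau> < real m" "1 / (\<tau> - t1) < real m" "1 / e < real m" using m by auto
      moreover have "0 < real m" using m sol by auto
      ultimately show "1 / real m < \<tau>" "1 / real m < \<tau> - t1" "1 / real m < e"
        using sol t1 e by (auto simp: field_simps)
    qed
    have bnd: "1 / real m \<le> \<bar>fst (q t)\<bar> \<and> 1 / real m \<le> \<bar>snd (q t)\<bar> \<and> norm (q t) \<le> real m"
      if "\<tau> - 1 / real m < t" "t < \<tau>" for t
      using t1(2)[of t] that inv m by auto
    have "\<tau> \<le> real m" using m by auto
    with sol lim inv bnd have "z \<in> A m" unfolding A_def by blast
    then show "z \<in> (\<Union>m. A m)" by auto
  qed
  ultimately show ?thesis by (rule negligible_subset)
qed

section \<open>Passage through a binary collision\<close>

text \<open>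
  The square of the momentum conjugate to \<open>u\<close>, at the position \<open>(u, y)\<close>, when the other component
  of the momentum is \<open>g\<close> and the energy is \<open>h\<close>.
\<close>
definition sq_momentum :: "real \<Rightarrow> real \<Rightarrow> real \<Rightarrow> real \<Rightarrow> real" where
  "sq_momentum h u y g = 2 * pi * (h + potential (u, y)) - g\<^sup>2"

text \<open>The second component of the force at \<open>(u, y)\<close>, multiplied by \<open>pi\<close> because velocity is momentum over \<open>pi\<close>.\<close>
definition crossing_force :: "real \<Rightarrow> real \<Rightarrow> real" where
  "crossing_force u y = - pi * (y / (norm (u, y))\<^sup>2 + 1 / y)"

text \<open>
  A passage through \<open>u = 0\<close>, parametrized by the vanishing coordinate \<open>u\<close> instead of time. In this
  parametrization the remaining coordinate \<open>Y\<close> and its momentum \<open>G\<close> solve a differential equation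
  that depends on them and on \<open>h\<close> in a Lipschitz continuous way, uniformly in \<open>u\<close>: the term \<open>- ln u\<close>,
  by which the potential diverges at \<open>u = 0\<close>, does not involve them, and it enters only through the
  momentum in the denominator, which is at least 1. The bounds by \<open>m\<close> make the Lipschitz constant
  uniform over curves.
\<close>
definition crossing_curve ::
    "real \<Rightarrow> real \<Rightarrow> real \<Rightarrow> (real \<Rightarrow> real) \<Rightarrow> (real \<Rightarrow> real) \<Rightarrow> bool" where
  "crossing_curve m h c Y G \<longleftrightarrow> 0 < c \<and> c \<le> 1 \<and>
     continuous_on {-c..c} Y \<and> continuous_on {-c..c} G \<and>
     (\<forall>u\<in>{-c..c}. 1 / m \<le> \<bar>Y u\<bar> \<and> \<bar>Y u\<bar> \<le> m \<and> \<bar>G u\<bar> \<le> m) \<and>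
     (\<forall>u\<in>{-c..c} - {0}. 1 \<le> sq_momentum h u (Y u) (G u)) \<and>
     (\<forall>u\<in>{-c<..<c} - {0}.
        (Y has_real_derivative G u / sqrt (sq_momentum h u (Y u) (G u))) (at u) \<and>
        (G has_real_derivative crossing_force u (Y u) / sqrt (sq_momentum h u (Y u) (G u))) (at u))"

lemma abs_ln_diff_le:
  fixes v w :: real
  assumes e: "0 < e" "e \<le> \<bar>v\<bar>" "e \<le> \<bar>w\<bar>"
  shows "\<bar>ln v - ln w\<bar> \<le> \<bar>v - w\<bar> / e"
proof -
  have *: "ln \<bar>a\<bar> - ln \<bar>b\<bar> \<le> \<bar>v - w\<bar> / e" if "0 < e" "e \<le> \<bar>a\<bar>" "e \<le> \<bar>b\<bar>" "\<bar>a\<bar> - \<bar>b\<bar> \<le> \<bar>v - w\<bar>" for a b :: real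
  proof -
    have "a \<noteq> 0" "b \<noteq> 0" using that by auto
    then have "ln \<bar>a\<bar> - ln \<bar>b\<bar> = ln (\<bar>a\<bar> / \<bar>b\<bar>)" by (simp add: ln_div)
    also have "\<dots> \<le> \<bar>a\<bar> / \<bar>b\<bar> - 1" using that by (intro ln_le_minus_one divide_pos_pos) auto
    also have "\<dots> = (\<bar>a\<bar> - \<bar>b\<bar>) / \<bar>b\<bar>" using that by (auto simp: diff_divide_distrib)
    also have "\<dots> \<le> \<bar>v - w\<bar> / \<bar>b\<bar>" using that by (intro divide_right_mono) auto
    also have "\<dots> \<le> \<bar>v - w\<bar> / e" using that by (intro divide_left_mono mult_pos_pos) auto
    finally show ?thesis .
  qed
  have "ln \<bar>a\<bar> = ln a" for a :: real by (auto simp: abs_if ln_minus)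
  then show ?thesis using *[of v w] *[of w v] e by (auto simp: abs_le_iff)
qed

lemma abs_quotient_diff_le:
  fixes a b s t :: real
  assumes s: "1 \<le> s" and t: "1 \<le> t"
  shows "\<bar>a / sqrt s - b / sqrt t\<bar> \<le> \<bar>a - b\<bar> + \<bar>b\<bar> * \<bar>s - t\<bar>"
proof -
  have r: "1 \<le> sqrt s" "1 \<le> sqrt t" using s t by auto
  have "\<bar>sqrt s - sqrt t\<bar> * 1 \<le> \<bar>sqrt s - sqrt t\<bar> * (sqrt s + sqrt t)"
    by (rule mult_left_mono) (use r in linarith, simp)
  also have "\<dots> = \<bar>(sqrt s - sqrt t) * (sqrt s + sqrt t)\<bar>" using r by (simp add: abs_mult)
  also have "(sqrt s - sqrt t) * (sqrt s + sqrt t) = s - t"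
    using s t by (simp add: algebra_simps)
  finally have "\<bar>1 / sqrt s - 1 / sqrt t\<bar> \<le> \<bar>s - t\<bar>"
    using abs_diff_inverse_le[of 1 "sqrt s" "sqrt t"] r by auto
  then have 2: "\<bar>b * (1 / sqrt s - 1 / sqrt t)\<bar> \<le> \<bar>b\<bar> * \<bar>s - t\<bar>"
    unfolding abs_mult by (intro mult_left_mono) auto
  have 1: "\<bar>(a - b) / sqrt s\<bar> \<le> \<bar>a - b\<bar>"
  proof -
    have "\<bar>a - b\<bar> / sqrt s \<le> \<bar>a - b\<bar> / 1" using r by (intro divide_left_mono) auto
    then show ?thesis using r by (simp add: abs_divide)
  qed
  have "a / sqrt s - b / sqrt t = (a - b) / sqrt s + b * (1 / sqrt s - 1 / sqrt t)"
    by (simp add: diff_divide_distrib right_diff_distrib)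
  then show ?thesis using order_trans[OF abs_triangle_ineq add_mono[OF 1 2]] by simp
qed

lemma abs_crossing_force_le:
  assumes m: "1 \<le> m" and u: "u \<noteq> 0" and y: "1 / m \<le> \<bar>y\<bar>"
  shows "\<bar>crossing_force u y\<bar> \<le> 2 * pi * m"
proof -
  have m0: "0 < 1 / m" using m by simp
  have n: "1 / m \<le> norm (u, y)" using y abs_snd_le_norm[of "(u, y)"] by auto
  have "\<bar>y\<bar> / (norm (u, y))\<^sup>2 \<le> norm (u, y) / (norm (u, y))\<^sup>2"
    using abs_snd_le_norm[of "(u, y)"] by (intro divide_right_mono) auto
  also have "\<dots> = 1 / norm (u, y)" using u by (simp add: power2_eq_square)
  also have "\<dots> \<le> 1 / (1 / m)" using n m0 by (intro divide_left_mono mult_pos_pos) (auto simp del: norm_Pair)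
  finally have a: "\<bar>y / (norm (u, y))\<^sup>2\<bar> \<le> m" by simp
  have "1 / \<bar>y\<bar> \<le> 1 / (1 / m)" using y m0 by (intro divide_left_mono mult_pos_pos) auto
  then have b: "\<bar>1 / y\<bar> \<le> m" by simp
  have "\<bar>crossing_force u y\<bar> = pi * \<bar>y / (norm (u, y))\<^sup>2 + 1 / y\<bar>"
    by (simp add: crossing_force_def abs_mult)
  also have "\<dots> \<le> pi * (m + m)"
    using a b abs_triangle_ineq[of "y / (norm (u, y))\<^sup>2" "1 / y"] by (intro mult_left_mono) auto
  finally show ?thesis by simp
qed

text \<open>A Lipschitz constant common to all curves with the bound \<open>m\<close>; its value is of no importance.\<close>
definition crossing_constant :: "real \<Rightarrow> real" where
  "crossing_constant m = (1 + m * (2 * pi + 4 * pi * m + 2 * m))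
     + (2 * pi * m\<^sup>2 + 2 * pi * m * (2 * pi + 4 * pi * m + 2 * m))"

lemma crossing_constant_nonneg: "1 \<le> m \<Longrightarrow> 0 \<le> crossing_constant m"
  by (simp add: crossing_constant_def)

lemma crossing_field_lipschitz:
  assumes m: "1 \<le> m" and u: "u \<noteq> 0" and y: "1 / m \<le> \<bar>y\<bar>" "1 / m \<le> \<bar>y'\<bar>"
    and g: "\<bar>g\<bar> \<le> m" "\<bar>g'\<bar> \<le> m"
    and W: "1 \<le> sq_momentum h u y g" "1 \<le> sq_momentum h' u y' g'"
  shows "\<bar>g / sqrt (sq_momentum h u y g) - g' / sqrt (sq_momentum h' u y' g')\<bar>
      \<le> crossing_constant m * (\<bar>y - y'\<bar> + \<bar>g - g'\<bar> + \<bar>h - h'\<bar>)"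
    "\<bar>crossing_force u y / sqrt (sq_momentum h u y g)
       - crossing_force u y' / sqrt (sq_momentum h' u y' g')\<bar>
      \<le> crossing_constant m * (\<bar>y - y'\<bar> + \<bar>g - g'\<bar> + \<bar>h - h'\<bar>)"
proof -
  define M where "M = 2 * pi + 4 * pi * m + 2 * m"
  define L where "L = (1 + m * M) + (2 * pi * m\<^sup>2 + 2 * pi * m * M)"
  have M0: "0 \<le> M" using m by (simp add: M_def)
  have L: "1 + m * M \<le> L" "2 * pi * m\<^sup>2 + 2 * pi * m * M \<le> L" using m M0 by (auto simp: L_def)
  have Lm: "crossing_constant m = L" by (simp add: crossing_constant_def L_def M_def)
  define D where "D = \<bar>y - y'\<bar> + \<bar>g - g'\<bar> + \<bar>h - h'\<bar>"
  have D: "\<bar>y - y'\<bar> \<le> D" "\<bar>g - g'\<bar> \<le> D" "\<bar>h - h'\<bar> \<le> D" "0 \<le> D" by (auto simp: D_def)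
  have m0: "0 < 1 / m" using m by simp
  have nz: "y \<noteq> 0" "y' \<noteq> 0" using y m0 by auto
  have n: "1 / m \<le> norm (u, y)" "1 / m \<le> norm (u, y')"
    using y abs_snd_le_norm[of "(u, y)"] abs_snd_le_norm[of "(u, y')"] by auto
  have nd: "norm ((u, y) - (u, y')) = \<bar>y - y'\<bar>" by (simp add: norm_prod_def)
  have nn: "\<bar>norm (u, y) - norm (u, y')\<bar> \<le> \<bar>y - y'\<bar>"
    using norm_triangle_ineq3[of "(u, y)" "(u, y')"] nd by simp
  have l1: "\<bar>ln y - ln y'\<bar> \<le> m * \<bar>y - y'\<bar>"
    using abs_ln_diff_le[OF m0 y] by (simp add: mult.commute)
  have "\<bar>ln (norm (u, y)) - ln (norm (u, y'))\<bar> \<le> \<bar>norm (u, y) - norm (u, y')\<bar> / (1 / m)"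
    using n by (intro abs_ln_diff_le[OF m0]) auto
  also have "\<dots> \<le> m * \<bar>y - y'\<bar>" using nn m by (simp add: mult.commute mult_left_mono)
  finally have l2: "\<bar>ln (norm (u, y)) - ln (norm (u, y'))\<bar> \<le> m * \<bar>y - y'\<bar>" .
  have pd: "\<bar>potential (u, y) - potential (u, y')\<bar> \<le> 2 * m * \<bar>y - y'\<bar>"
    using l1 l2 u nz by (simp add: potential_eq_sum_ln)
  have gd: "\<bar>g\<^sup>2 - g'\<^sup>2\<bar> \<le> 2 * m * \<bar>g - g'\<bar>"
  proof -
    have "\<bar>g\<^sup>2 - g'\<^sup>2\<bar> = \<bar>g + g'\<bar> * \<bar>g - g'\<bar>"
      by (simp add: power2_eq_square algebra_simps flip: abs_mult)
    also have "\<dots> \<le> 2 * m * \<bar>g - g'\<bar>" using g by (intro mult_right_mono) auto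
    finally show ?thesis .
  qed
  have Wd: "\<bar>sq_momentum h u y g - sq_momentum h' u y' g'\<bar> \<le> M * D"
  proof -
    have "sq_momentum h u y g - sq_momentum h' u y' g'
        = 2 * pi * (h - h') + 2 * pi * (potential (u, y) - potential (u, y')) - (g\<^sup>2 - g'\<^sup>2)"
      by (simp add: sq_momentum_def algebra_simps)
    then have "\<bar>sq_momentum h u y g - sq_momentum h' u y' g'\<bar>
        \<le> 2 * pi * \<bar>h - h'\<bar> + 2 * pi * \<bar>potential (u, y) - potential (u, y')\<bar> + \<bar>g\<^sup>2 - g'\<^sup>2\<bar>"
      using abs_triangle_ineq[of "2 * pi * (h - h')" "2 * pi * (potential (u, y) - potential (u, y'))"]
        abs_triangle_ineq4[of "2 * pi * (h - h') + 2 * pi * (potential (u, y) - potential (u, y'))" "g\<^sup>2 - g'\<^sup>2"]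
      by (simp add: abs_mult)
    also have "\<dots> \<le> 2 * pi * D + 2 * pi * (2 * m * D) + 2 * m * D"
      using D pd gd m
      by (intro add_mono mult_left_mono order_trans[OF pd] order_trans[OF gd]) auto
    finally show ?thesis by (simp add: M_def algebra_simps)
  qed
  have "\<bar>g / sqrt (sq_momentum h u y g) - g' / sqrt (sq_momentum h' u y' g')\<bar> \<le> D + m * (M * D)"
    using D g Wd m
    by (intro order_trans[OF abs_quotient_diff_le[OF W]] add_mono mult_mono) auto
  also have "\<dots> \<le> L * D"
    using mult_right_mono[OF L(1) D(4)] by (simp add: algebra_simps)
  finally have 1: "\<bar>g / sqrt (sq_momentum h u y g) - g' / sqrt (sq_momentum h' u y' g')\<bar> \<le> L * D" .
  let ?N = "crossing_force u"
  have "\<bar>y / (norm (u, y))\<^sup>2 - y' / (norm (u, y'))\<^sup>2\<bar>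
      \<le> norm ((u, y) /\<^sub>R (norm (u, y))\<^sup>2 - (u, y') /\<^sub>R (norm (u, y'))\<^sup>2)"
    using abs_snd_le_norm[of "(u, y) /\<^sub>R (norm (u, y))\<^sup>2 - (u, y') /\<^sub>R (norm (u, y'))\<^sup>2"]
    by (simp add: divide_inverse mult.commute)
  also have "\<dots> = \<bar>y - y'\<bar> / (norm (u, y) * norm (u, y'))"
    using u by (subst norm_inversion_diff) (auto simp: nd zero_prod_def simp del: diff_Pair)
  also have "\<dots> \<le> \<bar>y - y'\<bar> / ((1 / m) * (1 / m))"
    using n m0 u by (intro divide_left_mono mult_mono mult_pos_pos) (auto simp del: norm_Pair)
  also have "\<dots> \<le> m\<^sup>2 * D"
    using D m by (simp add: power2_eq_square mult.commute mult_left_mono)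
  finally have i1: "\<bar>y / (norm (u, y))\<^sup>2 - y' / (norm (u, y'))\<^sup>2\<bar> \<le> m\<^sup>2 * D" .
  have i2: "\<bar>1 / y - 1 / y'\<bar> \<le> m\<^sup>2 * D"
    using abs_diff_inverse_le[OF m0 y] mult_left_mono[OF D(1), of "m\<^sup>2"]
    by (simp add: power_divide mult.commute)
  have "?N y - ?N y' = - pi * ((y / (norm (u, y))\<^sup>2 - y' / (norm (u, y'))\<^sup>2) + (1 / y - 1 / y'))"
    by (simp add: crossing_force_def algebra_simps)
  then have "\<bar>?N y - ?N y'\<bar> = pi * \<bar>(y / (norm (u, y))\<^sup>2 - y' / (norm (u, y'))\<^sup>2) + (1 / y - 1 / y')\<bar>"
    by (simp add: abs_mult)
  also have "\<dots> \<le> pi * (m\<^sup>2 * D + m\<^sup>2 * D)"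
    using order_trans[OF abs_triangle_ineq add_mono[OF i1 i2]] by (intro mult_left_mono) auto
  finally have Nd: "\<bar>?N y - ?N y'\<bar> \<le> 2 * pi * m\<^sup>2 * D" by (simp add: mult_ac)
  have Nb: "\<bar>?N y'\<bar> \<le> 2 * pi * m" by (rule abs_crossing_force_le[OF m u y(2)])
  have "\<bar>?N y / sqrt (sq_momentum h u y g) - ?N y' / sqrt (sq_momentum h' u y' g')\<bar>
      \<le> 2 * pi * m\<^sup>2 * D + 2 * pi * m * (M * D)"
    using Nd Nb Wd m
    by (intro order_trans[OF abs_quotient_diff_le[OF W]] add_mono mult_mono) auto
  also have "\<dots> \<le> L * D"
    using mult_right_mono[OF L(2) D(4)] by (simp add: algebra_simps)
  finally have 2: "\<bar>?N y / sqrt (sq_momentum h u y g) - ?N y' / sqrt (sq_momentum h' u y' g')\<bar> \<le> L * D" .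
  show "\<bar>g / sqrt (sq_momentum h u y g) - g' / sqrt (sq_momentum h' u y' g')\<bar>
      \<le> crossing_constant m * (\<bar>y - y'\<bar> + \<bar>g - g'\<bar> + \<bar>h - h'\<bar>)"
    using 1 unfolding Lm D_def .
  show "\<bar>?N y / sqrt (sq_momentum h u y g) - ?N y' / sqrt (sq_momentum h' u y' g')\<bar>
      \<le> crossing_constant m * (\<bar>y - y'\<bar> + \<bar>g - g'\<bar> + \<bar>h - h'\<bar>)"
    using 2 unfolding Lm D_def .
qed

text \<open>Gronwall's inequality, backwards from \<open>c\<close> to \<open>- c\<close>.\<close>
lemma crossing_gronwall:
  assumes m: "1 \<le> m" and c: "0 < c" "c \<le> 1"
    and C1: "crossing_curve m h c1 Y G" and C2: "crossing_curve m h' c2 Y' G'"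
    and le: "c \<le> c1" "c \<le> c2"
  shows "\<bar>Y (- c) - Y' (- c)\<bar> \<le> exp (6 * crossing_constant m) * (\<bar>Y c - Y' c\<bar> + \<bar>G c - G' c\<bar> + \<bar>h - h'\<bar>)"
    "\<bar>G (- c) - G' (- c)\<bar> \<le> exp (6 * crossing_constant m) * (\<bar>Y c - Y' c\<bar> + \<bar>G c - G' c\<bar> + \<bar>h - h'\<bar>)"
proof -
  define L where "L = crossing_constant m"
  have L: "0 \<le> L" unfolding L_def by (rule crossing_constant_nonneg[OF m])
  define E where "E = (\<lambda>u. (Y u - Y' u)\<^sup>2 + (G u - G' u)\<^sup>2 + (h - h')\<^sup>2)"
  define F where "F = (\<lambda>u. E u * exp (6 * L * u))"
  have sub: "{-c..c} \<subseteq> {-c1..c1}" "{-c..c} \<subseteq> {-c2..c2}" using le by auto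
  have "continuous_on {-c..c} Y" "continuous_on {-c..c} G" "continuous_on {-c..c} Y'" "continuous_on {-c..c} G'"
    using C1 C2 sub unfolding crossing_curve_def by (blast intro: continuous_on_subset)+
  then have cont: "continuous_on {-c..c} F" unfolding F_def E_def
    by (intro continuous_intros)
  have deriv: "\<exists>d. (F has_real_derivative d) (at u) \<and> 0 \<le> d" if u: "-c < u" "u < c" "u \<noteq> 0" for u
  proof -
    have u1: "u \<in> {-c1<..<c1} - {0}" "u \<in> {-c2<..<c2} - {0}" using u le by auto
    define a b a' b' where "a = G u / sqrt (sq_momentum h u (Y u) (G u))"
      and "b = crossing_force u (Y u) / sqrt (sq_momentum h u (Y u) (G u))"
      and "a' = G' u / sqrt (sq_momentum h' u (Y' u) (G' u))"
      and "b' = crossing_force u (Y' u) / sqrt (sq_momentum h' u (Y' u) (G' u))"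
    have der: "(Y has_real_derivative a) (at u)" "(G has_real_derivative b) (at u)"
      "(Y' has_real_derivative a') (at u)" "(G' has_real_derivative b') (at u)"
      using C1 C2 u1 unfolding crossing_curve_def a_def b_def a'_def b'_def by blast+
    define D where "D = \<bar>Y u - Y' u\<bar> + \<bar>G u - G' u\<bar> + \<bar>h - h'\<bar>"
    have "u \<in> {-c1..c1}" "u \<in> {-c2..c2}" using u1 by auto
    then have B: "1 / m \<le> \<bar>Y u\<bar>" "1 / m \<le> \<bar>Y' u\<bar>" "\<bar>G u\<bar> \<le> m" "\<bar>G' u\<bar> \<le> m"
      "1 \<le> sq_momentum h u (Y u) (G u)" "1 \<le> sq_momentum h' u (Y' u) (G' u)"
      using C1 C2 u(3) unfolding crossing_curve_def by blast+
    have ab: "\<bar>a - a'\<bar> \<le> L * D" "\<bar>b - b'\<bar> \<le> L * D"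
      unfolding a_def b_def a'_def b'_def D_def L_def
      by (rule crossing_field_lipschitz[OF m u(3) B])+
    have D0: "0 \<le> D" by (simp add: D_def)
    have "((\<lambda>u. (Y u - Y' u)\<^sup>2 + (G u - G' u)\<^sup>2 + (h - h')\<^sup>2) has_real_derivative
        2 * (Y u - Y' u) * (a - a') + 2 * (G u - G' u) * (b - b')) (at u)"
      by (auto intro!: derivative_eq_intros der simp: algebra_simps)
    then have dE: "(E has_real_derivative 2 * (Y u - Y' u) * (a - a') + 2 * (G u - G' u) * (b - b')) (at u)"
      by (simp add: E_def)
    have dF: "(F has_real_derivative
        (2 * (Y u - Y' u) * (a - a') + 2 * (G u - G' u) * (b - b') + 6 * L * E u) * exp (6 * L * u)) (at u)"
      unfolding F_def by (auto intro!: derivative_eq_intros dE simp: algebra_simps)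
    have "\<bar>(Y u - Y' u) * (a - a')\<bar> \<le> \<bar>Y u - Y' u\<bar> * (L * D)"
      "\<bar>(G u - G' u) * (b - b')\<bar> \<le> \<bar>G u - G' u\<bar> * (L * D)"
      unfolding abs_mult using ab by (auto intro: mult_left_mono)
    moreover have "\<bar>Y u - Y' u\<bar> * (L * D) + \<bar>G u - G' u\<bar> * (L * D) \<le> D * (L * D)"
      unfolding distrib_right[symmetric]
      by (rule mult_right_mono) (use L D0 in \<open>auto simp: D_def\<close>)
    moreover have "D * (L * D) \<le> L * (3 * E u)"
    proof -
      have "(x + y + z)\<^sup>2 \<le> 3 * (x\<^sup>2 + y\<^sup>2 + z\<^sup>2)" for x y z :: real
        using zero_le_power2[of "x - y"] zero_le_power2[of "y - z"] zero_le_power2[of "x - z"]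
        by (simp add: power2_eq_square algebra_simps)
      from this[of "\<bar>Y u - Y' u\<bar>" "\<bar>G u - G' u\<bar>" "\<bar>h - h'\<bar>"]
      have "D\<^sup>2 \<le> 3 * E u" by (simp add: D_def E_def)
      then have "L * D\<^sup>2 \<le> L * (3 * E u)" using L by (intro mult_left_mono)
      then show ?thesis by (simp add: power2_eq_square mult_ac)
    qed
    ultimately have "0 \<le> 2 * (Y u - Y' u) * (a - a') + 2 * (G u - G' u) * (b - b') + 6 * L * E u"
      by linarith
    then have "0 \<le> (2 * (Y u - Y' u) * (a - a') + 2 * (G u - G' u) * (b - b') + 6 * L * E u) * exp (6 * L * u)"
      by (intro mult_nonneg_nonneg) auto
    with dF show ?thesis by blast
  qed
  have "F (- c) \<le> F 0"
    by (rule DERIV_nonneg_imp_increasing_open)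
      (use c deriv in \<open>auto intro: continuous_on_subset[OF cont]\<close>)
  also have "F 0 \<le> F c"
    by (rule DERIV_nonneg_imp_increasing_open)
      (use c deriv in \<open>auto intro: continuous_on_subset[OF cont]\<close>)
  finally have "E (- c) * exp (- (6 * L * c)) * exp (6 * L * c) \<le> E c * exp (6 * L * c) * exp (6 * L * c)"
    by (intro mult_right_mono) (auto simp: F_def)
  then have "E (- c) \<le> E c * (exp (6 * L * c) * exp (6 * L * c))"
    by (simp add: mult.assoc flip: exp_add)
  also have "\<dots> \<le> E c * (exp (6 * L) * exp (6 * L))"
    using c L by (intro mult_left_mono mult_mono) (auto simp: E_def mult_left_le)
  also have "E c \<le> (\<bar>Y c - Y' c\<bar> + \<bar>G c - G' c\<bar> + \<bar>h - h'\<bar>)\<^sup>2"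
  proof -
    have "x\<^sup>2 + y\<^sup>2 + z\<^sup>2 \<le> (\<bar>x\<bar> + \<bar>y\<bar> + \<bar>z\<bar>)\<^sup>2" for x y z :: real
    proof -
      have "0 \<le> 2 * (\<bar>x\<bar> * \<bar>y\<bar> + \<bar>y\<bar> * \<bar>z\<bar> + \<bar>x\<bar> * \<bar>z\<bar>)" by simp
      then show ?thesis by (simp add: power2_eq_square algebra_simps)
    qed
    then show ?thesis unfolding E_def .
  qed
  finally have Ebound: "E (- c) \<le> (exp (6 * L) * (\<bar>Y c - Y' c\<bar> + \<bar>G c - G' c\<bar> + \<bar>h - h'\<bar>))\<^sup>2"
    by (simp add: power2_eq_square mult_ac)
  show "\<bar>Y (- c) - Y' (- c)\<bar> \<le> exp (6 * crossing_constant m) * (\<bar>Y c - Y' c\<bar> + \<bar>G c - G' c\<bar> + \<bar>h - h'\<bar>)"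
    "\<bar>G (- c) - G' (- c)\<bar> \<le> exp (6 * crossing_constant m) * (\<bar>Y c - Y' c\<bar> + \<bar>G c - G' c\<bar> + \<bar>h - h'\<bar>)"
    unfolding L_def[symmetric]
    by (rule power2_le_imp_le, rule order_trans[OF _ Ebound], simp add: E_def, simp)+
qed

lemma crossing_curve_speed:
  assumes C: "crossing_curve m h c Y G" and m: "1 \<le> m" and ab: "a \<le> b" "{a..b} \<subseteq> {-c..c}" "0 \<notin> {a..b}"
  shows "\<bar>Y b - Y a\<bar> \<le> 2 * pi * m * (b - a)" "\<bar>G b - G a\<bar> \<le> 2 * pi * m * (b - a)"
proof -
  note C = C[unfolded crossing_curve_def]
  have int: "u \<in> {-c<..<c} - {0}" if "a < u" "u < b" for u
  proof -
    have "a \<in> {-c..c}" "b \<in> {-c..c}" using ab by auto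
    then show ?thesis using that ab by auto
  qed
  have bounds: "\<bar>G u / sqrt (sq_momentum h u (Y u) (G u))\<bar> \<le> 2 * pi * m"
    "\<bar>crossing_force u (Y u) / sqrt (sq_momentum h u (Y u) (G u))\<bar> \<le> 2 * pi * m"
    if u: "a < u" "u < b" for u
  proof -
    have u': "u \<in> {-c..c} - {0}" using int[OF u] by auto
    have W: "1 \<le> sqrt (sq_momentum h u (Y u) (G u))" using C u' by auto
    have quot: "\<bar>r / sqrt (sq_momentum h u (Y u) (G u))\<bar> \<le> \<bar>r\<bar>" for r
    proof -
      have "\<bar>r\<bar> / sqrt (sq_momentum h u (Y u) (G u)) \<le> \<bar>r\<bar> / 1"
        using W by (intro divide_left_mono) auto
      then show ?thesis using W by (simp add: abs_divide)
    qed
    have y: "1 / m \<le> \<bar>Y u\<bar>" and g: "\<bar>G u\<bar> \<le> m" using C u' by auto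
    have "m * 1 \<le> m * (2 * pi)" using m pi_ge_two by (intro mult_left_mono) auto
    then show "\<bar>G u / sqrt (sq_momentum h u (Y u) (G u))\<bar> \<le> 2 * pi * m"
      using quot[of "G u"] g by (simp add: mult.commute)
    have "u \<noteq> 0" using u' by simp
    then show "\<bar>crossing_force u (Y u) / sqrt (sq_momentum h u (Y u) (G u))\<bar> \<le> 2 * pi * m"
      by (rule order_trans[OF quot abs_crossing_force_le[OF m _ y]])
  qed
  have gen: "\<bar>f b - f a\<bar> \<le> 2 * pi * m * (b - a)"
    if "continuous_on {-c..c} f" and f': "\<And>u. a < u \<Longrightarrow> u < b \<Longrightarrow> (f has_real_derivative f' u) (at u) \<and> \<bar>f' u\<bar> \<le> 2 * pi * m"
    for f f' :: "real \<Rightarrow> real"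
  proof (cases "a = b")
    case False
    then have "a < b" using ab by simp
    have "norm (f b - f a) \<le> 2 * pi * m * b - 2 * pi * m * a"
    proof (rule differentiable_bound_general[OF \<open>a < b\<close>])
      show "continuous_on {a..b} f" using that ab by (auto intro: continuous_on_subset)
      show "(f has_vector_derivative f' x) (at x)" "norm (f' x) \<le> 2 * pi * m" if "a < x" "x < b" for x
        using f'[OF that] by (auto simp: has_real_derivative_iff_has_vector_derivative)
      show "((*) (2 * pi * m) has_vector_derivative 2 * pi * m) (at x)" for x
        by (auto intro!: derivative_eq_intros simp: has_real_derivative_iff_has_vector_derivative[symmetric])
    qed (intro continuous_intros)
    then show ?thesis by (simp add: right_diff_distrib)
  qed simp
  show "\<bar>Y b - Y a\<bar> \<le> 2 * pi * m * (b - a)"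
    by (rule gen[where f' = "\<lambda>u. G u / sqrt (sq_momentum h u (Y u) (G u))"])
      (use C int bounds in auto)
  show "\<bar>G b - G a\<bar> \<le> 2 * pi * m * (b - a)"
    by (rule gen[where f' = "\<lambda>u. crossing_force u (Y u) / sqrt (sq_momentum h u (Y u) (G u))"])
      (use C int bounds in blast)+
qed

lemma crossing_start_lipschitz:
  assumes m: "1 \<le> m"
  obtains K where "0 \<le> K" and
    "\<And>h c Y G h' c' Y' G'. crossing_curve m h c Y G \<Longrightarrow> crossing_curve m h' c' Y' G' \<Longrightarrow>
       \<bar>Y (- c) - Y' (- c')\<bar> + \<bar>G (- c) - G' (- c')\<bar>
         \<le> K * (\<bar>c - c'\<bar> + \<bar>Y c - Y' c'\<bar> + \<bar>G c - G' c'\<bar> + \<bar>h - h'\<bar>)"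
proof -
  define V where "V = 2 * pi * m"
  have V: "0 \<le> V" using m by (simp add: V_def)
  define X where "X = exp (6 * crossing_constant m)"
  have X: "0 \<le> X" by (simp add: X_def)
  define K where "K = 2 * X * (1 + 2 * V) + 2 * V"
  have main: "\<bar>Y (- c) - Y' (- c')\<bar> + \<bar>G (- c) - G' (- c')\<bar>
         \<le> K * (\<bar>c - c'\<bar> + \<bar>Y c - Y' c'\<bar> + \<bar>G c - G' c'\<bar> + \<bar>h - h'\<bar>)"
    if C: "crossing_curve m h c Y G" and C': "crossing_curve m h' c' Y' G'" and cc: "c \<le> c'"
    for h c Y G h' c' Y' G'
  proof -
    have c: "0 < c" "c \<le> 1" using C by (auto simp: crossing_curve_def)
    define d where "d = \<bar>c - c'\<bar>"
    define S where "S = d + \<bar>Y c - Y' c'\<bar> + \<bar>G c - G' c'\<bar> + \<bar>h - h'\<bar>"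
    have d: "c' - c = d" "0 \<le> d" "d \<le> S" using cc by (auto simp: d_def S_def)
    have s1: "\<bar>Y' c' - Y' c\<bar> \<le> V * d" "\<bar>G' c' - G' c\<bar> \<le> V * d"
      using crossing_curve_speed[OF C' m cc] c d by (auto simp: V_def)
    have s2: "\<bar>Y' (- c) - Y' (- c')\<bar> \<le> V * d" "\<bar>G' (- c) - G' (- c')\<bar> \<le> V * d"
      using crossing_curve_speed[OF C' m, of "- c'" "- c"] c d cc by (auto simp: V_def)
    define T where "T = \<bar>Y c - Y' c\<bar> + \<bar>G c - G' c\<bar> + \<bar>h - h'\<bar>"
    have "\<bar>Y (- c) - Y' (- c)\<bar> \<le> X * T" "\<bar>G (- c) - G' (- c)\<bar> \<le> X * T"
      unfolding X_def T_def by (rule crossing_gronwall[OF m c C C' order_refl cc])+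
    then have "\<bar>Y (- c) - Y' (- c')\<bar> + \<bar>G (- c) - G' (- c')\<bar> \<le> 2 * (X * T) + 2 * (V * d)"
      using s2 by linarith
    moreover have Vd: "V * d \<le> V * S" using V d by (intro mult_left_mono)
    moreover have "X * T \<le> X * (S + 2 * (V * S))"
    proof (rule mult_left_mono[OF _ X])
      have "T \<le> S + 2 * (V * d)" using s1 d(2) unfolding T_def S_def by linarith
      then show "T \<le> S + 2 * (V * S)" using Vd by linarith
    qed
    ultimately have "\<bar>Y (- c) - Y' (- c')\<bar> + \<bar>G (- c) - G' (- c')\<bar> \<le> 2 * (X * (S + 2 * (V * S))) + 2 * (V * S)"
      by linarith
    then show ?thesis by (simp add: K_def S_def d_def algebra_simps)
  qed
  show ?thesis
  proof (rule that[of K])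
    show "0 \<le> K" using X V by (simp add: K_def)
    fix h c Y G h' c' Y' G'
    assume C: "crossing_curve m h c Y G" "crossing_curve m h' c' Y' G'"
    show "\<bar>Y (- c) - Y' (- c')\<bar> + \<bar>G (- c) - G' (- c')\<bar>
         \<le> K * (\<bar>c - c'\<bar> + \<bar>Y c - Y' c'\<bar> + \<bar>G c - G' c'\<bar> + \<bar>h - h'\<bar>)"
      using main[OF C] main[OF C(2,1)] by (cases "c \<le> c'") (auto simp: abs_minus_commute)
  qed
qed

lemma negligible_lipschitz_relation:
  fixes R :: "'a::euclidean_space \<Rightarrow> 'a \<Rightarrow> bool"
  assumes N: "negligible N"
    and R: "\<And>a b a' b'. R a b \<Longrightarrow> R a' b' \<Longrightarrow> norm (a - a') \<le> K * norm (b - b')"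
  shows "negligible {a. \<exists>b\<in>N. R a b}"
proof -
  define S where "S = {b \<in> N. \<exists>a. R a b}"
  define f where "f = (\<lambda>b. SOME a. R a b)"
  have f: "R (f b) b" if "b \<in> S" for b
    using that unfolding S_def f_def by (auto intro: someI)
  have "negligible (f ` S)"
  proof (rule negligible_locally_Lipschitz_image)
    show "negligible S" using N by (rule negligible_subset) (auto simp: S_def)
    show "\<exists>T B. open T \<and> x \<in> T \<and> (\<forall>y\<in>S \<inter> T. norm (f y - f x) \<le> B * norm (y - x))" if "x \<in> S" for x
      using R[OF f f] that by (intro exI[of _ UNIV] exI[of _ K]) auto
  qed simp
  moreover have "{a. \<exists>b\<in>N. R a b} \<subseteq> f ` S"
  proof clarify
    fix a b assume "b \<in> N" "R a b"
    then have b: "b \<in> S" by (auto simp: S_def)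
    have "norm (a - f b) \<le> K * norm (b - b)" using R[OF \<open>R a b\<close> f[OF b]] .
    then have "a = f b" by simp
    then show "a \<in> f ` S" using b by auto
  qed
  ultimately show ?thesis by (rule negligible_subset)
qed

text \<open>
  In the coordinates \<open>(u, y, g, h)\<close> the state before the collision is a Lipschitz continuous function
  of the state after it.
\<close>
lemma negligible_crossing_start:
  fixes N :: "(real \<times> real \<times> real \<times> real) set"
  assumes N: "negligible N" and m: "1 \<le> m"
  shows "negligible {(- c, Y (- c), G (- c), h) | h c Y G. crossing_curve m h c Y G \<and> (c, Y c, G c, h) \<in> N}"
proof -
  obtain K where K: "0 \<le> K" and
    lip: "\<And>h c Y G h' c' Y' G'. crossing_curve m h c Y G \<Longrightarrow> crossing_curve m h' c' Y' G' \<Longrightarrow>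
       \<bar>Y (- c) - Y' (- c')\<bar> + \<bar>G (- c) - G' (- c')\<bar>
         \<le> K * (\<bar>c - c'\<bar> + \<bar>Y c - Y' c'\<bar> + \<bar>G c - G' c'\<bar> + \<bar>h - h'\<bar>)"
    using crossing_start_lipschitz[OF m] by blast
  define R where "R = (\<lambda>a b. \<exists>h c Y G. crossing_curve m h c Y G \<and>
     a = (- c, Y (- c), G (- c), h) \<and> b = (c, Y c, G c, h))"
  have "negligible {a. \<exists>b\<in>N. R a b}"
  proof (rule negligible_lipschitz_relation[OF N, where K = "2 + 4 * K"])
    fix a b a' b' :: "real \<times> real \<times> real \<times> real"
    assume "R a b" "R a' b'"
    then obtain h c Y G h' c' Y' G' where C: "crossing_curve m h c Y G" "crossing_curve m h' c' Y' G'"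
      and a: "a = (- c, Y (- c), G (- c), h)" "b = (c, Y c, G c, h)"
      and a': "a' = (- c', Y' (- c'), G' (- c'), h')" "b' = (c', Y' c', G' c', h')"
      unfolding R_def by blast
    have tri: "norm (w :: real, x :: real, y :: real, z :: real) \<le> \<bar>w\<bar> + \<bar>x\<bar> + \<bar>y\<bar> + \<bar>z\<bar>" for w x y z
      using norm_Pair_le[of w "(x, y, z)"] norm_Pair_le[of x "(y, z)"] norm_Pair_le[of y z] by simp
    have comp: "\<bar>w\<bar> \<le> norm (w :: real, x :: real, y :: real, z :: real)"
      "\<bar>x\<bar> \<le> norm (w, x, y, z)" "\<bar>y\<bar> \<le> norm (w, x, y, z)" "\<bar>z\<bar> \<le> norm (w, x, y, z)" for w x y z
      using norm_fst_le[of w "(x, y, z)"] norm_snd_le[of "(x, y, z)" w]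
        norm_fst_le[of x "(y, z)"] norm_snd_le[of "(y, z)" x] norm_fst_le[of y z] norm_snd_le[of z y]
      by auto
    define n where "n = norm (b - b')"
    have n: "\<bar>c - c'\<bar> \<le> n" "\<bar>Y c - Y' c'\<bar> \<le> n" "\<bar>G c - G' c'\<bar> \<le> n" "\<bar>h - h'\<bar> \<le> n"
      using comp[where w = "c - c'" and x = "Y c - Y' c'" and y = "G c - G' c'" and z = "h - h'"]
      by (auto simp: n_def a a')
    have "norm (a - a') \<le> \<bar>c - c'\<bar> + (\<bar>Y (- c) - Y' (- c')\<bar> + \<bar>G (- c) - G' (- c')\<bar>) + \<bar>h - h'\<bar>"
      using tri[of "- c + c'" "Y (- c) - Y' (- c')" "G (- c) - G' (- c')" "h - h'"]
      by (simp add: a a')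
    also have "\<dots> \<le> n + K * (n + n + n + n) + n"
      using n K by (intro add_mono order_trans[OF lip[OF C]] mult_left_mono) auto
    finally show "norm (a - a') \<le> (2 + 4 * K) * norm (b - b')" by (simp add: n_def algebra_simps)
  qed
  moreover have "{(- c, Y (- c), G (- c), h) | h c Y G. crossing_curve m h c Y G \<and> (c, Y c, G c, h) \<in> N}
      \<subseteq> {a. \<exists>b\<in>N. R a b}"
    unfolding R_def by blast
  ultimately show ?thesis by (rule negligible_subset)
qed

lemma potential_even: "potential (- u, y) = potential (u, y)"
  by (simp add: potential_def norm_prod_def)

lemma potential_sign: "s \<in> {-1, 1} \<Longrightarrow> potential (s * u, y) = potential (u, y)"
  using potential_even by auto

lemma differentiable_potential:
  "fst q \<noteq> 0 \<Longrightarrow> snd q \<noteq> 0 \<Longrightarrow> potential differentiable (at q)"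
  using GDERIV_potential unfolding gderiv_def differentiable_def by blast

text \<open>
  The state with coordinates \<open>(u, y, g, h)\<close>, and the coordinates of a state. In a passage from
  positive to negative first coordinate \<open>s = 1\<close>, in the opposite one \<open>s = -1\<close>; with the sign
  chosen in this way \<open>u\<close> increases with time.
\<close>
definition crossing_state :: "real \<Rightarrow> real \<times> real \<times> real \<times> real \<Rightarrow> (real \<times> real) \<times> (real \<times> real)" where
  "crossing_state s a =
     ((- s * fst a, fst (snd a)),
      (- s * sqrt (sq_momentum (snd (snd (snd a))) (fst a) (fst (snd a)) (fst (snd (snd a)))),
       fst (snd (snd a))))"

definition crossing_coordinates :: "real \<Rightarrow> (real \<times> real) \<times> (real \<times> real) \<Rightarrow> real \<times> real \<times> real \<times> real" where
  "crossing_coordinates s z =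
     (- s * fst (fst z), snd (fst z), snd (snd z),
      ((fst (snd z))\<^sup>2 + (snd (snd z))\<^sup>2) / (2 * pi) - potential (fst z))"

lemma crossing_coordinates_state:
  assumes s: "s \<in> {-1, 1}" and W: "0 \<le> sq_momentum h u y g"
  shows "crossing_coordinates s (crossing_state s (u, y, g, h)) = (u, y, g, h)"
  using s W potential_sign[of "- s" u y]
  by (auto simp: crossing_coordinates_def crossing_state_def sq_momentum_def power_mult_distrib)

text \<open>The states \<open>z\<close> and \<open>w\<close> lie on one passage, before and after the collision, at opposite values of \<open>u\<close>.\<close>
definition crossing_pair ::
    "real \<Rightarrow> real \<Rightarrow> (real \<times> real) \<times> (real \<times> real) \<Rightarrow> (real \<times> real) \<times> (real \<times> real) \<Rightarrow> bool" where
  "crossing_pair m s z w \<longleftrightarrow> (\<exists>h c Y G. crossing_curve m h c Y G \<and>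
     z = crossing_state s (- c, Y (- c), G (- c), h) \<and> w = crossing_state s (c, Y c, G c, h))"

lemma negligible_crossing_pair:
  assumes N: "negligible N" and m: "1 \<le> m" and s: "s \<in> {-1, 1}"
  shows "negligible {z. \<exists>w\<in>N. crossing_pair m s z w}"
proof -
  define X where "X = {z :: (real \<times> real) \<times> (real \<times> real). fst (fst z) \<noteq> 0 \<and> snd (fst z) \<noteq> 0}"
  define N1 where "N1 = crossing_coordinates s ` (N \<inter> X)"
  have "crossing_coordinates s differentiable_on (N \<inter> X)"
    unfolding differentiable_on_def
  proof
    fix z assume "z \<in> N \<inter> X"
    then have "potential differentiable (at (fst z))" by (auto simp: X_def intro: differentiable_potential)
    moreover have "fst differentiable (at z within N \<inter> X)"
      by (rule bounded_linear_imp_differentiable[OF bounded_linear_fst])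
    ultimately have p: "(\<lambda>z. potential (fst z)) differentiable (at z within N \<inter> X)"
      by (rule differentiable_compose)
    show "crossing_coordinates s differentiable (at z within N \<inter> X)"
      unfolding crossing_coordinates_def[abs_def] power2_eq_square
      by (intro differentiable_Pair differentiable_diff p differentiable_mult differentiable_add
          differentiable_divide differentiable_minus differentiable_const
          bounded_linear_imp_differentiable bounded_linear_intros) auto
  qed
  then have N1: "negligible N1"
    unfolding N1_def using N by (intro negligible_differentiable_image_negligible negligible_Int) auto
  define A where "A = {(- c, Y (- c), G (- c), h) | h c Y G. crossing_curve m h c Y G \<and> (c, Y c, G c, h) \<in> N1}"
  have A: "negligible A" unfolding A_def by (rule negligible_crossing_start[OF N1 m])
  have curve: "1 \<le> sq_momentum h c (Y c) (G c)" "1 \<le> sq_momentum h (- c) (Y (- c)) (G (- c))"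
    "Y c \<noteq> 0" "Y (- c) \<noteq> 0" "c \<noteq> 0" if C: "crossing_curve m h c Y G" for h c Y G
  proof -
    have c: "0 < c" using C by (simp add: crossing_curve_def)
    then have "c \<in> {-c..c} - {0}" "- c \<in> {-c..c} - {0}" by auto
    then have "1 \<le> sq_momentum h c (Y c) (G c)" "1 \<le> sq_momentum h (- c) (Y (- c)) (G (- c))"
      "1 / m \<le> \<bar>Y c\<bar>" "1 / m \<le> \<bar>Y (- c)\<bar>"
      using C unfolding crossing_curve_def by blast+
    moreover have "0 < 1 / m" using m by simp
    ultimately show "1 \<le> sq_momentum h c (Y c) (G c)" "1 \<le> sq_momentum h (- c) (Y (- c)) (G (- c))"
      "Y c \<noteq> 0" "Y (- c) \<noteq> 0" "c \<noteq> 0" using c by auto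
  qed
  have "crossing_state s differentiable_on A"
    unfolding differentiable_on_def
  proof
    fix a assume "a \<in> A"
    then obtain h c Y G where a: "a = (- c, Y (- c), G (- c), h)" and C: "crossing_curve m h c Y G"
      unfolding A_def by blast
    note cu = curve[OF C]
    have "potential differentiable (at (fst a, fst (snd a)))"
      using cu by (intro differentiable_potential) (auto simp: a)
    moreover have "(\<lambda>a. (fst a, fst (snd a))) differentiable (at a within A)"
      by (intro bounded_linear_imp_differentiable bounded_linear_intros)
    ultimately have p: "(\<lambda>a. potential (fst a, fst (snd a))) differentiable (at a within A)"
      by (rule differentiable_compose[of potential "\<lambda>a. (fst a, fst (snd a))"])
    define W where "W = (\<lambda>a :: real \<times> real \<times> real \<times> real. sq_momentum (snd (snd (snd a))) (fst a) (fst (snd a)) (fst (snd (snd a))))"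
    have "W differentiable (at a within A)"
      unfolding W_def sq_momentum_def power2_eq_square
      by (intro differentiable_diff p differentiable_mult differentiable_add differentiable_const
          bounded_linear_imp_differentiable bounded_linear_intros)
    moreover have "sqrt differentiable (at (W a))"
    proof -
      have "0 < W a" using cu by (simp add: W_def a)
      then have "(sqrt has_real_derivative inverse (sqrt (W a)) / 2) (at (W a))" by (rule DERIV_real_sqrt)
      then show ?thesis unfolding has_field_derivative_def differentiable_def by blast
    qed
    ultimately have sq: "(\<lambda>a. sqrt (W a)) differentiable (at a within A)"
      by (intro differentiable_compose[of sqrt W])
    have eq: "crossing_state s = (\<lambda>a. ((- s * fst a, fst (snd a)), (- s * sqrt (W a), fst (snd (snd a)))))"
      by (auto simp: crossing_state_def W_def)
    show "crossing_state s differentiable (at a within A)"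
      unfolding eq
      by (intro differentiable_Pair differentiable_mult differentiable_minus differentiable_const sq
          bounded_linear_imp_differentiable bounded_linear_intros)
  qed
  then have "negligible (crossing_state s ` A)"
    using A by (intro negligible_differentiable_image_negligible) auto
  moreover have "{z. \<exists>w\<in>N. crossing_pair m s z w} \<subseteq> crossing_state s ` A"
  proof clarify
    fix z w assume w: "w \<in> N" and "crossing_pair m s z w"
    then obtain h c Y G where C: "crossing_curve m h c Y G"
      and z: "z = crossing_state s (- c, Y (- c), G (- c), h)" and w': "w = crossing_state s (c, Y c, G c, h)"
      unfolding crossing_pair_def by blast
    note cu = curve[OF C]
    have "w \<in> X" unfolding w' X_def crossing_state_def using cu s by auto
    then have "crossing_coordinates s w \<in> N1" using w by (auto simp: N1_def)
    then have "(c, Y c, G c, h) \<in> N1"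
      unfolding w' using crossing_coordinates_state[OF s, of h c "Y c" "G c"] cu by simp
    then have "(- c, Y (- c), G (- c), h) \<in> A" using C unfolding A_def by blast
    then show "z \<in> crossing_state s ` A" using z by blast
  qed
  ultimately show ?thesis by (rule negligible_subset)
qed

text \<open>
  A solution that passes through a binary collision with \<open>\<bar>fst (p t)\<bar> \<ge> 1\<close> can be parametrized
  by its first coordinate.
\<close>
lemma crossing_pair_of_solution:
  assumes sol: "classical_solution_on h ({a0<..<b0} - {c}) q p"
    and cont: "continuous_on {a0<..<b0} q" and contp: "isCont (\<lambda>t. snd (p t)) c"
    and order: "a0 < a" "a < c" "c < b" "b < b0" and qc: "fst (q c) = 0"
    and bounds: "\<And>t. t \<in> {a..b} \<Longrightarrow> 1 / m \<le> \<bar>snd (q t)\<bar> \<and> \<bar>snd (q t)\<bar> \<le> m \<and> \<bar>snd (p t)\<bar> \<le> m"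
    and fast: "\<And>t. t \<in> {a..b} - {c} \<Longrightarrow> 1 \<le> (fst (p t))\<^sup>2"
    and s: "s \<in> {-1, 1}" and d: "s * fst (q a) = d" "s * fst (q b) = - d" "0 < d" "d \<le> 1"
  shows "crossing_pair m s (q a, p a) (q b, p b)"
proof -
  have op: "open ({a0<..<b0} - {c})" by (intro open_delete open_greaterThanLessThan)
  note D = classical_solution_interior[OF sol _ op subset_refl]
  note S = classical_solutionD[OF sol]
  define v where "v = (\<lambda>t. - s * fst (q t))"
  have vab: "v a = - d" "v b = d" "v c = 0" using d qc by (auto simp: v_def)
  have ss: "s * s = 1" using s by auto
  have vcont: "continuous_on {a..b} v"
    unfolding v_def using order
    by (intro continuous_intros continuous_on_subset[OF cont]) auto
  have v': "(v has_real_derivative - s * (fst (p t) / pi)) (at t)" if "t \<in> {a0<..<b0} - {c}" for t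
    unfolding v_def by (intro DERIV_cmult D(1) that)
  have pc: "isCont p t" if "t \<in> {a0<..<b0} - {c}" for t
    using D(6)[OF that] by (rule has_vector_derivative_continuous)
  have in0: "t \<in> {a0<..<b0} - {c}" if "t \<in> {a..b} - {c}" for t using that order by auto
  \<comment> \<open>the first momentum cannot point away from the collision before it, nor towards it afterwards\<close>
  have side: "1 \<le> - s * fst (p t)" if J: "J = {a..<c} \<or> J = {c<..b}" and t: "t \<in> J" for J t
  proof (rule ccontr)
    assume neg: "\<not> 1 \<le> - s * fst (p t)"
    have J': "J \<subseteq> {a..b} - {c}" using J order by auto
    have abs1: "1 \<le> \<bar>- s * fst (p u)\<bar>" if "u \<in> J" for u
    proof -
      have "1\<^sup>2 \<le> (- s * fst (p u))\<^sup>2"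
        using fast[OF subsetD[OF J' that]] s by auto
      then show ?thesis by (metis abs_le_square_iff abs_one)
    qed
    have "continuous_on J (\<lambda>u. - s * fst (p u))"
      by (intro continuous_intros continuous_at_imp_continuous_on ballI pc in0 subsetD[OF J'])
    moreover have "connected J" using J by auto
    ultimately have sg: "sgn (- s * fst (p u)) = sgn (- s * fst (p t))" if "u \<in> J" for u
      using abs1 t that by (intro sgn_constant[of J]) force+
    have le: "- s * fst (p u) \<le> 0" if "u \<in> J" for u
      using sg[OF that] abs1[OF t] neg by (auto simp: sgn_if split: if_splits)
    have dec: "\<exists>y. (v has_real_derivative y) (at u) \<and> y \<le> 0" if "u \<in> J" for u
    proof -
      have "- s * fst (p u) / pi \<le> 0" using le[OF that] by (intro divide_nonpos_pos) auto
      then show ?thesis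
        using v'[OF in0[OF subsetD[OF J' that]]] by (intro exI[of _ "- s * (fst (p u) / pi)"]) auto
    qed
    from J show False
    proof
      assume J: "J = {a..<c}"
      have "v c \<le> v a"
        by (rule DERIV_nonpos_imp_decreasing_open)
          (use J order dec in \<open>auto intro: continuous_on_subset[OF vcont]\<close>)
      then show False using vab d by simp
    next
      assume J: "J = {c<..b}"
      have "v b \<le> v c"
        by (rule DERIV_nonpos_imp_decreasing_open)
          (use J order dec in \<open>auto intro: continuous_on_subset[OF vcont]\<close>)
      then show False using vab d by simp
    qed
  qed
  have pos: "1 \<le> - s * fst (p t)" if "t \<in> {a..b} - {c}" for t
  proof (cases "t < c")
    case True
    then show ?thesis using that by (intro side[of "{a..<c}"]) auto
  next
    case False
    then show ?thesis using that by (intro side[of "{c<..b}"]) auto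
  qed
  have inc: "v t < v u" if "a \<le> t" "t < u" "u \<le> b" "c \<le> t \<or> u \<le> c" for t u
  proof (rule DERIV_pos_imp_increasing_open[OF that(2)])
    fix w assume w: "t < w" "w < u"
    then have w': "w \<in> {a..b} - {c}" using that by auto
    have "0 < - s * fst (p w) / pi" using pos[OF w'] by (intro divide_pos_pos) auto
    then show "\<exists>y. (v has_real_derivative y) (at w) \<and> 0 < y"
      using v'[OF in0[OF w']] by (intro exI[of _ "- s * (fst (p w) / pi)"]) auto
  qed (use that in \<open>auto intro: continuous_on_subset[OF vcont]\<close>)
  have mono: "v t < v u" if "a \<le> t" "t < u" "u \<le> b" for t u
  proof (cases "c \<le> t \<or> u \<le> c")
    case False
    then have "v t < v c" "v c < v u" using inc[of t c] inc[of c u] that order by auto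
    then show ?thesis by simp
  qed (use inc that in blast)
  have inj: "inj_on v {a..b}"
  proof (rule inj_onI)
    fix t u assume "t \<in> {a..b}" "u \<in> {a..b}" "v t = v u"
    then show "t = u" using mono[of t u] mono[of u t] by (cases t u rule: linorder_cases) auto
  qed
  have im: "v ` {a..b} = {-d..d}"
  proof
    show "v ` {a..b} \<subseteq> {-d..d}"
    proof clarify
      fix t assume t: "t \<in> {a..b}"
      have "v a \<le> v t" using mono[of a t] t by (cases "a = t") auto
      moreover have "v t \<le> v b" using mono[of t b] t by (cases "t = b") auto
      ultimately show "v t \<in> {-d..d}" using vab by simp
    qed
    show "{-d..d} \<subseteq> v ` {a..b}"
    proof
      fix y assume "y \<in> {-d..d}"
      then have "\<exists>t\<ge>a. t \<le> b \<and> v t = y" using vab order by (intro IVT') (auto intro: vcont)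
      then show "y \<in> v ` {a..b}" by auto
    qed
  qed
  define \<theta> where "\<theta> = the_inv_into {a..b} v"
  have \<theta>cont: "continuous_on {-d..d} \<theta>"
    unfolding \<theta>_def im[symmetric] by (rule continuous_on_inv_into[OF vcont compact_Icc inj])
  have v\<theta>: "v (\<theta> y) = y" and \<theta>in: "\<theta> y \<in> {a..b}" if "y \<in> {-d..d}" for y
    using that f_the_inv_into_f[OF inj, of y] the_inv_into_into[OF inj, of y "{a..b}"]
    unfolding im \<theta>_def by auto
  have \<theta>v: "\<theta> (v t) = t" if "t \<in> {a..b}" for t
    unfolding \<theta>_def using that by (rule the_inv_into_f_f[OF inj])
  have \<theta>ends: "\<theta> (- d) = a" "\<theta> d = b" "\<theta> 0 = c"
    using \<theta>v[of a] \<theta>v[of b] \<theta>v[of c] vab order by auto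
  have \<theta>c: "\<theta> y \<noteq> c" if "y \<in> {-d..d}" "y \<noteq> 0" for y using v\<theta>[OF that(1)] that vab by auto
  define Y where "Y = (\<lambda>y. snd (q (\<theta> y)))"
  define G where "G = (\<lambda>y. snd (p (\<theta> y)))"
  have W: "sq_momentum h y (Y y) (G y) = (fst (p (\<theta> y)))\<^sup>2" if y: "y \<in> {-d..d}" "y \<noteq> 0" for y
  proof -
    have t: "\<theta> y \<in> {a0<..<b0} - {c}" using \<theta>in[OF y(1)] \<theta>c[OF y] in0 by auto
    have "y = - s * fst (q (\<theta> y))" using v\<theta>[OF y(1)] by (simp add: v_def)
    then have "potential (y, Y y) = potential (q (\<theta> y))"
      using potential_sign[of "- s" "fst (q (\<theta> y))" "Y y"] s by (auto simp: Y_def)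
    moreover have "(norm (p (\<theta> y)))\<^sup>2 = (fst (p (\<theta> y)))\<^sup>2 + (G y)\<^sup>2"
      by (simp add: norm_prod_def G_def)
    ultimately show ?thesis using S(5)[OF t] by (simp add: sq_momentum_def)
  qed
  have sqrtW: "sqrt (sq_momentum h y (Y y) (G y)) = - s * fst (p (\<theta> y))" if y: "y \<in> {-d..d}" "y \<noteq> 0" for y
  proof -
    have "1 \<le> - s * fst (p (\<theta> y))" using pos \<theta>in[OF y(1)] \<theta>c[OF y] by auto
    moreover have "(fst (p (\<theta> y)))\<^sup>2 = (- s * fst (p (\<theta> y)))\<^sup>2" using ss by (simp add: power2_eq_square)
    ultimately show ?thesis unfolding W[OF y] by simp
  qed
  have sndp: "continuous_on {a..b} (\<lambda>t. snd (p t))"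
  proof (intro continuous_at_imp_continuous_on ballI)
    fix t assume "t \<in> {a..b}"
    then show "isCont (\<lambda>t. snd (p t)) t"
      using contp pc[of t] in0[of t] by (cases "t = c") auto
  qed
  have \<theta>im: "\<theta> ` {-d..d} \<subseteq> {a..b}" using \<theta>in by auto
  have "crossing_curve m h d Y G"
    unfolding crossing_curve_def
  proof (intro conjI ballI)
    show "0 < d" "d \<le> 1" using d by auto
    show "continuous_on {- d..d} Y"
      unfolding Y_def using order \<theta>im
      by (intro continuous_on_snd continuous_on_compose2[OF cont \<theta>cont]) auto
    show "continuous_on {- d..d} G"
      unfolding G_def by (rule continuous_on_compose2[OF sndp \<theta>cont \<theta>im])
    show "1 / m \<le> \<bar>Y y\<bar>" "\<bar>Y y\<bar> \<le> m" "\<bar>G y\<bar> \<le> m" if "y \<in> {-d..d}" for y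
      using bounds[OF \<theta>in[OF that]] by (auto simp: Y_def G_def)
    show "1 \<le> sq_momentum h y (Y y) (G y)" if "y \<in> {-d..d} - {0}" for y
      using that W[of y] fast[of "\<theta> y"] \<theta>in[of y] \<theta>c[of y] by auto
    fix y assume y: "y \<in> {-d<..<d} - {0}"
    then have yd: "y \<in> {-d..d}" "y \<noteq> 0" by auto
    define t where "t = \<theta> y"
    have t: "t \<in> {a0<..<b0} - {c}" using \<theta>in[OF yd(1)] \<theta>c[OF yd] in0 by (auto simp: t_def)
    have p1: "1 \<le> - s * fst (p t)" using pos \<theta>in[OF yd(1)] \<theta>c[OF yd] by (auto simp: t_def)
    have "isCont \<theta> y"
      using continuous_on_interior[OF \<theta>cont, of y] y by simp
    then have "(\<theta> has_real_derivative inverse (- s * (fst (p t) / pi))) (at y)"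
      by (intro DERIV_inverse_function[where f = v and a = "- d" and b = d])
        (use v'[OF t] p1 y v\<theta> in \<open>auto simp: t_def\<close>)
    moreover have "inverse (- s * (fst (p t) / pi)) = pi / sqrt (sq_momentum h y (Y y) (G y))"
      unfolding sqrtW[OF yd] t_def by (simp add: field_simps)
    ultimately have \<theta>': "(\<theta> has_real_derivative pi / sqrt (sq_momentum h y (Y y) (G y))) (at y)" by simp
    have "((\<lambda>y. snd (q (\<theta> y))) has_real_derivative
        snd (p t) / pi * (pi / sqrt (sq_momentum h y (Y y) (G y)))) (at y)"
      using DERIV_chain2[OF D(2)[OF t, unfolded t_def] \<theta>'] by (simp add: t_def)
    then show "(Y has_real_derivative G y / sqrt (sq_momentum h y (Y y) (G y))) (at y)"
      by (simp add: Y_def[abs_def] G_def t_def)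
    have nrm: "norm (y, Y y) = norm (q t)"
    proof -
      have "y = - s * fst (q t)" using v\<theta>[OF yd(1)] by (simp add: v_def t_def)
      then have "y\<^sup>2 = (fst (q t))\<^sup>2" using ss by (simp add: power2_eq_square)
      then show ?thesis by (simp add: norm_prod_def Y_def t_def)
    qed
    have dG: "(G has_real_derivative
        - (Y y / (norm (y, Y y))\<^sup>2 + 1 / Y y) * (pi / sqrt (sq_momentum h y (Y y) (G y)))) (at y)"
      using DERIV_chain2[OF D(4)[OF t, unfolded t_def] \<theta>'] unfolding nrm
      by (simp add: G_def[abs_def] Y_def t_def)
    show "(G has_real_derivative crossing_force y (Y y) / sqrt (sq_momentum h y (Y y) (G y))) (at y)"
      unfolding crossing_force_def
      by (rule DERIV_cong[OF dG]) (simp only: mult_minus_left mult_minus_right times_divide_eq_right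
          minus_divide_left mult.commute[of pi])
  qed
  moreover have "(q a, p a) = crossing_state s (- d, Y (- d), G (- d), h)"
  proof -
    have "fst (q a) = s * d" using ss by (simp add: d(1)[symmetric] flip: mult.assoc)
    moreover have "fst (p a) = - s * sqrt (sq_momentum h (- d) (Y (- d)) (G (- d)))"
      using sqrtW[of "- d"] d ss by (simp add: \<theta>ends flip: mult.assoc)
    ultimately show ?thesis by (simp add: crossing_state_def Y_def G_def \<theta>ends prod_eq_iff)
  qed
  moreover have "(q b, p b) = crossing_state s (d, Y d, G d, h)"
  proof -
    have "s * (s * fst (q b)) = s * - d" by (simp only: d(2))
    then have "fst (q b) = - s * d" using ss by (simp flip: mult.assoc)
    moreover have "fst (p b) = - s * sqrt (sq_momentum h d (Y d) (G d))"
      using sqrtW[of d] d ss by (simp add: \<theta>ends flip: mult.assoc)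
    ultimately show ?thesis by (simp add: crossing_state_def Y_def G_def \<theta>ends prod_eq_iff)
  qed
  ultimately show ?thesis unfolding crossing_pair_def by blast
qed

text \<open>
  Every instant shortly before a binary collision is matched, by the intermediate value theorem,
  with an instant after it at which the vanishing coordinate has the opposite value.
\<close>
lemma crossing_near_collision:
  assumes sol: "classical_solution_on h ({a0<..<b0} - {c}) q p"
    and cont: "continuous_on {a0<..<b0} q" and order: "a0 < c" "c < b0"
    and tr: "transmits_at (fst \<circ> q) (snd \<circ> q) (snd \<circ> p) c"
  obtains m :: nat and s a1 where "1 \<le> m" "s \<in> {-1, 1}" "a0 < a1" "a1 < c"
    "\<And>a. a1 < a \<Longrightarrow> a < c \<Longrightarrow> \<exists>b. c < b \<and> b < b0 \<and> crossing_pair (real m) s (q a, p a) (q b, p b)"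
proof -
  have op: "open ({a0<..<b0} - {c})" by (intro open_delete open_greaterThanLessThan)
  note D = classical_solution_interior[OF sol _ op subset_refl]
  note S = classical_solutionD[OF sol]
  have qc: "fst (q c) = 0" "snd (q c) \<noteq> 0" and contp: "isCont (\<lambda>t. snd (p t)) c"
    using tr by (auto simp: transmits_at_def comp_def)
  obtain s where s: "s \<in> {-1, 1}" and left: "\<forall>\<^sub>F u in at_left c. sgn (fst (q u)) = s"
    and right: "\<forall>\<^sub>F u in at_right c. sgn (fst (q u)) = - s"
    using tr unfolding transmits_at_def comp_def by blast
  obtain a2 where a2: "a2 < c" "\<And>u. a2 < u \<Longrightarrow> u < c \<Longrightarrow> sgn (fst (q u)) = s"
    using left by (auto simp: eventually_at_left_field)
  obtain b2 where b2: "c < b2" "\<And>u. c < u \<Longrightarrow> u < b2 \<Longrightarrow> sgn (fst (q u)) = - s"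
    using right by (auto simp: eventually_at_right_field)
  obtain a4 where a4: "max a2 a0 < a4" "a4 < c" using dense[of "max a2 a0" c] a2 order by auto
  obtain b4 where b4: "c < b4" "b4 < min b2 b0" using dense[of c "min b2 b0"] b2 order by auto
  have pc: "isCont (\<lambda>t. snd (p t)) t" if "t \<in> {a0<..<b0}" for t
  proof (cases "t = c")
    case False
    then have "isCont p t" using D(6)[of t] that by (auto intro: has_vector_derivative_continuous)
    then show ?thesis by simp
  qed (use contp in simp)
  have c4: "continuous_on {a4..b4} q" "continuous_on {a4..b4} (\<lambda>t. snd (p t))"
  proof -
    have sub: "{a4..b4} \<subseteq> {a0<..<b0}" using a4 b4 by auto
    show "continuous_on {a4..b4} q" by (rule continuous_on_subset[OF cont sub])
    show "continuous_on {a4..b4} (\<lambda>t. snd (p t))"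
      using sub by (intro continuous_at_imp_continuous_on ballI pc) auto
  qed
  have snz: "snd (q t) \<noteq> 0" if "t \<in> {a4..b4}" for t
    using S(2)[of t] qc that a4 b4 by (cases "t = c") auto
  have "compact ((\<lambda>t. (1 / snd (q t), snd (q t), snd (p t))) ` {a4..b4})"
    using snz by (intro compact_continuous_image continuous_intros c4) auto
  then obtain K0 where K0: "\<And>t. t \<in> {a4..b4} \<Longrightarrow> norm (1 / snd (q t), snd (q t), snd (p t)) \<le> K0"
    using compact_imp_bounded by (metis (no_types, lifting) bounded_iff imageI)
  obtain m :: nat where m: "max (max 1 \<bar>h\<bar>) K0 \<le> real m" using real_arch_simple by blast
  have m1: "1 \<le> real m" "\<bar>h\<bar> \<le> real m" using m by auto
  have bounds: "1 / real m \<le> \<bar>snd (q t)\<bar>" "\<bar>snd (q t)\<bar> \<le> real m" "\<bar>snd (p t)\<bar> \<le> real m"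
    if t: "t \<in> {a4..b4}" for t
  proof -
    have "norm (1 / snd (q t)) \<le> K0" "norm (snd (q t), snd (p t)) \<le> K0"
      using K0[OF t] norm_fst_le norm_snd_le order_trans by blast+
    then have "\<bar>1 / snd (q t)\<bar> \<le> real m" "\<bar>snd (q t)\<bar> \<le> real m" "\<bar>snd (p t)\<bar> \<le> real m"
      using abs_fst_le_norm[of "(snd (q t), snd (p t))"] abs_snd_le_norm[of "(snd (q t), snd (p t))"] m
      by auto
    then show "1 / real m \<le> \<bar>snd (q t)\<bar>" "\<bar>snd (q t)\<bar> \<le> real m" "\<bar>snd (p t)\<bar> \<le> real m"
      using m1 snz[OF t] by (auto simp: divide_simps mult.commute)
  qed
  \<comment> \<open>closer than \<open>exp (- R)\<close> to the axis the first momentum is at least 1 in absolute value\<close>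
  define R where "R = real m + ln 8 + ln (1 + real m) + ln (real m) + (real m)\<^sup>2 + 1"
  have R0: "0 \<le> R" using m1 by (auto simp: R_def intro!: add_nonneg_nonneg)
  have fast: "1 \<le> (fst (p t))\<^sup>2"
    if t: "t \<in> {a4..b4} - {c}" and x: "\<bar>fst (q t)\<bar> < exp (- R)" for t
  proof -
    have t': "t \<in> {a0<..<b0} - {c}" using t a4 b4 by auto
    have nz: "fst (q t) \<noteq> 0" "snd (q t) \<noteq> 0" using S(1,2)[OF t'] by auto
    have lnabs: "ln \<bar>w\<bar> = ln w" for w :: real by (auto simp: abs_if ln_minus)
    have l1: "ln (fst (q t)) \<le> - R"
    proof -
      have "ln \<bar>fst (q t)\<bar> \<le> ln (exp (- R))" using x nz by (intro ln_mono) auto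
      then show ?thesis by (simp add: lnabs)
    qed
    have l2: "ln (snd (q t)) \<le> ln (real m)"
    proof -
      have "ln \<bar>snd (q t)\<bar> \<le> ln (real m)" using bounds[of t] t nz m1 by (intro ln_mono) auto
      then show ?thesis by (simp add: lnabs)
    qed
    have l3: "ln (norm (q t)) \<le> ln (1 + real m)"
    proof (rule ln_mono)
      have "norm (q t) \<le> \<bar>fst (q t)\<bar> + \<bar>snd (q t)\<bar>"
        using norm_Pair_le[of "fst (q t)" "snd (q t)"] by simp
      moreover have "exp (- R) \<le> 1" using R0 by simp
      moreover have "\<bar>snd (q t)\<bar> \<le> real m" using bounds(2)[of t] t by auto
      ultimately show "norm (q t) \<le> 1 + real m" using x by linarith
      show "0 < norm (q t)" using nz by auto
    qed
    have "h + potential (q t) \<ge> (real m)\<^sup>2 + 1"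
      using l1 l2 l3 m1 unfolding potential_eq_sum_ln[OF nz] R_def by linarith
    then have "1 * ((real m)\<^sup>2 + 1) \<le> (2 * pi) * (h + potential (q t))"
      using pi_ge_two by (intro mult_mono) auto
    moreover have "(snd (p t))\<^sup>2 \<le> (real m)\<^sup>2"
      using bounds(3)[of t] t by (intro abs_le_square_iff[THEN iffD1]) auto
    moreover have "(norm (p t))\<^sup>2 = (fst (p t))\<^sup>2 + (snd (p t))\<^sup>2" by (simp add: norm_prod_def)
    ultimately show ?thesis using S(5)[OF t'] by simp
  qed
  have "isCont (\<lambda>t. fst (q t)) c"
  proof -
    have "isCont q c" using cont order by (intro continuous_on_interior[OF cont]) auto
    then show ?thesis by simp
  qed
  then have xlim: "((\<lambda>t. \<bar>fst (q t)\<bar>) \<longlongrightarrow> 0) (at c)"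
    using qc by (simp add: isCont_def tendsto_rabs_zero)
  have "\<forall>\<^sub>F t in at c. \<bar>fst (q t)\<bar> < exp (- R)"
    using order_tendstoD(2)[OF xlim, of "exp (- R)"] by simp
  then obtain e where e: "0 < e" "\<And>t. t \<noteq> c \<Longrightarrow> \<bar>t - c\<bar> < e \<Longrightarrow> \<bar>fst (q t)\<bar> < exp (- R)"
    by (auto simp: eventually_at dist_real_def)
  obtain b5 where b5: "c < b5" "b5 < min b4 (c + e)" using dense[of c "min b4 (c + e)"] b4 e by auto
  have xb5: "0 < \<bar>fst (q b5)\<bar>" using S(1)[of b5] b5 b4 a4 by auto
  have "\<forall>\<^sub>F t in at c. \<bar>fst (q t)\<bar> < \<bar>fst (q b5)\<bar>"
    by (rule order_tendstoD(2)[OF xlim xb5])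
  then obtain e' where e': "0 < e'" "\<And>t. t \<noteq> c \<Longrightarrow> \<bar>t - c\<bar> < e' \<Longrightarrow> \<bar>fst (q t)\<bar> < \<bar>fst (q b5)\<bar>"
    by (auto simp: eventually_at dist_real_def)
  define a1 where "a1 = max a4 (max (c - e) (c - e'))"
  show ?thesis
  proof (rule that[of m s a1])
    show "1 \<le> m" using m1 by simp
    show "s \<in> {-1, 1}" by fact
    show "a0 < a1" "a1 < c" using a4 e e' by (auto simp: a1_def)
    fix a assume a: "a1 < a" "a < c"
    define d where "d = s * fst (q a)"
    have sa: "sgn (fst (q a)) = s" using a2(2)[of a] a a4 by (auto simp: a1_def)
    have xa: "\<bar>fst (q a)\<bar> < exp (- R)" "\<bar>fst (q a)\<bar> < \<bar>fst (q b5)\<bar>"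
      using e(2)[of a] e'(2)[of a] a by (auto simp: a1_def)
    have d_abs: "d = \<bar>fst (q a)\<bar>" unfolding d_def sa[symmetric] by (simp add: abs_sgn mult.commute)
    have d: "0 < d" "d \<le> 1"
    proof -
      have "fst (q a) \<noteq> 0" using sa s by auto
      then show "0 < d" by (simp add: d_abs)
      have "exp (- R) \<le> 1" using R0 by simp
      then show "d \<le> 1" using xa d_abs by linarith
    qed
    have sb5: "- s * fst (q b5) = \<bar>fst (q b5)\<bar>"
      using b2(2)[of b5] b5 b4 by (metis abs_sgn min_less_iff_conj mult.commute order_less_trans)
    have "\<exists>b\<ge>c. b \<le> b5 \<and> - s * fst (q b) = d"
    proof (rule IVT')
      show "- s * fst (q c) \<le> d" using qc d by simp
      show "d \<le> - s * fst (q b5)" using sb5 xa d_abs by simp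
      show "c \<le> b5" using b5 by simp
      show "continuous_on {c..b5} (\<lambda>b. - s * fst (q b))"
        using b5 a4 b4 by (intro continuous_intros continuous_on_subset[OF cont]) auto
    qed
    then obtain b where b: "c \<le> b" "b \<le> b5" "- s * fst (q b) = d" by blast
    have "b \<noteq> c" using b qc d by auto
    then have cb: "c < b" using b by simp
    have sub: "{a..b} \<subseteq> {a4..b4}" using a b b5 by (auto simp: a1_def)
    have close: "\<bar>t - c\<bar> < e" if "t \<in> {a..b}" for t
    proof -
      have "c - e < t" "t < c + e" using that a b b5 by (auto simp: a1_def)
      then show ?thesis by linarith
    qed
    have "crossing_pair (real m) s (q a, p a) (q b, p b)"
    proof (rule crossing_pair_of_solution[OF sol cont contp])
      show "a0 < a" "a < c" "c < b" "b < b0" using a cb b b5 b4 a4 by (auto simp: a1_def)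
      show "fst (q c) = 0" by (rule qc)
      show "1 / real m \<le> \<bar>snd (q t)\<bar> \<and> \<bar>snd (q t)\<bar> \<le> real m \<and> \<bar>snd (p t)\<bar> \<le> real m" if "t \<in> {a..b}" for t
        using bounds sub that by blast
      show "1 \<le> (fst (p t))\<^sup>2" if "t \<in> {a..b} - {c}" for t
        using fast[of t] e(2)[of t] close[of t] sub that by auto
      show "s \<in> {-1, 1}" by fact
      show "s * fst (q a) = d" "s * fst (q b) = - d" using b by (auto simp: d_def)
    qed (use d in auto)
    then show "\<exists>b. c < b \<and> b < b0 \<and> crossing_pair (real m) s (q a, p a) (q b, p b)"
      using cb b b5 b4 by auto
  qed
qed

section \<open>Orbits with finitely many binary collisions\<close>

lemma classical_solution_swap:
  assumes "classical_solution_on h I q p"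
  shows "classical_solution_on h I (\<lambda>t. prod.swap (q t)) (\<lambda>t. prod.swap (p t))"
proof (rule classical_solutionI)
  fix t assume t: "t \<in> I"
  note D = classical_solutionD[OF assms t]
  have bl: "bounded_linear (prod.swap :: real \<times> real \<Rightarrow> _)"
    unfolding prod.swap_def by (intro bounded_linear_intros)
  have n: "norm (prod.swap v) = norm v" for v :: "real \<times> real"
    by (simp add: norm_prod_def add.commute)
  have sc: "prod.swap (a *\<^sub>R v) = a *\<^sub>R prod.swap v" for a and v :: "real \<times> real"
    by (simp add: prod_eq_iff)
  have f: "force (prod.swap v) = prod.swap (force v)" for v
    by (simp add: force_def n prod_eq_iff)
  have pot: "potential (prod.swap v) = potential v" for v
    by (simp add: potential_def n mult.commute)
  show "fst (prod.swap (q t)) \<noteq> 0 \<and> snd (prod.swap (q t)) \<noteq> 0"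
    "(norm (prod.swap (p t)))\<^sup>2 = 2 * pi * (h + potential (prod.swap (q t)))"
    using D by (auto simp: n pot)
  show "((\<lambda>t. prod.swap (q t)) has_vector_derivative (1 / pi) *\<^sub>R prod.swap (p t)) (at t within I)"
    using bounded_linear.has_vector_derivative[OF bl D(3)] by (simp add: sc)
  show "((\<lambda>t. prod.swap (p t)) has_vector_derivative force (prod.swap (q t))) (at t within I)"
    using bounded_linear.has_vector_derivative[OF bl D(4)] by (simp add: f)
qed

lemma potential_scaleR:
  assumes "0 < l" "fst q \<noteq> 0" "snd q \<noteq> 0"
  shows "potential (l *\<^sub>R q) = potential q - 3 * ln l"
proof -
  have "q \<noteq> 0" using assms by auto
  then show ?thesis using assms by (simp add: potential_eq_sum_ln ln_mult)
qed

text \<open>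
  Time translations and the scaling symmetry: because the potential is logarithmic, multiplying
  positions and times by \<open>l\<close> maps solutions to solutions, with the same momenta, and shifts
  the energy by \<open>3 * ln l\<close>.
\<close>
lemma classical_solution_affine:
  assumes sol: "classical_solution_on h I q p" and l: "0 < l" and J: "\<And>t. t \<in> J \<Longrightarrow> t / l + b \<in> I"
  shows "classical_solution_on (h + 3 * ln l) J (\<lambda>t. l *\<^sub>R q (t / l + b)) (\<lambda>t. p (t / l + b))"
proof (rule classical_solutionI)
  fix t assume t: "t \<in> J"
  note D = classical_solutionD[OF sol J[OF t]]
  have im: "(\<lambda>t. t / l + b) ` J \<subseteq> I" using J by auto
  have aff: "((\<lambda>t. t / l + b) has_vector_derivative 1 / l) (at t within J)"
    unfolding has_real_derivative_iff_has_vector_derivative[symmetric]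
    using l by (auto intro!: derivative_eq_intros)
  have f: "force (l *\<^sub>R v) = (1 / l) *\<^sub>R force v" for v
    using l by (simp add: force_def prod_eq_iff power_mult_distrib power2_eq_square divide_inverse algebra_simps)
  show "fst (l *\<^sub>R q (t / l + b)) \<noteq> 0 \<and> snd (l *\<^sub>R q (t / l + b)) \<noteq> 0"
    using D l by auto
  show "(norm (p (t / l + b)))\<^sup>2 = 2 * pi * (h + 3 * ln l + potential (l *\<^sub>R q (t / l + b)))"
    using D(5) potential_scaleR[OF l D(1,2)] by simp
  have eq: "l *\<^sub>R ((1 / l) *\<^sub>R v) = v" for v :: "real \<times> real" using l by simp
  have "((\<lambda>t. q (t / l + b)) has_vector_derivative (1 / l) *\<^sub>R (1 / pi) *\<^sub>R p (t / l + b)) (at t within J)"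
    using vector_diff_chain_within[OF aff has_vector_derivative_within_subset[OF D(3) im]]
    by (simp add: comp_def)
  from bounded_linear.has_vector_derivative[OF bounded_linear_scaleR_right this, of l]
  show "((\<lambda>t. l *\<^sub>R q (t / l + b)) has_vector_derivative (1 / pi) *\<^sub>R p (t / l + b)) (at t within J)"
    unfolding eq .
  show "((\<lambda>t. p (t / l + b)) has_vector_derivative force (l *\<^sub>R q (t / l + b))) (at t within J)"
    using vector_diff_chain_within[OF aff has_vector_derivative_within_subset[OF D(4) im]]
    by (simp add: comp_def f)
qed

lemma eventually_at_left_affine:
  fixes t l b :: real
  assumes l: "0 < l" and P: "eventually P (at_left (t / l + b))"
  shows "\<forall>\<^sub>F s in at_left t. P (s / l + b)"
proof -
  obtain a where a: "a < t / l + b" "\<And>u. a < u \<Longrightarrow> u < t / l + b \<Longrightarrow> P u"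
    using P by (auto simp: eventually_at_left_field)
  show ?thesis unfolding eventually_at_left_field
  proof (intro exI conjI allI impI)
    show "l * (a - b) < t" using a(1) l by (simp add: field_simps)
    show "P (s / l + b)" if "l * (a - b) < s" "s < t" for s
      using that l by (intro a(2)) (auto simp: field_simps)
  qed
qed

lemma eventually_at_right_affine:
  fixes t l b :: real
  assumes l: "0 < l" and P: "eventually P (at_right (t / l + b))"
  shows "\<forall>\<^sub>F s in at_right t. P (s / l + b)"
proof -
  obtain a where a: "t / l + b < a" "\<And>u. t / l + b < u \<Longrightarrow> u < a \<Longrightarrow> P u"
    using P by (auto simp: eventually_at_right_field)
  show ?thesis unfolding eventually_at_right_field
  proof (intro exI conjI allI impI)
    show "t < l * (a - b)" using a(1) l by (simp add: field_simps)
    show "P (s / l + b)" if "t < s" "s < l * (a - b)" for s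
      using that l by (intro a(2)) (auto simp: field_simps)
  qed
qed

lemma transmits_at_affine:
  assumes l: "0 < l" and tr: "transmits_at x y g (t / l + b)"
  shows "transmits_at (\<lambda>s. l * x (s / l + b)) (\<lambda>s. l * y (s / l + b)) (\<lambda>s. g (s / l + b)) t"
proof -
  have sg: "sgn (l * v) = sgn v" for v :: real using l by (simp add: sgn_mult)
  have c: "isCont (\<lambda>s. s / l + b) t" using l by (intro continuous_intros) auto
  obtain e where e: "e \<in> {-1, 1}" "\<forall>\<^sub>F u in at_left (t / l + b). sgn (x u) = e"
    "\<forall>\<^sub>F u in at_right (t / l + b). sgn (x u) = - e"
    using tr unfolding transmits_at_def by blast
  have "\<forall>\<^sub>F u in at_left t. sgn (l * x (u / l + b)) = e" "\<forall>\<^sub>F u in at_right t. sgn (l * x (u / l + b)) = - e"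
    unfolding sg using eventually_at_left_affine[OF l e(2)] eventually_at_right_affine[OF l e(3)] by auto
  moreover have "isCont (\<lambda>s. l * y (s / l + b)) t" "isCont (\<lambda>s. g (s / l + b)) t"
    using tr isCont_o2[OF c, of y] isCont_o2[OF c, of g] by (auto simp: transmits_at_def)
  ultimately show ?thesis
    using tr e(1) l unfolding transmits_at_def by auto
qed

lemma time_domain_ereal: "time_domain (ereal \<tau>) = {0..<\<tau>}"
  by (auto simp: time_domain_def)

lemma generalized_solution_affine:
  assumes sol: "generalized_solution h (ereal \<tau>) C q p" and l: "0 < l" and b: "0 \<le> b" "b < \<tau>" "b \<notin> C"
  shows "generalized_solution (h + 3 * ln l) (ereal (l * (\<tau> - b))) ((\<lambda>t. l * (t - b)) ` (C \<inter> {b<..}))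
     (\<lambda>t. l *\<^sub>R q (t / l + b)) (\<lambda>t. p (t / l + b))"
proof -
  note S = sol[unfolded generalized_solution_def time_domain_ereal]
  define C' where "C' = (\<lambda>t. l * (t - b)) ` (C \<inter> {b<..})"
  have C': "t \<in> C' \<longleftrightarrow> t / l + b \<in> C \<and> 0 < t" for t
  proof
    assume "t \<in> C'"
    then show "t / l + b \<in> C \<and> 0 < t" using l by (auto simp: C'_def)
  next
    assume "t / l + b \<in> C \<and> 0 < t"
    then show "t \<in> C'" using l unfolding C'_def
      by (intro image_eqI[of _ _ "t / l + b"]) auto
  qed
  have dom: "t / l + b \<in> {0..<\<tau>}" if "t \<in> {0..<l * (\<tau> - b)}" for t
    using that l b by (auto simp: field_simps intro: add_nonneg_nonneg)
  show ?thesis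
    unfolding generalized_solution_def time_domain_ereal C'_def[symmetric]
  proof (intro conjI ballI)
    show "0 < ereal (l * (\<tau> - b))" using l b by simp
    show "continuous_on {0..<l * (\<tau> - b)} (\<lambda>t. l *\<^sub>R q (t / l + b))"
    proof -
      have "continuous_on {0..<\<tau>} q" using S by auto
      moreover have "continuous_on {0..<l * (\<tau> - b)} (\<lambda>t. t / l + b)"
        using l by (intro continuous_intros) auto
      moreover have "(\<lambda>t. t / l + b) ` {0..<l * (\<tau> - b)} \<subseteq> {0..<\<tau>}" using dom by blast
      ultimately have "continuous_on {0..<l * (\<tau> - b)} (\<lambda>t. q (t / l + b))"
        by (rule continuous_on_compose2)
      then show ?thesis by (intro continuous_on_scaleR continuous_on_const)
    qed
    show "finite C'" using S by (auto simp: C'_def)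
    show "C' \<subseteq> {0..<l * (\<tau> - b)} - {0}"
    proof
      fix t assume "t \<in> C'"
      then have t: "t / l + b \<in> C" "0 < t" using C' by auto
      then have "t / l + b < \<tau>" using S by auto
      then show "t \<in> {0..<l * (\<tau> - b)} - {0}" using t l by (auto simp: field_simps)
    qed
    show "classical_solution_on (h + 3 * ln l) ({0..<l * (\<tau> - b)} - C')
        (\<lambda>t. l *\<^sub>R q (t / l + b)) (\<lambda>t. p (t / l + b))"
    proof (rule classical_solution_affine[OF _ l])
      show "classical_solution_on h ({0..<\<tau>} - C) q p" using S by auto
      show "t / l + b \<in> {0..<\<tau>} - C" if "t \<in> {0..<l * (\<tau> - b)} - C'" for t
        using dom[of t] that b C'[of t] by (cases "t = 0") auto
    qed
    fix t assume "t \<in> C'"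
    then have "binary_collision_at q p (t / l + b)" using C' S by auto
    then show "binary_collision_at (\<lambda>t. l *\<^sub>R q (t / l + b)) (\<lambda>t. p (t / l + b)) t"
      unfolding binary_collision_at_def
      using transmits_at_affine[OF l, of "fst \<circ> q" "snd \<circ> q" "snd \<circ> p" t b]
        transmits_at_affine[OF l, of "snd \<circ> q" "fst \<circ> q" "fst \<circ> p" t b]
      by (auto simp: comp_def)
  qed
qed

text \<open>At time \<open>\<tau>\<close> the orbit collapses totally, or comes to rest off the axes.\<close>
definition singular_end :: "real \<Rightarrow> (real \<Rightarrow> real \<times> real) \<Rightarrow> (real \<Rightarrow> real \<times> real) \<Rightarrow> bool" where
  "singular_end \<tau> q p \<longleftrightarrow> (q \<longlongrightarrow> 0) (at_left \<tau>) \<or>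
     (p \<longlongrightarrow> 0) (at_left \<tau>) \<and>
     (\<exists>e>0. \<exists>R. \<forall>\<^sub>F t in at_left \<tau>. e \<le> \<bar>fst (q t)\<bar> \<and> e \<le> \<bar>snd (q t)\<bar> \<and> norm (q t) \<le> R)"

lemma singular_end_affine:
  assumes se: "singular_end \<tau> q p" and l: "0 < l"
  shows "singular_end (l * (\<tau> - b)) (\<lambda>t. l *\<^sub>R q (t / l + b)) (\<lambda>t. p (t / l + b))"
proof -
  have eq: "l * (\<tau> - b) / l + b = \<tau>" using l by simp
  have ev: "\<forall>\<^sub>F s in at_left (l * (\<tau> - b)). P (s / l + b)" if "eventually P (at_left \<tau>)" for P
    using eventually_at_left_affine[OF l, of P "l * (\<tau> - b)" b] that unfolding eq .
  have lim: "((\<lambda>s. f (s / l + b)) \<longlongrightarrow> 0) (at_left (l * (\<tau> - b)))" if "(f \<longlongrightarrow> 0) (at_left \<tau>)" for f :: "real \<Rightarrow> real \<times> real"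
    using that ev unfolding tendsto_def by blast
  from se show ?thesis
    unfolding singular_end_def
  proof (elim disjE conjE exE)
    assume "(q \<longlongrightarrow> 0) (at_left \<tau>)"
    then have "((\<lambda>s. l *\<^sub>R q (s / l + b)) \<longlongrightarrow> l *\<^sub>R 0) (at_left (l * (\<tau> - b)))"
      by (intro tendsto_intros lim)
    then show "((\<lambda>t. l *\<^sub>R q (t / l + b)) \<longlongrightarrow> 0) (at_left (l * (\<tau> - b))) \<or>
      ((\<lambda>t. p (t / l + b)) \<longlongrightarrow> 0) (at_left (l * (\<tau> - b))) \<and>
      (\<exists>e>0. \<exists>R. \<forall>\<^sub>F t in at_left (l * (\<tau> - b)). e \<le> \<bar>fst (l *\<^sub>R q (t / l + b))\<bar> \<and>
        e \<le> \<bar>snd (l *\<^sub>R q (t / l + b))\<bar> \<and> norm (l *\<^sub>R q (t / l + b)) \<le> R)" by simp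
  next
    fix e R
    assume p: "(p \<longlongrightarrow> 0) (at_left \<tau>)" and e: "0 < e"
      and R: "\<forall>\<^sub>F t in at_left \<tau>. e \<le> \<bar>fst (q t)\<bar> \<and> e \<le> \<bar>snd (q t)\<bar> \<and> norm (q t) \<le> R"
    have "\<forall>\<^sub>F t in at_left (l * (\<tau> - b)). l * e \<le> \<bar>fst (l *\<^sub>R q (t / l + b))\<bar> \<and>
        l * e \<le> \<bar>snd (l *\<^sub>R q (t / l + b))\<bar> \<and> norm (l *\<^sub>R q (t / l + b)) \<le> l * R"
      using ev[OF R] by eventually_elim (use l in \<open>auto simp: abs_mult\<close>)
    moreover have "0 < l * e" using l e by simp
    ultimately show "((\<lambda>t. l *\<^sub>R q (t / l + b)) \<longlongrightarrow> 0) (at_left (l * (\<tau> - b))) \<or>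
      ((\<lambda>t. p (t / l + b)) \<longlongrightarrow> 0) (at_left (l * (\<tau> - b))) \<and>
      (\<exists>e>0. \<exists>R. \<forall>\<^sub>F t in at_left (l * (\<tau> - b)). e \<le> \<bar>fst (l *\<^sub>R q (t / l + b))\<bar> \<and>
        e \<le> \<bar>snd (l *\<^sub>R q (t / l + b))\<bar> \<and> norm (l *\<^sub>R q (t / l + b)) \<le> R)"
      using lim[OF p] by blast
  qed
qed

text \<open>
  The states, of whatever energy, from which a generalized solution reaches a singular end after
  exactly \<open>j\<close> binary collisions.
\<close>
definition singular_states :: "nat \<Rightarrow> ((real \<times> real) \<times> (real \<times> real)) set" where
  "singular_states j = {z. \<exists>h \<tau> C q p. generalized_solution h (ereal \<tau>) C q p \<and> card C = j \<and>
     z = (q 0, p 0) \<and> singular_end \<tau> q p}"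

lemma singular_states_scale:
  assumes "z \<in> singular_states j" and l: "0 < l"
  shows "(l *\<^sub>R fst z, snd z) \<in> singular_states j"
proof -
  obtain h \<tau> C q p where sol: "generalized_solution h (ereal \<tau>) C q p" and j: "card C = j"
    and z: "z = (q 0, p 0)" and se: "singular_end \<tau> q p"
    using assms unfolding singular_states_def by blast
  have C: "C \<subseteq> {0..<\<tau>} - {0}" and \<tau>: "0 < \<tau>"
    using sol unfolding generalized_solution_def time_domain_ereal by auto
  have C0: "C \<inter> {0<..} = C" "0 \<notin> C" using C by auto
  have "card ((\<lambda>t. l * (t - 0)) ` C) = j"
    using l j by (subst card_image) (auto intro: inj_onI)
  moreover have "generalized_solution (h + 3 * ln l) (ereal (l * (\<tau> - 0))) ((\<lambda>t. l * (t - 0)) ` C)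
     (\<lambda>t. l *\<^sub>R q (t / l + 0)) (\<lambda>t. p (t / l + 0))"
    using generalized_solution_affine[OF sol l order_refl \<tau> C0(2)] unfolding C0(1) .
  moreover have "singular_end (l * (\<tau> - 0)) (\<lambda>t. l *\<^sub>R q (t / l + 0)) (\<lambda>t. p (t / l + 0))"
    by (rule singular_end_affine[OF se l])
  moreover have "(l *\<^sub>R fst z, snd z) = (l *\<^sub>R q (0 / l + 0), p (0 / l + 0))" by (simp add: z)
  ultimately show ?thesis unfolding singular_states_def by blast
qed

text \<open>
  Induction on the number of collisions. A rational time just before the first collision is used,
  because only countably many times can be allowed in \<open>negligible_flows_to\<close>.
\<close>
lemma negligible_singular_states: "negligible (singular_states j)"
proof (induction j)
  case 0
  have "singular_states 0 \<subseteq> collapse_states \<union> rest_states"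
  proof
    fix z assume "z \<in> singular_states 0"
    then obtain h \<tau> C q p where sol: "generalized_solution h (ereal \<tau>) C q p" and C: "card C = 0"
      and z: "z = (q 0, p 0)" and se: "singular_end \<tau> q p"
      unfolding singular_states_def by blast
    have "C = {}" using sol C by (auto simp: generalized_solution_def)
    then have "0 < \<tau>" "classical_solution_on h {0..<\<tau>} q p"
      using sol unfolding generalized_solution_def time_domain_ereal by auto
    then show "z \<in> collapse_states \<union> rest_states"
      using z se unfolding singular_end_def collapse_states_def rest_states_def by blast
  qed
  then show ?case
    using negligible_collapse_states negligible_rest_states by (blast intro: negligible_subset negligible_Un)
next
  case (Suc j)
  define sw :: "(real \<times> real) \<times> (real \<times> real) \<Rightarrow> (real \<times> real) \<times> (real \<times> real)"
    where "sw = (\<lambda>z. (prod.swap (fst z), prod.swap (snd z)))"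
  have sw2: "sw (sw z) = z" for z by (simp add: sw_def)
  have swneg: "negligible (sw ` N)" if "negligible N" for N
    unfolding sw_def prod.swap_def using that
    by (intro negligible_differentiable_image_negligible)
      (auto intro!: linear_imp_differentiable_on linearI)
  define M1 where "M1 = (\<lambda>m s. {z. \<exists>w\<in>singular_states j. crossing_pair (real (Suc m)) s z w})"
  define M2 where "M2 = (\<lambda>m s. {z. \<exists>w\<in>sw ` singular_states j. crossing_pair (real (Suc m)) s z w})"
  define M where "M = (\<Union>m. M1 m 1 \<union> M1 m (-1) \<union> sw ` M2 m 1 \<union> sw ` M2 m (-1))"
  have "negligible (M1 m 1 \<union> M1 m (-1) \<union> sw ` M2 m 1 \<union> sw ` M2 m (-1))" for m
    unfolding M1_def M2_def
    using negligible_crossing_pair[OF Suc.IH, of "real (Suc m)"]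
      negligible_crossing_pair[OF swneg[OF Suc.IH], of "real (Suc m)"]
    by (intro negligible_Un swneg) auto
  then have M: "negligible M" unfolding M_def by (rule negligible_Union_nat)
  have "negligible (\<Union>r\<in>\<rat>. {z. \<exists>w\<in>M. flows_to r z w})"
    by (rule negligible_countable_Union) (auto intro: negligible_flows_to[OF M] countable_rat)
  moreover have "singular_states (Suc j) \<subseteq> (\<Union>r\<in>\<rat>. {z. \<exists>w\<in>M. flows_to r z w})"
  proof
    fix z assume "z \<in> singular_states (Suc j)"
    then obtain h \<tau> C q p where sol: "generalized_solution h (ereal \<tau>) C q p" and cj: "card C = Suc j"
      and z: "z = (q 0, p 0)" and se: "singular_end \<tau> q p"
      unfolding singular_states_def by blast
    note S = sol[unfolded generalized_solution_def time_domain_ereal]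
    have fin: "finite C" and CS: "C \<subseteq> {0..<\<tau>} - {0}" and ne: "C \<noteq> {}" using S cj by auto
    define c where "c = Min C"
    have c: "c \<in> C" "\<And>d. d \<in> C \<Longrightarrow> c \<le> d" using fin ne by (auto simp: c_def)
    have c0: "0 < c" "c < \<tau>" using c(1) CS by auto
    define b0 where "b0 = Min (insert \<tau> (C - {c}))"
    have b0: "b0 \<le> \<tau>" "\<And>d. d \<in> C \<Longrightarrow> d \<noteq> c \<Longrightarrow> b0 \<le> d" using fin by (auto simp: b0_def)
    have cb0: "c < b0"
      unfolding b0_def using fin c c0 by (subst Min_gr_iff) (auto simp: order.strict_iff_order)
    have classical: "classical_solution_on h ({0..<\<tau>} - C) q p" using S by auto
    have near: "classical_solution_on h ({0<..<b0} - {c}) q p"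
      by (rule classical_solution_subset[OF classical]) (use b0 in force)
    have cont: "continuous_on {0<..<b0} q"
      using S b0 by (auto intro: continuous_on_subset)
    have after: "(q b, p b) \<in> singular_states j" if b: "c < b" "b < b0" for b
    proof -
      have bC: "b \<notin> C" using b b0 by force
      have "C \<inter> {b<..} = C - {c}" using b b0 by force
      then have card: "card ((\<lambda>t. 1 * (t - b)) ` (C \<inter> {b<..})) = j"
        using cj fin c(1) by (subst card_image) (auto intro: inj_onI)
      have "generalized_solution (h + 3 * ln 1) (ereal (1 * (\<tau> - b))) ((\<lambda>t. 1 * (t - b)) ` (C \<inter> {b<..}))
         (\<lambda>t. 1 *\<^sub>R q (t / 1 + b)) (\<lambda>t. p (t / 1 + b))"
        using b b0 c0 by (intro generalized_solution_affine[OF sol _ _ _ bC]) auto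
      moreover have "singular_end (1 * (\<tau> - b)) (\<lambda>t. 1 *\<^sub>R q (t / 1 + b)) (\<lambda>t. p (t / 1 + b))"
        by (rule singular_end_affine[OF se]) simp
      moreover have "(q b, p b) = (1 *\<^sub>R q (0 / 1 + b), p (0 / 1 + b))" by simp
      ultimately show ?thesis unfolding singular_states_def using card by blast
    qed
    have "\<exists>a1. 0 < a1 \<and> a1 < c \<and> (\<forall>a. a1 < a \<and> a < c \<longrightarrow> (q a, p a) \<in> M)"
    proof -
      have "binary_collision_at q p c" using S c by auto
      then show ?thesis
        unfolding binary_collision_at_def
      proof
        assume tr: "transmits_at (fst \<circ> q) (snd \<circ> q) (snd \<circ> p) c"
        obtain m :: nat and s a1 where m: "1 \<le> m" "s \<in> {-1, 1}" and a1: "0 < a1" "a1 < c"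
          and cr: "\<And>a. a1 < a \<Longrightarrow> a < c \<Longrightarrow> \<exists>b. c < b \<and> b < b0 \<and> crossing_pair (real m) s (q a, p a) (q b, p b)"
          using crossing_near_collision[OF near cont c0(1) cb0 tr] by blast
        have "(q a, p a) \<in> M" if a: "a1 < a" "a < c" for a
        proof -
          obtain b where "c < b" "b < b0" "crossing_pair (real (Suc (m - 1))) s (q a, p a) (q b, p b)"
            using cr[OF a] m by auto
          then have "(q a, p a) \<in> M1 (m - 1) s" using after unfolding M1_def by blast
          then show ?thesis using m(2) unfolding M_def by auto
        qed
        then show ?thesis using a1 by blast
      next
        assume tr: "transmits_at (snd \<circ> q) (fst \<circ> q) (fst \<circ> p) c"
        let ?q = "\<lambda>t. prod.swap (q t)" and ?p = "\<lambda>t. prod.swap (p t)"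
        have tr': "transmits_at (fst \<circ> ?q) (snd \<circ> ?q) (snd \<circ> ?p) c"
          using tr by (simp add: comp_def)
        have cont': "continuous_on {0<..<b0} ?q"
          unfolding prod.swap_def by (intro continuous_intros cont)
        obtain m :: nat and s a1 where m: "1 \<le> m" "s \<in> {-1, 1}" and a1: "0 < a1" "a1 < c"
          and cr: "\<And>a. a1 < a \<Longrightarrow> a < c \<Longrightarrow> \<exists>b. c < b \<and> b < b0 \<and> crossing_pair (real m) s (?q a, ?p a) (?q b, ?p b)"
          using crossing_near_collision[OF classical_solution_swap[OF near] cont' c0(1) cb0 tr'] by blast
        have "(q a, p a) \<in> M" if a: "a1 < a" "a < c" for a
        proof -
          obtain b where b: "c < b" "b < b0" "crossing_pair (real (Suc (m - 1))) s (?q a, ?p a) (?q b, ?p b)"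
            using cr[OF a] m by auto
          have "(?q b, ?p b) = sw (q b, p b)" by (simp add: sw_def)
          then have "(?q a, ?p a) \<in> M2 (m - 1) s" using b after unfolding M2_def by blast
          moreover have "(q a, p a) = sw (?q a, ?p a)" by (simp add: sw_def)
          ultimately have "(q a, p a) \<in> sw ` M2 (m - 1) s" by blast
          then show ?thesis using m(2) unfolding M_def by auto
        qed
        then show ?thesis using a1 by blast
      qed
    qed
    then obtain a1 where a1: "0 < a1" "a1 < c" "\<And>a. a1 < a \<Longrightarrow> a < c \<Longrightarrow> (q a, p a) \<in> M" by blast
    obtain r where r: "r \<in> \<rat>" "a1 < r" "r < c" using Rats_dense_in_real[OF a1(2)] by blast
    have "{0..r} \<subseteq> {0..<\<tau>} - C" using r c c0 by force
    then have "flows_to r z (q r, p r)"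
      unfolding z using r a1 by (intro flows_toI[OF classical]) auto
    then show "z \<in> (\<Union>r\<in>\<rat>. {z. \<exists>w\<in>M. flows_to r z w})" using r a1(3) by blast
  qed
  ultimately show ?case by (rule negligible_subset)
qed

section \<open>The last arc\<close>

lemma norm_position:
  assumes "0 < r"
  shows "norm (position r \<alpha>) = r * exp (- 1 / r\<^sup>2)"
proof -
  have "position r \<alpha> = (r * exp (- 1 / r\<^sup>2)) *\<^sub>R (cos \<alpha>, sin \<alpha>)" by (simp add: position_def)
  then have "norm (position r \<alpha>) = \<bar>r * exp (- 1 / r\<^sup>2)\<bar> * norm (cos \<alpha>, sin \<alpha>)"
    by (simp only: norm_scaleR real_norm_def)
  then show ?thesis using assms by (simp add: norm_prod_def)
qed

lemma potential_position:
  assumes r: "0 < r" and \<alpha>: "0 < \<alpha>" "\<alpha> < pi / 2"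
  shows "potential (position r \<alpha>) = 3 / r\<^sup>2 - 3 * ln r - ln (4 * sin (2 * \<alpha>))"
proof -
  have cs: "0 < cos \<alpha>" "0 < sin \<alpha>" using \<alpha> by (auto intro: cos_gt_zero_pi sin_gt_zero)
  have "ln (4 * sin (2 * \<alpha>)) = ln 8 + ln (cos \<alpha>) + ln (sin \<alpha>)"
  proof -
    have "4 * sin (2 * \<alpha>) = 8 * (cos \<alpha> * sin \<alpha>)" by (simp add: sin_double)
    then show ?thesis using cs by (simp add: ln_mult)
  qed
  moreover have "potential (position r \<alpha>) = - (ln 8 + ln (r * exp (- 1 / r\<^sup>2))
      + ln (r * exp (- 1 / r\<^sup>2) * cos \<alpha>) + ln (r * exp (- 1 / r\<^sup>2) * sin \<alpha>))"
  proof -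
    have fs: "fst (position r \<alpha>) = r * exp (- 1 / r\<^sup>2) * cos \<alpha>" "snd (position r \<alpha>) = r * exp (- 1 / r\<^sup>2) * sin \<alpha>"
      by (simp_all add: position_def)
    then have "fst (position r \<alpha>) \<noteq> 0" "snd (position r \<alpha>) \<noteq> 0" using r cs by auto
    from potential_eq_sum_ln[OF this] show ?thesis by (simp only: fs norm_position[OF r])
  qed
  moreover have "ln (r * exp (- 1 / r\<^sup>2)) = ln r - 1 / r\<^sup>2" using r by (simp add: ln_mult)
  ultimately show ?thesis using r cs by (simp add: ln_mult)
qed

lemma E_hat_eq:
  assumes r: "0 < r" and \<alpha>: "0 < \<alpha>" "\<alpha> < pi / 2"
  shows "E_hat h r \<alpha> = 2 * r\<^sup>2 * (h + potential (position r \<alpha>))"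
  using r by (simp add: E_hat_def potential_position[OF assms] field_simps)

lemma norm_momentum:
  assumes "0 < r" "0 \<le> E_hat h r \<alpha>"
  shows "(norm (momentum h r \<alpha> \<psi>))\<^sup>2 = pi * E_hat h r \<alpha> / r\<^sup>2"
proof -
  have "momentum h r \<alpha> \<psi> = (sqrt (pi * E_hat h r \<alpha>) / r) *\<^sub>R (cos \<psi>, sin \<psi>)"
    by (simp add: momentum_def)
  then have "norm (momentum h r \<alpha> \<psi>) = \<bar>sqrt (pi * E_hat h r \<alpha>) / r\<bar> * norm (cos \<psi>, sin \<psi>)"
    by (simp only: norm_scaleR real_norm_def)
  then show ?thesis using assms by (simp add: norm_prod_def power_divide)
qed

lemma norm_reflect: "norm (reflect v) = norm v"
  by (simp add: reflect_def norm_prod_def)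

lemma potential_reflect: "potential (reflect v) = potential v"
  by (simp add: potential_def norm_reflect) (simp add: reflect_def abs_mult)

text \<open>
  An axis attracts its coordinate with a force that is bounded below as long as the coordinate is
  bounded. So the original time stays bounded on an arc that collapses or comes to rest.
\<close>
lemma no_bounded_eternal_arc:
  assumes sol: "classical_solution_on h {a<..} q p" and R: "\<And>t. a < t \<Longrightarrow> \<bar>fst (q t)\<bar> \<le> R"
  shows False
proof -
  note D = classical_solution_interior[OF sol _ open_greaterThan subset_refl]
  have nz: "fst (q t) \<noteq> 0" if "a < t" for t using classical_solutionD(1)[OF sol, of t] that by auto
  define b where "b = a + 1"
  define s where "s = sgn (fst (q b))"
  have s2: "s * s = 1" using nz[of b] by (auto simp: s_def b_def sgn_if)
  have cont: "continuous_on {a<..} (\<lambda>t. fst (q t))"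
    using D(1) DERIV_isCont by (intro continuous_at_imp_continuous_on) blast
  have f: "s * fst (q t) = \<bar>fst (q t)\<bar>" if "a < t" for t
  proof -
    have "s = sgn (fst (q t))" unfolding s_def
      using that nz by (intro sgn_constant[OF cont]) (auto simp: b_def)
    then show ?thesis by (simp add: abs_sgn mult.commute)
  qed
  have R0: "0 < R" using R[of b] nz[of b] by (auto simp: b_def)
  have force: "s * - (fst (q t) / (norm (q t))\<^sup>2 + 1 / fst (q t)) \<le> - (1 / R)" if t: "a < t" for t
  proof -
    have "s / fst (q t) = 1 / \<bar>fst (q t)\<bar>"
    proof -
      have "s \<noteq> 0" using s2 by auto
      then have "s / fst (q t) = (s * s) / (s * fst (q t))" by simp
      then show ?thesis unfolding s2 f[OF t] .
    qed
    moreover have "1 / R \<le> 1 / \<bar>fst (q t)\<bar>" using R[OF t] nz[OF t] by (intro divide_left_mono mult_pos_pos R0) auto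
    moreover have "0 \<le> s * fst (q t) / (norm (q t))\<^sup>2" unfolding f[OF t] by simp
    ultimately show ?thesis by (simp add: right_diff_distrib)
  qed
  have g: "s * fst (p t) \<le> s * fst (p b) - (t - b) / R" if "b \<le> t" for t
  proof -
    have "s * fst (p t) + t * (1 / R) \<le> s * fst (p b) + b * (1 / R)"
    proof (rule DERIV_nonpos_imp_nonincreasing[OF that])
      fix u assume "b \<le> u" "u \<le> t"
      then have u: "a < u" by (simp add: b_def)
      have "((\<lambda>u. s * fst (p u) + u * (1 / R)) has_real_derivative
          s * - (fst (q u) / (norm (q u))\<^sup>2 + 1 / fst (q u)) + 1 * (1 / R)) (at u)"
        by (intro DERIV_add DERIV_cmult D(3) DERIV_cmult_right DERIV_ident) (use u in auto)
      then show "\<exists>y. ((\<lambda>u. s * fst (p u) + u * (1 / R)) has_real_derivative y) (at u) \<and> y \<le> 0"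
        using force[OF u] by (intro exI conjI) auto
    qed
    then show ?thesis by (simp add: diff_divide_distrib)
  qed
  define c where "c = b + R * (1 + \<bar>s * fst (p b)\<bar>)"
  have c: "b \<le> c" using R0 by (simp add: c_def)
  have g1: "s * fst (p t) \<le> - 1" if "c \<le> t" for t
  proof -
    have "R * (1 + \<bar>s * fst (p b)\<bar>) / R \<le> (t - b) / R"
      using that R0 by (intro divide_right_mono) (auto simp: c_def)
    then have "1 + \<bar>s * fst (p b)\<bar> \<le> (t - b) / R" using R0 by simp
    then show ?thesis using g[of t] that c by linarith
  qed
  define t where "t = c + pi * R"
  have ct: "c \<le> t" using R0 by (simp add: t_def)
  have "s * fst (q t) + t * (1 / pi) \<le> s * fst (q c) + c * (1 / pi)"
  proof (rule DERIV_nonpos_imp_nonincreasing[OF ct])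
    fix u assume u: "c \<le> u" "u \<le> t"
    then have u': "a < u" using c by (simp add: b_def)
    have "((\<lambda>u. s * fst (q u) + u * (1 / pi)) has_real_derivative s * (fst (p u) / pi) + 1 * (1 / pi)) (at u)"
      by (intro DERIV_add DERIV_cmult D(1) DERIV_cmult_right DERIV_ident) (use u' in auto)
    moreover have "s * (fst (p u) / pi) + 1 * (1 / pi) = (s * fst (p u) + 1) / pi"
      by (simp add: add_divide_distrib)
    moreover have "(s * fst (p u) + 1) / pi \<le> 0" using g1[OF u(1)] by (intro divide_nonpos_pos) auto
    ultimately show "\<exists>y. ((\<lambda>u. s * fst (q u) + u * (1 / pi)) has_real_derivative y) (at u) \<and> y \<le> 0"
      by auto
  qed
  then have "s * fst (q t) \<le> s * fst (q c) - R" by (simp add: t_def add_divide_distrib)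
  moreover have "a < c" "a < t" using c ct by (auto simp: b_def)
  moreover have "s * fst (q c) \<le> R" unfolding f[OF \<open>a < c\<close>] by (rule R[OF \<open>a < c\<close>])
  ultimately have "\<bar>fst (q t)\<bar> \<le> 0" using f[of t] by linarith
  then show False using nz[OF \<open>a < t\<close>] by simp
qed

text \<open>
  As rescaled time tends to infinity, the original time either increases to a limit that it does not
  attain, and then what holds eventually in rescaled time holds eventually in original time; or it
  is eventually constant, which is possible because it stands still at zero velocity.
\<close>
lemma rescaled_time_cases:
  assumes sol: "generalized_solution h T C q p" and arc: "rescaled_last_arc h T C q \<sigma> r \<alpha>"
    and R: "\<forall>\<^sub>F \<zeta> in at_top. norm (q (\<sigma> \<zeta>)) \<le> R"
  obtains
    (limit) \<tau> where "0 < \<tau>" "generalized_solution h (ereal \<tau>) C q p"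
      "\<And>P. \<forall>\<^sub>F \<zeta> in at_top. P (\<sigma> \<zeta>) \<Longrightarrow> \<forall>\<^sub>F t in at_left \<tau>. P t"
  | (stop) \<tau> where "\<tau> \<in> last_arc T C" "\<forall>\<^sub>F \<zeta> in at_top. \<sigma> \<zeta> = \<tau>"
proof -
  note A = arc[unfolded rescaled_last_arc_def, rule_format]
  note S = sol[unfolded generalized_solution_def]
  have sub: "last_arc T C \<subseteq> time_domain T - C" by (auto simp: last_arc_def)
  have energy: "0 \<le> E_hat h (r \<zeta>) (\<alpha> \<zeta>)" if "0 \<le> \<zeta>" for \<zeta>
  proof -
    have t: "\<sigma> \<zeta> \<in> time_domain T - C" using A[OF that] sub by auto
    have "(norm (p (\<sigma> \<zeta>)))\<^sup>2 = 2 * pi * (h + potential (q (\<sigma> \<zeta>)))"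
      using S t by (intro classical_solutionD(5)[of h "time_domain T - C"]) auto
    then have "0 \<le> 2 * pi * (h + potential (q (\<sigma> \<zeta>)))" by (metis zero_le_power2)
    then have "0 \<le> h + potential (reflect (q (\<sigma> \<zeta>)))"
      unfolding potential_reflect
      using mult_pos_neg[of "2 * pi" "h + potential (q (\<sigma> \<zeta>))"] by (intro leI notI) auto
    then show ?thesis
      using A[OF that] by (simp add: E_hat_eq)
  qed
  have cont: "continuous_on {0..} \<sigma>"
    using A has_field_derivative_imp_has_derivative[THEN has_derivative_continuous]
    by (fastforce simp: continuous_on_eq_continuous_within intro: DERIV_continuous)
  have mono: "\<sigma> a \<le> \<sigma> b" if "0 \<le> a" "a \<le> b" for a b
  proof (rule DERIV_nonneg_imp_increasing_open[OF that(2)])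
    fix \<zeta> assume "a < \<zeta>" "\<zeta> < b"
    then have z: "0 < \<zeta>" using that by simp
    have "at \<zeta> within {0..} = at \<zeta>" by (rule at_within_open_subset[of _ "{0<..}"]) (use z in auto)
    then show "\<exists>y. (\<sigma> has_real_derivative y) (at \<zeta>) \<and> 0 \<le> y"
      using A[of \<zeta>] energy[of \<zeta>] z
      by (intro exI[of _ "(r \<zeta>)\<^sup>2 * exp (- 1 / (r \<zeta>)\<^sup>2) * sqrt (E_hat h (r \<zeta>) (\<alpha> \<zeta>))"]) auto
  qed (use that in \<open>auto intro: continuous_on_subset[OF cont]\<close>)
  have hit: "\<exists>\<zeta>\<ge>z. \<sigma> \<zeta> = t" if z: "0 \<le> z" "\<sigma> z \<le> t" "t \<le> \<sigma> w" "0 \<le> w" for z w t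
  proof (cases "z \<le> w")
    case True
    have "\<exists>\<zeta>\<ge>z. \<zeta> \<le> w \<and> \<sigma> \<zeta> = t"
      using that True by (intro IVT') (auto intro: continuous_on_subset[OF cont])
    then show ?thesis by blast
  next
    case False
    then have "\<sigma> w \<le> \<sigma> z" using that by (intro mono) auto
    then show ?thesis using that by (intro exI[of _ z]) auto
  qed
  have dom: "0 \<le> \<sigma> \<zeta>" "ereal (\<sigma> \<zeta>) < T" "\<And>c. c \<in> C \<Longrightarrow> c < \<sigma> \<zeta>" if "0 \<le> \<zeta>" for \<zeta>
    using A[OF that] by (auto simp: last_arc_def time_domain_def)
  show ?thesis
  proof (cases "\<exists>M. \<forall>\<zeta>\<ge>0. \<sigma> \<zeta> \<le> M")
    case False
    then have unb: "\<exists>\<zeta>\<ge>0. M < \<sigma> \<zeta>" for M by (metis not_le)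
    have T: "ereal t < T" for t using unb[of t] dom(2) by (meson ereal_less_eq(3) less_imp_le order_le_less_trans)
    obtain z0 where z0: "\<And>\<zeta>. z0 \<le> \<zeta> \<Longrightarrow> norm (q (\<sigma> \<zeta>)) \<le> R"
      using R by (auto simp: eventually_at_top_linorder)
    define z where "z = max z0 0"
    have "classical_solution_on h {\<sigma> z<..} q p"
    proof (rule classical_solution_subset)
      show "classical_solution_on h (time_domain T - C) q p" using S by auto
      show "{\<sigma> z<..} \<subseteq> time_domain T - C"
        using dom(1,3)[of z] T by (fastforce simp: time_domain_def z_def)
    qed
    moreover have "\<bar>fst (q t)\<bar> \<le> R" if t: "\<sigma> z < t" for t
    proof -
      obtain w where "0 \<le> w" "t < \<sigma> w" using unb by blast
      then obtain \<zeta> where "z \<le> \<zeta>" "\<sigma> \<zeta> = t" using hit[of z t w] t by (auto simp: z_def)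
      then show ?thesis using z0[of \<zeta>] abs_fst_le_norm[of "q t"] by (auto simp: z_def)
    qed
    ultimately show ?thesis using no_bounded_eternal_arc by blast
  next
    case True
    then have bdd: "bdd_above (\<sigma> ` {0..})" by (auto simp: bdd_above_def)
    define \<tau> where "\<tau> = Sup (\<sigma> ` {0..})"
    have le: "\<sigma> \<zeta> \<le> \<tau>" if "0 \<le> \<zeta>" for \<zeta>
      unfolding \<tau>_def by (rule cSup_upper) (use that bdd in auto)
    have above: "\<exists>w\<ge>0. t < \<sigma> w" if "t < \<tau>" for t
      using that less_cSup_iff[OF _ bdd, of t] unfolding \<tau>_def by auto
    show ?thesis
    proof (cases "\<exists>w\<ge>0. \<sigma> w = \<tau>")
      case True
      then obtain w where w: "0 \<le> w" "\<sigma> w = \<tau>" by blast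
      have "\<sigma> \<zeta> = \<tau>" if "w \<le> \<zeta>" for \<zeta>
        using mono[of w \<zeta>] le[of \<zeta>] w that by auto
      then have "\<forall>\<^sub>F \<zeta> in at_top. \<sigma> \<zeta> = \<tau>" by (auto simp: eventually_at_top_linorder)
      moreover have "\<tau> \<in> last_arc T C" using A[OF w(1)] w by auto
      ultimately show ?thesis using stop by blast
    next
      case False
      then have lt: "\<sigma> \<zeta> < \<tau>" if "0 \<le> \<zeta>" for \<zeta> using le[OF that] that by fastforce
      have \<tau>0: "0 < \<tau>" using dom(1)[of 0] lt[of 0] by simp
      have dsub: "{0..<\<tau>} \<subseteq> time_domain T"
      proof
        fix t assume t: "t \<in> {0..<\<tau>}"
        then obtain w where "0 \<le> w" "t < \<sigma> w" using above by auto
        then have "ereal t < T" using dom(2)[of w] by (meson ereal_less_eq(3) less_imp_le order_le_less_trans)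
        then show "t \<in> time_domain T" using t by (simp add: time_domain_def)
      qed
      have "C \<subseteq> {0..<\<tau>} - {0}"
        using S dom(3)[of 0] lt[of 0] by (force simp: time_domain_def)
      moreover have "classical_solution_on h ({0..<\<tau>} - C) q p"
        by (rule classical_solution_subset[of h "time_domain T - C"]) (use S dsub in auto)
      moreover have "continuous_on {0..<\<tau>} q"
        by (rule continuous_on_subset[of "time_domain T"]) (use S dsub in auto)
      ultimately have "generalized_solution h (ereal \<tau>) C q p"
        unfolding generalized_solution_def time_domain_ereal using S \<tau>0 by auto
      moreover have "\<forall>\<^sub>F t in at_left \<tau>. P t" if P: "\<forall>\<^sub>F \<zeta> in at_top. P (\<sigma> \<zeta>)" for P
      proof -
        obtain z0 where z0: "\<And>\<zeta>. z0 \<le> \<zeta> \<Longrightarrow> P (\<sigma> \<zeta>)"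
          using P by (auto simp: eventually_at_top_linorder)
        define z where "z = max z0 0"
        have "P t" if t: "\<sigma> z < t" "t < \<tau>" for t
        proof -
          obtain w where "0 \<le> w" "t < \<sigma> w" using above t by blast
          then obtain \<zeta> where "z \<le> \<zeta>" "\<sigma> \<zeta> = t" using hit[of z t w] t by (auto simp: z_def)
          then show ?thesis using z0[of \<zeta>] by (auto simp: z_def)
        qed
        then show ?thesis using lt[of z] by (auto simp: eventually_at_left_field z_def)
      qed
      ultimately show ?thesis using limit[OF \<tau>0] by blast
    qed
  qed
qed

lemma singular_statesI:
  assumes "generalized_solution h (ereal \<tau>) C q p" "singular_end \<tau> q p"
  shows "(q 0, p 0) \<in> singular_states (card C)"
  using assms unfolding singular_states_def by blast

lemma total_collapse_singular:
  assumes "leads_to_total_collapse h (r0, \<alpha>0, \<psi>0)"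
  shows "\<exists>j. (position r0 \<alpha>0, momentum h r0 \<alpha>0 \<psi>0) \<in> singular_states j"
proof -
  obtain T C q p \<sigma> r \<alpha> where start: "solution_from h (r0, \<alpha>0, \<psi>0) T C q p"
    and arc: "rescaled_last_arc h T C q \<sigma> r \<alpha>" and lim: "(r \<longlongrightarrow> 0) at_top"
    using assms unfolding leads_to_total_collapse_def by blast
  have sol: "generalized_solution h T C q p" and init: "q 0 = position r0 \<alpha>0" "p 0 = momentum h r0 \<alpha>0 \<psi>0"
    using start by (auto simp: solution_from_def)
  have qr: "norm (q (\<sigma> \<zeta>)) \<le> r \<zeta>" if "0 \<le> \<zeta>" for \<zeta>
  proof -
    have "0 < r \<zeta>" "reflect (q (\<sigma> \<zeta>)) = position (r \<zeta>) (\<alpha> \<zeta>)"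
      using arc that by (auto simp: rescaled_last_arc_def)
    then have "norm (q (\<sigma> \<zeta>)) = r \<zeta> * exp (- 1 / (r \<zeta>)\<^sup>2)"
      using norm_position[of "r \<zeta>" "\<alpha> \<zeta>"] norm_reflect[of "q (\<sigma> \<zeta>)"] by simp
    also have "\<dots> \<le> r \<zeta> * 1" using \<open>0 < r \<zeta>\<close> by (intro mult_left_mono) auto
    finally show ?thesis by simp
  qed
  have small: "\<forall>\<^sub>F \<zeta> in at_top. norm (q (\<sigma> \<zeta>)) < e" if "0 < e" for e
    using order_tendstoD(2)[OF lim that] eventually_ge_at_top[of 0]
    by eventually_elim (use qr in force)
  have "\<forall>\<^sub>F \<zeta> in at_top. norm (q (\<sigma> \<zeta>)) \<le> 1"
    using small[OF zero_less_one] by eventually_elim simp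
  from sol arc this show ?thesis
  proof (cases rule: rescaled_time_cases)
    case (limit \<tau>)
    have "(q \<longlongrightarrow> 0) (at_left \<tau>)"
      unfolding tendsto_iff dist_norm diff_zero using limit(3)[OF small] by blast
    then have "singular_end \<tau> q p" by (simp add: singular_end_def)
    then show ?thesis using singular_statesI[OF limit(2)] init by auto
  next
    case (stop \<tau>)
    have "norm (q \<tau>) < e" if "0 < e" for e
    proof -
      have "\<forall>\<^sub>F \<zeta> :: real in at_top. norm (q \<tau>) < e"
        using small[OF that] stop(2) by eventually_elim simp
      then show ?thesis by simp
    qed
    then have "q \<tau> = 0" by (metis less_irrefl zero_less_norm_iff)
    moreover have "fst (q \<tau>) \<noteq> 0"
      using sol stop(1) by (intro classical_solutionD(1)[of h "time_domain T - C" q p])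
        (auto simp: generalized_solution_def last_arc_def)
    ultimately show ?thesis by simp
  qed
qed

lemma zero_velocity_singular:
  assumes lead: "leads_to_zero_velocity h (r0, \<alpha>0, \<psi>0)" and pos: "0 < r0" "0 < E_hat h r0 \<alpha>0"
  shows "\<exists>j. (position r0 \<alpha>0, momentum h r0 \<alpha>0 \<psi>0) \<in> singular_states j"
proof -
  obtain T C q p \<sigma> r \<alpha> r1 \<alpha>1 where start: "solution_from h (r0, \<alpha>0, \<psi>0) T C q p"
    and arc: "rescaled_last_arc h T C q \<sigma> r \<alpha>"
    and rest: "0 < r1" "0 < \<alpha>1" "\<alpha>1 < pi / 2" "E_hat h r1 \<alpha>1 = 0"
    and lim: "(r \<longlongrightarrow> r1) at_top" "(\<alpha> \<longlongrightarrow> \<alpha>1) at_top"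
    using lead unfolding leads_to_zero_velocity_def by blast
  have sol: "generalized_solution h T C q p" and init: "q 0 = position r0 \<alpha>0" "p 0 = momentum h r0 \<alpha>0 \<psi>0"
    using start by (auto simp: solution_from_def)
  note S = sol[unfolded generalized_solution_def]
  have cl: "classical_solution_on h (time_domain T - C) q p" using S by auto
  have A: "0 < r \<zeta>" "0 < \<alpha> \<zeta>" "\<alpha> \<zeta> < pi / 2" "reflect (q (\<sigma> \<zeta>)) = position (r \<zeta>) (\<alpha> \<zeta>)"
    "\<sigma> \<zeta> \<in> time_domain T - C" if "0 \<le> \<zeta>" for \<zeta>
    using arc that by (auto simp: rescaled_last_arc_def last_arc_def)
  have pE: "(norm (p (\<sigma> \<zeta>)))\<^sup>2 = pi * E_hat h (r \<zeta>) (\<alpha> \<zeta>) / (r \<zeta>)\<^sup>2" if "0 \<le> \<zeta>" for \<zeta>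
  proof -
    have "potential (position (r \<zeta>) (\<alpha> \<zeta>)) = potential (q (\<sigma> \<zeta>))"
      unfolding A(4)[OF that, symmetric] by (rule potential_reflect)
    then show ?thesis
      using classical_solutionD(5)[OF cl A(5)[OF that]] A(1-3)[OF that] by (simp add: E_hat_eq)
  qed
  define P where "P = position r1 \<alpha>1"
  have P: "0 < fst P" "0 < snd P"
    using rest by (auto simp: P_def position_def intro!: mult_pos_pos cos_gt_zero_pi sin_gt_zero)
  have rl: "((\<lambda>\<zeta>. position (r \<zeta>) (\<alpha> \<zeta>)) \<longlongrightarrow> P) at_top"
    unfolding P_def position_def using rest by (intro tendsto_intros lim) auto
  have sin: "sin (2 * \<alpha>1) > 0" using rest by (intro sin_gt_zero) auto
  have "((\<lambda>\<zeta>. pi * E_hat h (r \<zeta>) (\<alpha> \<zeta>) / (r \<zeta>)\<^sup>2) \<longlongrightarrow> pi * E_hat h r1 \<alpha>1 / r1\<^sup>2) at_top"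
    unfolding E_hat_def using rest sin by (intro tendsto_intros lim) auto
  then have Elim: "((\<lambda>\<zeta>. pi * E_hat h (r \<zeta>) (\<alpha> \<zeta>) / (r \<zeta>)\<^sup>2) \<longlongrightarrow> 0) at_top" using rest by simp
  have psmall: "\<forall>\<^sub>F \<zeta> in at_top. norm (p (\<sigma> \<zeta>)) < e" if e: "0 < e" for e
  proof -
    have "\<forall>\<^sub>F \<zeta> in at_top. pi * E_hat h (r \<zeta>) (\<alpha> \<zeta>) / (r \<zeta>)\<^sup>2 < e\<^sup>2"
      using e by (intro order_tendstoD(2)[OF Elim]) auto
    then show ?thesis using eventually_ge_at_top[of 0]
    proof eventually_elim
      case (elim \<zeta>)
      then have "(norm (p (\<sigma> \<zeta>)))\<^sup>2 < e\<^sup>2" by (simp only: pE)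
      then show ?case by (rule power2_less_imp_less) (use e in simp)
    qed
  qed
  define e where "e = min (fst P) (snd P) / 2"
  have e: "0 < e" "e < fst P" "e < snd P" using P by (auto simp: e_def)
  have qbnd: "\<forall>\<^sub>F \<zeta> in at_top. e \<le> \<bar>fst (q (\<sigma> \<zeta>))\<bar> \<and> e \<le> \<bar>snd (q (\<sigma> \<zeta>))\<bar> \<and> norm (q (\<sigma> \<zeta>)) \<le> norm P + 1"
    using order_tendstoD(1)[OF tendsto_fst[OF rl] e(2)] order_tendstoD(1)[OF tendsto_snd[OF rl] e(3)]
      order_tendstoD(2)[OF tendsto_norm[OF rl] less_add_one] eventually_ge_at_top[of 0]
  proof eventually_elim
    case (elim \<zeta>)
    then have "reflect (q (\<sigma> \<zeta>)) = position (r \<zeta>) (\<alpha> \<zeta>)" using A by auto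
    then have "position (r \<zeta>) (\<alpha> \<zeta>) = (\<bar>fst (q (\<sigma> \<zeta>))\<bar>, \<bar>snd (q (\<sigma> \<zeta>))\<bar>)"
      "norm (position (r \<zeta>) (\<alpha> \<zeta>)) = norm (q (\<sigma> \<zeta>))"
      using norm_reflect[of "q (\<sigma> \<zeta>)"] by (auto simp: reflect_def)
    then show ?case using elim by auto
  qed
  then have "\<forall>\<^sub>F \<zeta> in at_top. norm (q (\<sigma> \<zeta>)) \<le> norm P + 1" by eventually_elim simp
  from sol arc this show ?thesis
  proof (cases rule: rescaled_time_cases)
    case (limit \<tau>)
    have "(p \<longlongrightarrow> 0) (at_left \<tau>)"
      unfolding tendsto_iff dist_norm diff_zero using limit(3)[OF psmall] by blast
    then have "singular_end \<tau> q p"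
      unfolding singular_end_def using limit(3)[OF qbnd] e(1) by blast
    then show ?thesis using singular_statesI[OF limit(2)] init by auto
  next
    case (stop \<tau>)
    \<comment> \<open>rescaled time stops at a point with zero velocity, which the orbit reaches in finite time\<close>
    have "norm (p \<tau>) < e" if "0 < e" for e
    proof -
      have "\<forall>\<^sub>F \<zeta> :: real in at_top. norm (p \<tau>) < e"
        using psmall[OF that] stop(2) by eventually_elim simp
      then show ?thesis by simp
    qed
    then have p0: "p \<tau> = 0" by (metis less_irrefl zero_less_norm_iff)
    have \<tau>: "0 \<le> \<tau>" "ereal \<tau> < T" "\<And>c. c \<in> C \<Longrightarrow> c < \<tau>"
      using stop(1) by (auto simp: last_arc_def time_domain_def)
    have "\<tau> \<noteq> 0"
    proof
      assume "\<tau> = 0"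
      then have "momentum h r0 \<alpha>0 \<psi>0 = 0" using p0 init by simp
      then show False using norm_momentum[of r0 h \<alpha>0 \<psi>0] pos by simp
    qed
    then have \<tau>0: "0 < \<tau>" using \<tau> by simp
    have dsub: "{0..\<tau>} \<subseteq> time_domain T"
      using order_le_less_trans[OF _ \<tau>(2)] by (auto simp: time_domain_def)
    have fin: "finite C" and C0: "C \<subseteq> time_domain T - {0}" using S by auto
    have gen: "generalized_solution h (ereal \<tau>) C q p"
      unfolding generalized_solution_def time_domain_ereal
    proof (intro conjI)
      show "0 < ereal \<tau>" using \<tau>0 by simp
      show "continuous_on {0..<\<tau>} q"
        by (rule continuous_on_subset[of "time_domain T"]) (use S dsub in auto)
      show "C \<subseteq> {0..<\<tau>} - {0}" using C0 \<tau>(3) by (auto simp: time_domain_def)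
      show "classical_solution_on h ({0..<\<tau>} - C) q p"
        by (rule classical_solution_subset[OF cl]) (use dsub in auto)
    qed (use S in auto)
    obtain a where a: "a < \<tau>" "{a<..\<tau>} \<subseteq> time_domain T - C"
    proof
      show "Max (insert 0 C) < \<tau>" using fin \<tau>0 \<tau>(3) by (subst Max_less_iff) auto
      show "{Max (insert 0 C)<..\<tau>} \<subseteq> time_domain T - C"
      proof
        fix t assume t: "t \<in> {Max (insert 0 C)<..\<tau>}"
        then have "0 < t" "\<And>c. c \<in> C \<Longrightarrow> c < t" using fin by auto
        then show "t \<in> time_domain T - C" using dsub t by force
      qed
    qed
    have left: "(f \<longlongrightarrow> f \<tau>) (at_left \<tau>)" if f: "continuous_on (time_domain T - C) f" for f :: "real \<Rightarrow> real \<times> real"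
    proof -
      have "continuous_on {a<..\<tau>} f" by (rule continuous_on_subset[OF f a(2)])
      then have "(f \<longlongrightarrow> f \<tau>) (at \<tau> within {a<..\<tau>})" using a(1) by (auto simp: continuous_on)
      moreover have "at \<tau> within {a<..\<tau>} = at_left \<tau>"
        by (rule at_within_nhd[of _ "{a<..}"]) (use a(1) in auto)
      ultimately show ?thesis by simp
    qed
    have plim: "(p \<longlongrightarrow> 0) (at_left \<tau>)"
      using left[OF classical_solution_continuous(2)[OF cl]] p0 by simp
    have qlim: "(q \<longlongrightarrow> q \<tau>) (at_left \<tau>)"
      by (rule left[OF classical_solution_continuous(1)[OF cl]])
    have q\<tau>: "e / 2 < \<bar>fst (q \<tau>)\<bar> \<and> e / 2 < \<bar>snd (q \<tau>)\<bar>"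
    proof -
      have "\<forall>\<^sub>F \<zeta> :: real in at_top. e \<le> \<bar>fst (q \<tau>)\<bar> \<and> e \<le> \<bar>snd (q \<tau>)\<bar>"
        using qbnd stop(2) by eventually_elim simp
      then show ?thesis using e(1) by auto
    qed
    have "\<forall>\<^sub>F t in at_left \<tau>. e / 2 < \<bar>fst (q t)\<bar>" "\<forall>\<^sub>F t in at_left \<tau>. e / 2 < \<bar>snd (q t)\<bar>"
      "\<forall>\<^sub>F t in at_left \<tau>. norm (q t) < norm (q \<tau>) + 1"
      using order_tendstoD(1)[OF tendsto_rabs[OF tendsto_fst[OF qlim]] conjunct1[OF q\<tau>]]
        order_tendstoD(1)[OF tendsto_rabs[OF tendsto_snd[OF qlim]] conjunct2[OF q\<tau>]]
        order_tendstoD(2)[OF tendsto_norm[OF qlim] less_add_one] .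
    then have "\<forall>\<^sub>F t in at_left \<tau>. e / 2 \<le> \<bar>fst (q t)\<bar> \<and> e / 2 \<le> \<bar>snd (q t)\<bar> \<and> norm (q t) \<le> norm (q \<tau>) + 1"
      by eventually_elim auto
    then have "singular_end \<tau> q p"
      unfolding singular_end_def using plim e(1) by (meson half_gt_zero)
    then show ?thesis using singular_statesI[OF gen] init by auto
  qed
qed

section \<open>From states of all energies to initial conditions of a fixed energy\<close>

lemma negligible_slice:
  fixes N :: "(real \<times> 'a::euclidean_space) set"
  assumes N: "negligible N" and A: "\<And>x. 0 < x \<Longrightarrow> {x} \<times> A \<subseteq> N"
  shows "negligible A"
proof -
  have "N \<in> null_sets lebesgue" using N by (simp add: negligible_iff_null_sets)
  then obtain U where U: "U \<in> null_sets lborel" "N \<subseteq> U"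
    using null_sets_completion_iff2[of N lborel] by auto
  have Ub: "U \<in> sets borel" using U by auto
  have "(\<integral>\<^sup>+x. emeasure lborel (Pair x -` U) \<partial>lborel) = emeasure lborel U"
    using Ub lborel.emeasure_pair_measure_alt[of U lborel, unfolded lborel_prod] by simp
  also have "\<dots> = 0" using U by auto
  finally have ae: "AE x in lborel. emeasure lborel (Pair x -` U) = 0"
    using Ub lborel.measurable_emeasure_Pair[of U lborel, unfolded lborel_prod]
    by (subst (asm) nn_integral_0_iff_AE) auto
  have pos: "\<not> (AE x in lborel. x \<le> (0 :: real))"
  proof
    assume "AE x in lborel. x \<le> (0 :: real)"
    then have "{x :: real. \<not> x \<le> 0} \<in> null_sets lborel"
      using AE_iff_null[of lborel "\<lambda>x :: real. x \<le> 0"] by simp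
    then have "emeasure lborel {x :: real. \<not> x \<le> 0} = 0" by auto
    moreover have "{0<..<1 :: real} \<subseteq> {x. \<not> x \<le> 0}" by auto
    then have "emeasure lborel {0<..<1 :: real} \<le> emeasure lborel {x :: real. \<not> x \<le> 0}"
      by (intro emeasure_mono) auto
    ultimately show False by simp
  qed
  have "\<exists>x>0. emeasure lborel (Pair x -` U) = 0"
  proof (rule ccontr)
    assume neg: "\<not> (\<exists>x>0. emeasure lborel (Pair x -` U) = 0)"
    from ae have "AE x in lborel. x \<le> (0 :: real)"
    proof eventually_elim
      case (elim x)
      then show ?case using neg by (meson not_le)
    qed
    then show False using pos by simp
  qed
  then obtain x where x: "0 < x" "emeasure lborel (Pair x -` U) = 0" by blast
  have "Pair x -` U \<in> sets lborel"
    using measurable_sets[of "Pair x" borel borel U] Ub by simp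
  then have "Pair x -` U \<in> null_sets lborel" using x by (auto intro: null_setsI)
  then have "negligible (Pair x -` U)"
    by (simp add: negligible_iff_null_sets null_sets_completionI)
  moreover have "A \<subseteq> Pair x -` U" using A[OF x(1)] U(2) by auto
  ultimately show ?thesis by (rule negligible_subset)
qed

lemma open_coordinate_region:
  "open {x :: real \<times> real \<times> real. 0 < fst x \<and> 0 < fst (snd x) \<and> fst (snd x) < pi / 2}"
  by (intro open_Collect_conj open_Collect_less continuous_intros)

lemma sin_double_pos: "0 < \<alpha> \<Longrightarrow> \<alpha> < pi / 2 \<Longrightarrow> 0 < sin (2 * \<alpha>)"
  by (intro sin_gt_zero) auto

text \<open>For each \<open>\<alpha>\<close> at most one \<open>r\<close> lies on the zero velocity set.\<close>
lemma negligible_zero_velocity: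
  "negligible {x :: real \<times> real \<times> real. 0 < fst x \<and> 0 < fst (snd x) \<and> fst (snd x) < pi / 2 \<and>
     E_hat h (fst x) (fst (snd x)) = 0}"
    (is "negligible ?Z")
proof -
  define V where "V = {x :: real \<times> real \<times> real. 0 < fst x \<and> 0 < fst (snd x) \<and> fst (snd x) < pi / 2}"
  have V: "open V" unfolding V_def by (rule open_coordinate_region)
  have "continuous_on V (\<lambda>x. E_hat h (fst x) (fst (snd x)))"
    unfolding E_hat_def
    by (intro continuous_intros) (auto simp: V_def dest: sin_double_pos)
  then have "open (V \<inter> (\<lambda>x. E_hat h (fst x) (fst (snd x))) -` (- {0}))"
    using V by (intro continuous_open_preimage) auto
  moreover have Zeq: "?Z = V - (V \<inter> (\<lambda>x. E_hat h (fst x) (fst (snd x))) -` (- {0}))"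
    by (auto simp: V_def)
  ultimately have Z: "?Z \<in> sets borel" using V by (simp only:) auto
  have "emeasure lborel ?Z = (\<integral>\<^sup>+y. emeasure lborel ((\<lambda>r. (r, y)) -` ?Z) \<partial>lborel)"
    using Z lborel_pair.emeasure_pair_measure_alt2[of ?Z, unfolded lborel_prod] by simp
  also have "\<dots> = (\<integral>\<^sup>+y. 0 \<partial>(lborel :: (real \<times> real) measure))"
  proof (rule nn_integral_cong)
    fix y :: "real \<times> real"
    have unique: "r = s" if "(r, y) \<in> ?Z" "(s, y) \<in> ?Z" for r s
    proof -
      have ne: "E_hat h r \<alpha> \<noteq> 0" if "0 < s" "s < r" "E_hat h s \<alpha> = 0" "0 < \<alpha>" "\<alpha> < pi / 2" for r s \<alpha>
      proof
        assume r: "E_hat h r \<alpha> = 0"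
        have "3 / s\<^sup>2 - 3 * ln s - ln (4 * sin (2 * \<alpha>)) = 3 / r\<^sup>2 - 3 * ln r - ln (4 * sin (2 * \<alpha>))"
          using that r E_hat_eq[of s \<alpha> h] E_hat_eq[of r \<alpha> h] potential_position[of s \<alpha>] potential_position[of r \<alpha>]
          by simp
        moreover have "ln s < ln r" using that by simp
        moreover have "3 / r\<^sup>2 < 3 / s\<^sup>2"
          using that by (intro divide_strict_left_mono power_strict_mono mult_pos_pos) auto
        ultimately show False by simp
      qed
      show ?thesis
      proof (cases r s rule: linorder_cases)
        case less
        then show ?thesis using ne[of r s "fst y"] that by auto
      next
        case greater
        then show ?thesis using ne[of s r "fst y"] that by auto
      qed
    qed
    then have "\<exists>r. (\<lambda>r. (r, y)) -` ?Z \<subseteq> {r}"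
      by (metis (mono_tags, lifting) insert_iff subsetI vimage_eq)
    then obtain r where "(\<lambda>r. (r, y)) -` ?Z \<subseteq> {r}" by blast
    then have "finite ((\<lambda>r. (r, y)) -` ?Z)" by (rule finite_subset) simp
    then show "emeasure lborel ((\<lambda>r. (r, y)) -` ?Z) = 0"
      by (intro emeasure_lborel_countable countable_finite)
  qed
  finally have "?Z \<in> null_sets lborel" using Z by (auto intro: null_setsI)
  then show ?thesis by (simp add: negligible_iff_null_sets null_sets_completionI)
qed

text \<open>
  The coordinates \<open>(r, \<alpha>, \<psi>)\<close> on the energy level \<open>h\<close>, extended by the scaling factor \<open>l\<close> of the
  position to local coordinates of states of all energies. The pair of pairs is flattened, so that
  domain and range are the same type.
\<close>
definition scaled_state :: "real \<Rightarrow> real \<times> real \<times> real \<times> real \<Rightarrow> real \<times> real \<times> real \<times> real" where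
  "scaled_state h v = (case v of (l, r, \<alpha>, \<psi>) \<Rightarrow>
     (l * fst (position r \<alpha>), l * snd (position r \<alpha>), fst (momentum h r \<alpha> \<psi>), snd (momentum h r \<alpha> \<psi>)))"

text \<open>
  In polar coordinates for position and momentum the derivative is triangular: the angles decouple,
  the modulus of the momentum depends strictly on \<open>r\<close>, and that of the position on \<open>l\<close>.
\<close>
lemma scaled_state_immersion:
  assumes v: "0 < l" "0 < r" "0 < \<alpha>" "\<alpha> < pi / 2" "0 < E_hat h r \<alpha>"
  obtains D where "(scaled_state h has_derivative D) (at (l, r, \<alpha>, \<psi>))" "inj D"
proof -
  define x where "x = (l, r, \<alpha>, \<psi>)"
  define V where "V = {x :: real \<times> real \<times> real \<times> real. 0 < fst (snd x) \<and> 0 < fst (snd (snd x)) \<and> fst (snd (snd x)) < pi / 2}"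
  have V: "open V" unfolding V_def
    by (intro open_Collect_conj open_Collect_less continuous_intros)
  have xV: "x \<in> V" using v by (simp add: V_def x_def)
  define K where "K = (\<lambda>x :: real \<times> real \<times> real \<times> real.
     2 * pi * (h + (3 / (fst (snd x))\<^sup>2 - 3 * ln (fst (snd x)) - ln (4 * sin (2 * fst (snd (snd x)))))))"
  define \<rho> where "\<rho> = (\<lambda>x :: real \<times> real \<times> real \<times> real. fst x * (fst (snd x) * exp (- 1 / (fst (snd x))\<^sup>2)))"
  define \<Phi> where "\<Phi> = (\<lambda>x :: real \<times> real \<times> real \<times> real.
     (\<rho> x * cos (fst (snd (snd x))), \<rho> x * sin (fst (snd (snd x))),
      sqrt (K x) * cos (snd (snd (snd x))), sqrt (K x) * sin (snd (snd (snd x)))))"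
  have eq: "\<Phi> y = scaled_state h y" if yV: "y \<in> V" for y
  proof -
    obtain l r \<alpha> \<psi> where y: "y = (l, r, \<alpha>, \<psi>)" by (metis prod.collapse)
    have r: "0 < r" "0 < \<alpha>" "\<alpha> < pi / 2" using yV by (auto simp: y V_def)
    have "K y = pi * E_hat h r \<alpha> / r\<^sup>2"
      using r by (simp add: y K_def E_hat_eq[OF r] potential_position[OF r])
    then have "sqrt (K y) = sqrt (pi * E_hat h r \<alpha>) / r"
      using r by (simp add: real_sqrt_divide)
    then show ?thesis
      by (simp add: \<Phi>_def y scaled_state_def position_def momentum_def \<rho>_def)
  qed
  have K0: "0 < K x"
  proof -
    have "K x = pi * E_hat h r \<alpha> / r\<^sup>2"
      using v by (simp add: x_def K_def E_hat_eq potential_position)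
    then show ?thesis using v by simp
  qed
  have s2: "0 < sin (2 * \<alpha>)" using v by (intro sin_double_pos)
  define KD where "KD = (\<lambda>y :: real \<times> real \<times> real \<times> real.
     2 * pi * ((- 6 / r ^ 3 - 3 / r) * fst (snd y) - 2 * cos (2 * \<alpha>) / sin (2 * \<alpha>) * fst (snd (snd y))))"
  have dK: "(K has_derivative KD) (at x)"
    unfolding K_def KD_def using v s2
    by (auto intro!: derivative_eq_intros simp: x_def fun_eq_iff field_simps power2_eq_square power3_eq_cube)
  define SD where "SD = (\<lambda>y. KD y * (inverse (sqrt (K x)) / 2))"
  have dS: "((\<lambda>x. sqrt (K x)) has_derivative SD) (at x)"
    unfolding SD_def using has_derivative_real_sqrt[where g = K, OF K0 dK] by simp
  define RD where "RD = (\<lambda>y :: real \<times> real \<times> real \<times> real.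
     fst y * (r * exp (- 1 / r\<^sup>2)) + l * (exp (- 1 / r\<^sup>2) * (1 + 2 / r\<^sup>2)) * fst (snd y))"
  have dR: "(\<rho> has_derivative RD) (at x)"
    unfolding \<rho>_def RD_def using v
    by (auto intro!: derivative_eq_intros simp: x_def fun_eq_iff field_simps power2_eq_square)
  define D where "D = (\<lambda>y :: real \<times> real \<times> real \<times> real.
     (RD y * cos \<alpha> - \<rho> x * sin \<alpha> * fst (snd (snd y)), RD y * sin \<alpha> + \<rho> x * cos \<alpha> * fst (snd (snd y)),
      SD y * cos \<psi> - sqrt (K x) * sin \<psi> * snd (snd (snd y)), SD y * sin \<psi> + sqrt (K x) * cos \<psi> * snd (snd (snd y))))"
  have d\<Phi>: "(\<Phi> has_derivative D) (at x)"
    unfolding \<Phi>_def D_def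
    by (rule derivative_eq_intros dR dS refl | simp add: x_def fun_eq_iff algebra_simps)+
  have "(scaled_state h has_derivative D) (at x)"
    by (rule has_derivative_transform_within_open[OF d\<Phi> V xV eq])
  moreover have "inj D"
  proof -
    have "linear D" using d\<Phi> by (rule has_derivative_linear)
    moreover have "y = 0" if "D y = 0" for y
    proof -
      have polar: "a = 0 \<and> b = 0" if "a * cos \<phi> - b * sin \<phi> = 0" "a * sin \<phi> + b * cos \<phi> = 0" for a b \<phi> :: real
      proof -
        have "a * ((sin \<phi>)\<^sup>2 + (cos \<phi>)\<^sup>2)
            = (a * cos \<phi> - b * sin \<phi>) * cos \<phi> + (a * sin \<phi> + b * cos \<phi>) * sin \<phi>"
          by algebra
        moreover have "b * ((sin \<phi>)\<^sup>2 + (cos \<phi>)\<^sup>2)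
            = (a * sin \<phi> + b * cos \<phi>) * cos \<phi> - (a * cos \<phi> - b * sin \<phi>) * sin \<phi>"
          by algebra
        ultimately show ?thesis unfolding that sin_cos_squared_add by simp
      qed
      have \<rho>0: "\<rho> x \<noteq> 0" using v by (simp add: \<rho>_def x_def)
      have "RD y = 0 \<and> \<rho> x * fst (snd (snd y)) = 0"
        using that by (intro polar[of _ \<alpha>]) (auto simp: D_def zero_prod_def mult_ac)
      then have RD: "RD y = 0" and a: "fst (snd (snd y)) = 0" using \<rho>0 by auto
      have "SD y = 0 \<and> sqrt (K x) * snd (snd (snd y)) = 0"
        using that by (intro polar[of _ \<psi>]) (auto simp: D_def zero_prod_def mult_ac)
      then have SD: "SD y = 0" and b: "snd (snd (snd y)) = 0" using K0 by auto
      have "KD y = 0" using SD K0 by (simp add: SD_def)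
      then have "(- 6 / r ^ 3 - 3 / r) * fst (snd y) = 0" using a by (simp add: KD_def)
      moreover have "- 6 / r ^ 3 - 3 / r < 0"
      proof -
        have "0 < 6 / r ^ 3" "0 < 3 / r" using v by auto
        then show ?thesis unfolding minus_divide_left[symmetric] by linarith
      qed
      ultimately have c: "fst (snd y) = 0" by (metis less_irrefl mult_eq_0_iff)
      have "fst y = 0" using RD c v by (simp add: RD_def)
      then show ?thesis using a b c by (simp add: prod_eq_iff)
    qed
    ultimately show ?thesis using linear_injective_0 by blast
  qed
  ultimately show ?thesis using that unfolding x_def by blast
qed

theorem theorem6p6:
  fixes h :: real
  shows "{x \<in> allowed_region h. leads_to_total_collapse h x \<or> leads_to_zero_velocity h x}
           \<in> null_sets (lebesgue :: (real \<times> real \<times> real) measure)"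
proof -
  define N where "N = (\<Union>j. singular_states j)"
  define flat :: "(real \<times> real) \<times> (real \<times> real) \<Rightarrow> real \<times> real \<times> real \<times> real"
    where "flat = (\<lambda>z. (fst (fst z), snd (fst z), fst (snd z), snd (snd z)))"
  have "negligible N" unfolding N_def by (rule negligible_Union_nat) (rule negligible_singular_states)
  then have M: "negligible (flat ` N)"
    unfolding flat_def
    by (intro negligible_differentiable_image_negligible)
      (auto intro!: linear_imp_differentiable_on linearI)
  define S where "S = {v :: real \<times> real \<times> real \<times> real. 0 < fst v \<and> 0 < fst (snd v) \<and>
     0 < fst (snd (snd v)) \<and> fst (snd (snd v)) < pi / 2 \<and> 0 < E_hat h (fst (snd v)) (fst (snd (snd v)))}"
  have "\<exists>D. (scaled_state h has_derivative D) (at v) \<and> inj D" if "v \<in> S" for v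
  proof -
    obtain l r \<alpha> \<psi> where "v = (l, r, \<alpha>, \<psi>)" by (metis prod.collapse)
    then show ?thesis using that scaled_state_immersion[of l r \<alpha> h \<psi>] by (auto simp: S_def)
  qed
  then obtain D where "\<And>v. v \<in> S \<Longrightarrow> (scaled_state h has_derivative D v) (at v) \<and> inj (D v)" by metis
  then have pre: "negligible {v \<in> S. scaled_state h v \<in> flat ` N}"
    by (intro negligible_differentiable_vimage[OF M, of S D]) (auto intro: has_derivative_at_withinI)
  define A where "A = {x \<in> allowed_region h. leads_to_total_collapse h x \<or> leads_to_zero_velocity h x}"
  define Z where "Z = {x :: real \<times> real \<times> real. 0 < fst x \<and> 0 < fst (snd x) \<and> fst (snd x) < pi / 2 \<and>
     E_hat h (fst x) (fst (snd x)) = 0}"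
  have "negligible (A - Z)"
  proof (rule negligible_slice[OF pre])
    fix l :: real assume l: "0 < l"
    show "{l} \<times> (A - Z) \<subseteq> {v \<in> S. scaled_state h v \<in> flat ` N}"
    proof clarify
      fix r \<alpha> \<psi> assume x: "(r, \<alpha>, \<psi>) \<in> A" "(r, \<alpha>, \<psi>) \<notin> Z"
      then have r: "0 < r" "0 < \<alpha>" "\<alpha> < pi / 2" "0 < E_hat h r \<alpha>"
        by (auto simp: A_def Z_def allowed_region_def)
      have "\<exists>j. (position r \<alpha>, momentum h r \<alpha> \<psi>) \<in> singular_states j"
        using x(1) total_collapse_singular[of h r \<alpha> \<psi>] zero_velocity_singular[of h r \<alpha> \<psi>] r
        by (auto simp: A_def)
      then obtain j where "(position r \<alpha>, momentum h r \<alpha> \<psi>) \<in> singular_states j" by blast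
      from singular_states_scale[OF this l]
      have "(l *\<^sub>R position r \<alpha>, momentum h r \<alpha> \<psi>) \<in> N" by (auto simp: N_def)
      moreover have "scaled_state h (l, r, \<alpha>, \<psi>) = flat (l *\<^sub>R position r \<alpha>, momentum h r \<alpha> \<psi>)"
        by (simp add: scaled_state_def flat_def)
      ultimately show "(l, r, \<alpha>, \<psi>) \<in> S \<and> scaled_state h (l, r, \<alpha>, \<psi>) \<in> flat ` N"
        using l r by (auto simp: S_def)
    qed
  qed
  moreover have "negligible Z" unfolding Z_def by (rule negligible_zero_velocity)
  ultimately have "negligible ((A - Z) \<union> Z)" by (rule negligible_Un)
  then have "negligible A" by (rule negligible_subset) auto
  then show ?thesis by (simp add: A_def negligible_iff_null_sets)
qed

end
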